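(* For every real $\nu>0$, $$\int_{0}^{R^{(-1)}\left(\sqrt[5]{\frac{-11+5\sqrt5}{2}}\right)} f(-q)^4\, q^{-5/6}\, R(q)^{5\nu}\,dq=\Gamma\!\left(\tfrac56\right)\left(\frac{11+5\sqrt5}{2}\right)^{-\frac16-\nu}\frac{\Gamma\left(\frac16+\nu\right)}{\Gamma(1+\nu)}\;{}_2F_1\!\left(\tfrac16,\tfrac16+\nu;1+\nu;\frac{11-5\sqrt5}{11+5\sqrt5}\right).$$
   Context: For $|q|<1$, $f(-q):=\prod_{n=1}^{\infty}(1-q^n)$, and $R(q)$ is the Rogers–Ramanujan continued fraction $$R(q):=\cfrac{q^{1/5}}{1+\cfrac{q}{1+\cfrac{q^2}{1+\cfrac{q^3}{1+\cdots}}}},$$ considered here for real $q\in[0,1)$ with the nonnegative real fifth root. $R$ is extended continuously to $q=1$ by $R(1)=\lim_{q\to1^-}R(q)$, and $R^{(-1)}$ denotes the inverse function of $R:[0,1]\to[0,R(1)]$ (an increasing function). ${}_2F_1(a,b;c;z)=\sum_{n\ge0}\frac{(a)_n(b)_n}{(c)_n}\frac{z^n}{n!}$ is the Gauss hypergeometric function, with $(s)_n=\Gamma(s+n)/\Gamma(s)$. *)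

theory Defs
  imports "HOL-Analysis.Analysis"
begin

text \<open>
  Ramanujan's one-variable theta function, written so that
  \<open>ramanujan_f (- q) = (\<Prod>n. 1 - q ^ Suc n)\<close>; it is meant for arguments of absolute value below 1.
\<close>

definition ramanujan_f :: "real \<Rightarrow> real" where
  "ramanujan_f x = (\<Prod>n. 1 - (- x) ^ Suc n)"

text \<open>
  The finite fraction
  \<open>rr_denom n k q = 1 + q^k / (1 + q^(k+1) / (\<dots> / (1 + q^(k+n-1))))\<close>.
\<close>

primrec rr_denom :: "nat \<Rightarrow> nat \<Rightarrow> real \<Rightarrow> real" where
  "rr_denom 0 k q = 1"
| "rr_denom (Suc n) k q = 1 + q ^ k / rr_denom n (Suc k) q"

text \<open>
  The infinite continued fraction is the limit of its convergents
  \<open>q^(1/5)/1, q^(1/5)/(1 + q), \<dots>\<close>; it is meant for \<open>0 \<le> q < 1\<close>.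
\<close>

definition rr_fraction :: "real \<Rightarrow> real" where
  "rr_fraction q = lim (\<lambda>n. root 5 q / rr_denom n 1 q)"

definition rr_R :: "real \<Rightarrow> real" where
  "rr_R q = (if q = 1 then Lim (at_left 1) rr_fraction else rr_fraction q)"

definition rr_R_inv :: "real \<Rightarrow> real" where
  "rr_R_inv = inv_into {0..1} rr_R"

definition hyp_2F1 :: "real \<Rightarrow> real \<Rightarrow> real \<Rightarrow> real \<Rightarrow> real" where
  "hyp_2F1 a b c z =
     (\<Sum>n. pochhammer a n * pochhammer b n / pochhammer c n * (z ^ n / fact n))"

end

theory Submission
  imports Defs "HOL-Complex_Analysis.Complex_Analysis"
begin

text \<open>
  Put \<open>u = R(q) ^ 5\<close>. Two classical identities make the integral a Beta-type integral:
  \<open>q u' / u = f(-q) ^ 5 / f(-q ^ 5)\<close> and \<open>1 / u - 11 - u = f(-q) ^ 6 / (q f(-q ^ 5) ^ 6)\<close>.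
  They turn the integrand into \<open>u ^ (\<nu> - 5/6) (1 - 11 u - u\<^sup>2) ^ (-1/6) du\<close>. Since
  \<open>1 - 11 u - u\<^sup>2\<close> vanishes at \<open>u\<^sub>1 = (-11 + 5 sqrt 5) / 2\<close> and \<open>f(-q) / f(-q ^ 5) \<le> 1 - q\<close>,
  \<open>u\<close> increases from \<open>0\<close> to \<open>u\<^sub>1\<close> on \<open>[0, 1]\<close>; in particular the upper limit of integration is \<open>1\<close>,
  and Euler's integral for the hypergeometric function gives the result.

  Both identities come from the three-term relation of the theta function \<open>T\<close> that plays the role of
  Weierstrass' \<open>\<sigma>\<close>, a consequence of the Jacobi triple product. Differentiating that relation once
  and twice gives
  \<open>L(w + v) + L(w - v) - 2 L(w) = T'(0) T(2 w) T(v)\<^sup>2 / (T(w)\<^sup>2 T(w + v) T(w - v))\<close> and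
  \<open>L'(w) - L'(v) = T'(0)\<^sup>2 T(w + v) T(w - v) / (T(w)\<^sup>2 T(v)\<^sup>2)\<close> for \<open>L = T' / T\<close>, where
  \<open>L\<close> has a Lambert series. The first formula is used at \<open>e ^ w = q, q\<^sup>2\<close> with base \<open>q ^ 5\<close> and at
  \<open>e ^ w = \<zeta>, \<zeta>\<^sup>2\<close>, \<open>\<zeta> ^ 5 = 1\<close>, with base \<open>q\<close>. In all four cases the Lambert series are combinations
  of the same two series of weight one, so that \<open>f(-q) ^ 5 / f(-q ^ 5)\<close> is the quadratic form
  \<open>\<alpha>\<^sup>2 - 11 \<alpha> \<beta> - \<beta>\<^sup>2\<close> in two theta quotients with \<open>\<beta> / \<alpha> = u\<close>. The second formula, at the roots of
  unity, gives the derivative of \<open>u\<close>.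
\<close>

subsection \<open>The Jacobi triple product\<close>

text \<open>What links the two bases is a count of dimensions. Odd functions on the residues modulo
  5 form a plane. In \<open>L\<close> at \<open>q\<close> and \<open>q ^ 2\<close> with base
  \<open>q ^ 5\<close>, and at the nontrivial fifth roots of unity with base \<open>q\<close>, the
  coefficients of the Lambert series are odd functions of this kind, so \<open>lambert14\<close>,
  \<open>lambert23\<close> and constants express them all. The 11 is what remains of the products of
  \<open>zeta5 - zeta5 ^ 4\<close> and \<open>zeta5 ^ 2 - zeta5 ^ 3\<close> in this change of basis.

  A separate argument is needed to see that the limit of the convergents is a theta quotient at all.
  The sums H_j = \<open>hw_sum q j\<close> satisfy H_j = H_(j+1) + q^(j+1) H_(j+2) and have a
  positive limit. Hence they are positive, their ratios H_j / H_(j+1) obey the recursion of the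
  continued fraction, and the error of a convergent shrinks at least geometrically. For j = 0 and j
  = 1 the sums are theta series, which the triple product turns into products.

  The behaviour at q = 1, usually read off from a modular transformation, is obtained here by
  elementary bounds on the products.\<close>

definition qfac :: "complex \<Rightarrow> nat \<Rightarrow> complex" where
  "qfac p n = (\<Prod>i<n. 1 - p ^ Suc i)"

definition qpoch :: "complex \<Rightarrow> complex \<Rightarrow> complex" where
  "qpoch z p = (\<Prod>n. 1 - z * p ^ n)"

text \<open>A theta function in multiplicative notation: for \<open>0 < norm p < 1\<close> its zeros
  in \<open>z\<close> are the integer powers of \<open>p\<close>, and
  \<open>jacobi_triple_product\<close> expands it as a bilateral series.\<close>

definition jtheta :: "complex \<Rightarrow> complex \<Rightarrow> complex" where
  "jtheta z p = qpoch z p * qpoch (p / z) p"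

lemma one_minus_power_nonzero:
  fixes p :: complex
  assumes "norm p < 1"
  shows "1 - p ^ Suc i \<noteq> 0"
proof
  assume "1 - p ^ Suc i = 0"
  hence "norm (p ^ Suc i) = 1" by simp
  thus False using assms power_Suc_less_one[of "norm p" i] by (cases "p = 0") (auto simp: norm_power norm_mult)
qed

lemma qfac_nonzero: "norm p < 1 \<Longrightarrow> qfac p n \<noteq> 0"
  using one_minus_power_nonzero [of p] by (simp add: qfac_def)

lemma qfac_Suc: "qfac p (Suc n) = qfac p n * (1 - p ^ Suc n)"
  by (simp add: qfac_def)

section \<open>Gaussian binomial coefficients and the finite triple product\<close>

lemma choose_two_Suc: "Suc k choose 2 = (k choose 2) + k"
  by (simp add: numeral_2_eq_2)

text \<open>The Gaussian binomial coefficient. The value 0 for \<open>k > n\<close> is set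
  explicitly because \<open>n - k\<close> truncates; with it the Pascal rule holds at
  \<open>k = n\<close> as well.\<close>

definition qbin :: "complex \<Rightarrow> nat \<Rightarrow> nat \<Rightarrow> complex" where
  "qbin p n k = (if k \<le> n then qfac p n / (qfac p k * qfac p (n - k)) else 0)"

lemma qbin_0: "norm p < 1 \<Longrightarrow> qbin p n 0 = 1"
  by (simp add: qbin_def qfac_nonzero, simp add: qfac_def)

text \<open>Of the two q-Pascal rules this is the one that fits \<open>q_binomial\<close>:
  \<open>p ^ (n - k)\<close> and \<open>p ^ (Suc k choose 2)\<close> combine to
  \<open>p ^ (k choose 2) * p ^ n\<close>, so the new factor \<open>1 + x * p ^ n\<close> splits
  off.\<close>

lemma qbin_Suc_Suc:
  assumes "norm p < 1" "k \<le> n"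
  shows "qbin p (Suc n) (Suc k) = qbin p n (Suc k) + p ^ (n - k) * qbin p n k"
proof (cases "k = n")
  case True
  then show ?thesis using assms by (simp add: qbin_def qfac_nonzero)
next
  case False
  then obtain d where n: "n = Suc (k + d)" using assms(2) less_imp_Suc_add by fastforce
  have nz: "qfac p j \<noteq> 0" "1 - p ^ Suc j \<noteq> 0" for j
    using assms qfac_nonzero one_minus_power_nonzero by auto
  have "qfac p (Suc n) = qfac p n * (1 - p ^ Suc n)" by (rule qfac_Suc)
  then have "qbin p (Suc n) (Suc k) = qfac p n * (1 - p ^ Suc n) / (qfac p (Suc k) * qfac p (Suc d))"
    by (simp add: qbin_def n)
  moreover have "qbin p n (Suc k) = qfac p n / (qfac p (Suc k) * qfac p d)"
    "qbin p n k = qfac p n / (qfac p k * qfac p (Suc d))"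
    by (simp_all add: qbin_def n)
  moreover have "p ^ Suc n = p ^ Suc k * p ^ Suc d" by (simp add: n power_add)
  moreover have "n - k = Suc d" by (simp add: n)
  moreover have "qfac p (Suc k) = qfac p k * (1 - p ^ Suc k)" "qfac p (Suc d) = qfac p d * (1 - p ^ Suc d)"
    by (rule qfac_Suc)+
  moreover have "F * (1 - x * y) / (K * (1 - x) * (D * (1 - y))) = F / (K * (1 - x) * D) + y * (F / (K * (D * (1 - y))))"
    if "K \<noteq> 0" "D \<noteq> 0" "1 - x \<noteq> 0" "1 - y \<noteq> 0" for F K D x y :: complex
    using that by (simp add: divide_simps) (simp add: algebra_simps)
  ultimately show ?thesis using nz[of k] nz[of d] by (simp del: power_Suc)
qed

theorem q_binomial:
  assumes "norm p < 1"
  shows "(\<Prod>i<n. 1 + x * p ^ i) = (\<Sum>k\<le>n. qbin p n k * p ^ (k choose 2) * x ^ k)"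
proof (induction n)
  case 0
  show ?case using assms by (simp add: qbin_0 numeral_2_eq_2)
next
  case (Suc n)
  have "(\<Sum>k\<le>Suc n. qbin p (Suc n) k * p ^ (k choose 2) * x ^ k) =
     1 + (\<Sum>k\<le>n. qbin p (Suc n) (Suc k) * p ^ (Suc k choose 2) * x ^ Suc k)"
    using assms by (subst sum.atMost_Suc_shift) (simp add: qbin_0 numeral_2_eq_2)
  also have "(\<Sum>k\<le>n. qbin p (Suc n) (Suc k) * p ^ (Suc k choose 2) * x ^ Suc k) =
     (\<Sum>k\<le>n. qbin p n (Suc k) * p ^ (Suc k choose 2) * x ^ Suc k) +
     (\<Sum>k\<le>n. qbin p n k * p ^ (k choose 2) * x ^ k * (x * p ^ n))"
  proof (subst sum.distrib [symmetric], rule sum.cong [OF refl])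
    fix k assume k: "k \<in> {..n}"
    have "p ^ (n - k) * p ^ (Suc k choose 2) = p ^ (k choose 2) * p ^ n"
      using k by (simp add: choose_two_Suc power_add [symmetric] add.commute)
    then have "p ^ (n - k) * qbin p n k * p ^ (Suc k choose 2) * x ^ Suc k =
       qbin p n k * p ^ (k choose 2) * x ^ k * (x * p ^ n)"
      by (simp add: mult_ac)
    then show "qbin p (Suc n) (Suc k) * p ^ (Suc k choose 2) * x ^ Suc k =
       qbin p n (Suc k) * p ^ (Suc k choose 2) * x ^ Suc k +
       qbin p n k * p ^ (k choose 2) * x ^ k * (x * p ^ n)"
      using k assms by (simp add: qbin_Suc_Suc distrib_right del: power_Suc)
  qed
  also have "1 + ((\<Sum>k\<le>n. qbin p n (Suc k) * p ^ (Suc k choose 2) * x ^ Suc k) +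
     (\<Sum>k\<le>n. qbin p n k * p ^ (k choose 2) * x ^ k * (x * p ^ n))) =
     (\<Sum>k\<le>Suc n. qbin p n k * p ^ (k choose 2) * x ^ k) + (\<Sum>k\<le>n. qbin p n k * p ^ (k choose 2) * x ^ k) * (x * p ^ n)"
    using assms by (subst sum.atMost_Suc_shift) (simp add: qbin_0 sum_distrib_right numeral_2_eq_2)
  also have "(\<Sum>k\<le>Suc n. qbin p n k * p ^ (k choose 2) * x ^ k) = (\<Sum>k\<le>n. qbin p n k * p ^ (k choose 2) * x ^ k)"
    by (simp add: qbin_def)
  finally show ?case using Suc by (simp add: algebra_simps)
qed

lemma choose_two_int: "int (m choose 2) = int m * (int m - 1) div 2"
  by (simp add: choose_two of_nat_diff zdiv_int) (cases m, auto simp: algebra_simps)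

text \<open>Shifting the variable by \<open>p ^ N\<close> in the q-binomial theorem with
  \<open>2 * N\<close> factors makes it symmetric: the upper half of the product gives the factors
  in \<open>z\<close>, the lower half, read backwards, those in \<open>p / z\<close>, and the
  summation index is centred at \<open>N\<close>.\<close>

lemma finite_jacobi_triple_product:
  fixes p z :: complex
  assumes p: "norm p < 1" "p \<noteq> 0" and z: "z \<noteq> 0"
  shows "(\<Prod>i<N. (1 - z * p ^ i) * (1 - p / z * p ^ i)) =
    (\<Sum>k\<le>2*N. qbin p (2*N) k * ((-z) powi (int k - int N) * p powi ((int k - int N) * (int k - int N - 1) div 2)))"
proof -
  define x where "x = - z * p powi (- int N)"
  have "(\<Prod>i<2*N. 1 + x * p ^ i) = (\<Prod>i<N. 1 + x * p ^ i) * (\<Prod>i=N..<2*N. 1 + x * p ^ i)"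
    by (simp add: lessThan_atLeast0 prod.atLeastLessThan_concat)
  also have "(\<Prod>i=N..<2*N. 1 + x * p ^ i) = (\<Prod>i<N. 1 - z * p ^ i)"
  proof -
    have "(\<Prod>i=N..<2*N. 1 + x * p ^ i) = (\<Prod>i<N. 1 + x * p ^ (i + N))"
      by (simp add: lessThan_atLeast0 prod.shift_bounds_nat_ivl[of _ 0 N N, simplified] mult_2)
    then show ?thesis using p by (simp add: x_def power_add power_int_minus field_simps)
  qed
  \<comment> \<open>Each factor \<open>1 - z / p ^ Suc i\<close> is turned over by taking out
    \<open>- z / p ^ Suc i\<close>; the product of what is taken out is divided off at the
    end.\<close>
  also have "(\<Prod>i<N. 1 + x * p ^ i) = (\<Prod>i<N. (1 - p / z * p ^ i) * (-z / p ^ Suc i))"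
  proof -
    have "(\<Prod>i<N. 1 + x * p ^ i) = (\<Prod>i<N. 1 + x * p ^ (N - Suc i))"
      by (rule prod.nat_diff_reindex [symmetric])
    also have "\<dots> = (\<Prod>i<N. (1 - p / z * p ^ i) * (-z / p ^ Suc i))"
    proof (rule prod.cong [OF refl])
      fix i assume i: "i \<in> {..<N}"
      have "p ^ N = p ^ (N - Suc i) * p ^ Suc i" using i by (simp only: power_add [symmetric]) simp
      then have "x * p ^ (N - Suc i) = - z / p ^ Suc i"
        using p by (simp add: x_def power_int_minus field_simps)
      then show "1 + x * p ^ (N - Suc i) = (1 - p / z * p ^ i) * (-z / p ^ Suc i)"
        using p z by (simp only:) (simp add: field_simps)
    qed
    finally show ?thesis .
  qed
  also have "\<dots> = (\<Prod>i<N. 1 - p / z * p ^ i) * ((-z) ^ N / p ^ (Suc N choose 2))"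
  proof -
    have "(\<Prod>i<N. - z / p ^ Suc i) = (-z) ^ N / p ^ (Suc N choose 2)"
      by (induction N) (simp_all add: choose_two_Suc power_add, simp_all add: numeral_2_eq_2 mult_ac)
    then show ?thesis by (simp only: prod.distrib)
  qed
  finally have *: "(\<Prod>i<2*N. 1 + x * p ^ i) =
     (\<Prod>i<N. (1 - z * p ^ i) * (1 - p / z * p ^ i)) * ((-z) ^ N / p ^ (Suc N choose 2))"
    by (simp add: prod.distrib mult_ac)
  have "(\<Prod>i<N. (1 - z * p ^ i) * (1 - p / z * p ^ i)) =
      (\<Sum>k\<le>2*N. qbin p (2*N) k * p ^ (k choose 2) * x ^ k) * (p ^ (Suc N choose 2) / (-z) ^ N)"
    using * p z by (simp add: q_binomial [OF p(1), symmetric])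
  also have "\<dots> = (\<Sum>k\<le>2*N. qbin p (2*N) k * ((-z) powi (int k - int N) * p powi ((int k - int N) * (int k - int N - 1) div 2)))"
    unfolding sum_distrib_right
  proof (rule sum.cong [OF refl])
    fix k
    have e: "(int k - int N) * (int k - int N - 1) div 2 = int (k choose 2) + int (Suc N choose 2) - int N * int k"
    proof -
      have "2 * int (k choose 2) = int k * (int k - 1)" "2 * int (Suc N choose 2) = (int N + 1) * int N"
        unfolding choose_two_int by (simp_all add: algebra_simps)
      then have "(int k - int N) * (int k - int N - 1) = 2 * (int (k choose 2) + int (Suc N choose 2) - int N * int k)"
        by (simp add: algebra_simps)
      then show ?thesis by simp
    qed
    have x: "x ^ k = (-z) ^ k * p powi (- (int N * int k))"
      unfolding x_def power_mult_distrib by (simp only: power_int_mult power_int_of_nat flip: mult_minus_left)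
    have "p powi ((int k - int N) * (int k - int N - 1) div 2) = p ^ (k choose 2) * p ^ (Suc N choose 2) * p powi (- (int N * int k))"
      unfolding e using p by (simp add: power_int_diff power_int_add power_int_minus divide_inverse)
    moreover have "(-z) powi (int k - int N) = (-z) ^ k / (-z) ^ N"
      using z by (simp add: power_int_diff)
    ultimately show "qbin p (2*N) k * p ^ (k choose 2) * x ^ k * (p ^ (Suc N choose 2) / (-z) ^ N) =
       qbin p (2*N) k * ((-z) powi (int k - int N) * p powi ((int k - int N) * (int k - int N - 1) div 2))"
      by (simp add: x)
  qed
  finally show ?thesis .
qed


section \<open>Bilateral series and the limit of the finite identity\<close>

lemma summable_on_int_iff:
  fixes f :: "int \<Rightarrow> real"
  assumes "summable (\<lambda>n. f (int n))" "summable (\<lambda>n. f (- int n))" "\<And>n. f n \<ge> 0"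
  shows "f summable_on UNIV"
proof -
  have 1: "f summable_on (range int)"
    using assms by (subst summable_on_reindex) (auto simp: o_def summable_on_UNIV_nonneg_real_iff)
  have 2: "f summable_on (range (\<lambda>n. - int n))"
    using assms by (subst summable_on_reindex) (auto simp: o_def summable_on_UNIV_nonneg_real_iff inj_def)
  have "UNIV = range int \<union> range (\<lambda>n. - int n)"
  proof (intro set_eqI iffI UNIV_I)
    fix x :: int show "x \<in> range int \<union> range (\<lambda>n. - int n)" by (cases x rule: int_cases2) auto
  qed
  then show ?thesis using summable_on_union [OF 1 2] by simp
qed

lemma summable_power_choose_two:
  fixes r x :: real
  assumes "0 \<le> r" "r < 1" "x \<ge> 0"
  shows "summable (\<lambda>n. x ^ n * r ^ (n choose 2))"
proof -
  have "(\<lambda>n. x * r ^ n) \<longlonglongrightarrow> x * 0"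
    by (intro tendsto_intros LIMSEQ_power_zero) (use assms in auto)
  then have "eventually (\<lambda>n. x * r ^ n < 1/2) sequentially"
    by (intro order_tendstoD) auto
  then obtain N where N: "x * r ^ n \<le> 1/2" if "n \<ge> N" for n
    unfolding eventually_sequentially by (meson less_imp_le)
  show ?thesis
  proof (rule summable_ratio_test [of "1/2" N])
    fix n assume "n \<ge> N"
    have "norm (x ^ Suc n * r ^ (Suc n choose 2)) = (x * r ^ n) * (x ^ n * r ^ (n choose 2))"
      using assms by (simp add: choose_two_Suc power_add)
    also have "\<dots> \<le> 1/2 * (x ^ n * r ^ (n choose 2))"
      using N [OF \<open>n \<ge> N\<close>] assms by (intro mult_right_mono) auto
    finally show "norm (x ^ Suc n * r ^ (Suc n choose 2)) \<le> 1/2 * norm (x ^ n * r ^ (n choose 2))"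
      using assms by simp
  qed simp
qed

text \<open>\<open>n * (n - 1)\<close> is even and nonnegative for every integer \<open>n\<close>,
  so \<open>div\<close> is exact and no negative power of \<open>p\<close> occurs.\<close>

definition theta_term :: "complex \<Rightarrow> complex \<Rightarrow> int \<Rightarrow> complex" where
  "theta_term z p n = (- z) powi n * p powi (n * (n - 1) div 2)"

lemma theta_term_abs_summable:
  assumes "norm p < 1" "p \<noteq> 0" "z \<noteq> 0"
  shows "(\<lambda>n. norm (theta_term z p n)) summable_on UNIV"
proof (rule summable_on_int_iff)
  have "norm (theta_term z p (int n)) = norm z ^ n * norm p ^ (n choose 2)" for n
    by (simp add: theta_term_def norm_mult norm_power_int norm_power flip: choose_two_int)
  then show "summable (\<lambda>n. norm (theta_term z p (int n)))"
    using summable_power_choose_two [of "norm p" "norm z"] assms by simp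
  have "norm (theta_term z p (- int n)) = (norm (p / z)) ^ n * norm p ^ (n choose 2)" for n
  proof -
    have "- int n * (- int n - 1) div 2 = int (Suc n choose 2)"
      unfolding choose_two_int by (simp add: algebra_simps)
    also have "\<dots> = int ((n choose 2) + n)" by (simp add: choose_two_Suc)
    finally have "theta_term z p (- int n) = (- z) powi (- int n) * p ^ ((n choose 2) + n)"
      unfolding theta_term_def by (simp only: power_int_of_nat)
    then show ?thesis
      by (simp add: norm_mult norm_power_int norm_divide norm_power power_add power_divide power_int_minus field_simps)
  qed
  then show "summable (\<lambda>n. norm (theta_term z p (- int n)))"
    using summable_power_choose_two [of "norm p" "norm (p / z)"] assms by simp
qed auto

lemma convergent_prod_qpoch:
  fixes z p :: "'a :: {real_normed_field, banach, heine_borel}"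
  assumes "norm p < 1"
  shows "convergent_prod (\<lambda>n. 1 - z * p ^ n)"
proof -
  have "abs_convergent_prod (\<lambda>n. 1 - z * p ^ n)"
    unfolding abs_convergent_prod_conv_summable using assms
    by (auto simp: norm_mult norm_power intro!: summable_mult summable_geometric)
  then show ?thesis by (rule abs_convergent_prod_imp_convergent_prod)
qed

lemma qpoch_LIMSEQ:
  assumes "norm p < 1"
  shows "(\<lambda>n. \<Prod>i<n. 1 - z * p ^ i) \<longlonglongrightarrow> qpoch z p"
  using convergent_prod_LIMSEQ [OF convergent_prod_qpoch [OF assms, of z]]
  by (simp add: qpoch_def LIMSEQ_lessThan_iff_atMost)

lemma qpoch_eq_0_iff:
  assumes "norm p < 1"
  shows "qpoch z p = 0 \<longleftrightarrow> (\<exists>n. z * p ^ n = 1)"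
proof -
  have "(\<lambda>n. 1 - z * p ^ n) has_prod qpoch z p"
    unfolding qpoch_def by (rule convergent_prod_has_prod [OF convergent_prod_qpoch [OF assms]])
  from has_prod_eq_0_iff [OF this] show ?thesis by auto
qed

lemma qfac_LIMSEQ: "norm p < 1 \<Longrightarrow> qfac p \<longlonglongrightarrow> qpoch p p"
  using qpoch_LIMSEQ [of p p] unfolding qfac_def [abs_def] by simp

lemma qpoch_self_nonzero:
  assumes "norm p < 1"
  shows "qpoch p p \<noteq> 0"
  using one_minus_power_nonzero [OF assms] by (auto simp: qpoch_eq_0_iff [OF assms])

text \<open>Dominated convergence for bilateral series: the enumeration \<open>int_decode\<close>
  carries the sums to the naturals, where \<open>tannerys_theorem\<close> applies.\<close>

lemma tannery_int:
  fixes a :: "nat \<Rightarrow> int \<Rightarrow> complex"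
  assumes lim: "\<And>k. (\<lambda>n. a n k) \<longlonglongrightarrow> b k"
    and bound: "\<And>n k. norm (a n k) \<le> M k"
    and M: "M summable_on UNIV"
    and s: "\<And>n. (a n has_sum s n) UNIV" and S: "s \<longlonglongrightarrow> t"
  shows "(b has_sum t) UNIV"
proof -
  have bij: "bij_betw int_decode UNIV UNIV" using bij_int_decode by simp
  have sM: "summable (\<lambda>k. M (int_decode k))"
    using M summable_on_reindex_bij_betw [OF bij, of M] summable_on_imp_summable by blast
  have ev: "eventually (\<lambda>(k, n). norm (a n (int_decode k)) \<le> M (int_decode k)) (at_top \<times>\<^sub>F sequentially)"
    by (intro always_eventually) (auto simp: bound)
  note T = tannerys_theorem [of "\<lambda>k n. a n (int_decode k)" "\<lambda>k. b (int_decode k)", OF lim ev sM sequentially_bot]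
  have "(\<lambda>n. \<Sum>k. a n (int_decode k)) \<longlonglongrightarrow> (\<Sum>k. b (int_decode k))"
    by (rule T [THEN conjunct2, THEN conjunct2])
  moreover have "(\<Sum>k. a n (int_decode k)) = s n" for n
  proof -
    have "((\<lambda>k. a n (int_decode k)) has_sum s n) UNIV"
      using s [of n] has_sum_reindex_bij_betw [OF bij, of "a n"] by simp
    then show ?thesis by (intro sums_unique [symmetric] has_sum_imp_sums)
  qed
  ultimately have t: "(\<Sum>k. b (int_decode k)) = t"
    by (simp only: LIMSEQ_unique [OF _ S])
  have sb: "summable (\<lambda>k. norm (b (int_decode k)))"
    by (rule T [THEN conjunct2, THEN conjunct1])
  then have "(\<lambda>k. b (int_decode k)) sums t"
    using summable_norm_cancel summable_sums t by force
  with sb have "((\<lambda>k. b (int_decode k)) has_sum t) UNIV"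
    by (rule norm_summable_imp_has_sum)
  then show ?thesis using has_sum_reindex_bij_betw [OF bij, of b] by simp
qed

text \<open>In the finite form the coefficient at a fixed \<open>k\<close> tends to
  \<open>1 / qpoch p p\<close> as \<open>N\<close> grows, and all coefficients are bounded, so a
  multiple of the absolutely convergent theta series dominates.\<close>

theorem jacobi_triple_product:
  fixes p z :: complex
  assumes p: "norm p < 1" "p \<noteq> 0" and z: "z \<noteq> 0"
  shows "(theta_term z p has_sum qpoch p p * jtheta z p) UNIV"
proof -
  \<comment> \<open>Zero outside \<open>- N..N\<close>, so that each finite sum becomes a sum over
    all integers.\<close>
  define c where "c N k = (if \<bar>k\<bar> \<le> int N then qbin p (2*N) (nat (k + int N)) else 0)" for N k
  have c_lim: "(\<lambda>N. c N k) \<longlonglongrightarrow> 1 / qpoch p p" for k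
  proof -
    define m where "m = nat \<bar>k\<bar>"
    have f: "filterlim (\<lambda>N. nat (int N + k)) sequentially sequentially" for k
    proof -
      have "eventually (\<lambda>N. Z \<le> nat (int N + k)) sequentially" for Z
        using eventually_ge_at_top [of "Z + nat \<bar>k\<bar>"] by eventually_elim linarith
      then show ?thesis by (simp add: filterlim_at_top)
    qed
    have "(\<lambda>N. qfac p (2*N) / (qfac p (nat (int N + k)) * qfac p (nat (int N + - k)))) \<longlonglongrightarrow> qpoch p p / (qpoch p p * qpoch p p)"
    proof (intro tendsto_intros)
      show "(\<lambda>N. qfac p (2*N)) \<longlonglongrightarrow> qpoch p p"
        by (rule filterlim_compose [OF qfac_LIMSEQ [OF p(1)]]) (simp add: mult_nat_left_at_top)
      show "(\<lambda>N. qfac p (nat (int N + k))) \<longlonglongrightarrow> qpoch p p" "(\<lambda>N. qfac p (nat (int N + - k))) \<longlonglongrightarrow> qpoch p p"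
        by (rule filterlim_compose [OF qfac_LIMSEQ [OF p(1)] f])+
    qed (use qpoch_self_nonzero p in auto)
    moreover have "eventually (\<lambda>N. qfac p (2*N) / (qfac p (nat (int N + k)) * qfac p (nat (int N + - k))) = c N k) sequentially"
      using eventually_ge_at_top [of m]
    proof eventually_elim
      case (elim N)
      then have k: "\<bar>k\<bar> \<le> int N" by (simp add: m_def)
      then have "nat (k + int N) \<le> 2*N" "2*N - nat (k + int N) = nat (int N + - k)" by linarith+
      with k show ?case by (simp add: c_def qbin_def add.commute)
    qed
    ultimately show ?thesis using qpoch_self_nonzero [OF p(1)]
      by (simp add: tendsto_cong)
  qed
  \<comment> \<open>\<open>qfac p\<close> and its inverse both converge, the inverse because the
    limit is not 0; hence both are bounded.\<close>
  obtain K where K: "norm (c N k) \<le> K" for N k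
  proof -
    have "Bseq (qfac p)" using qfac_LIMSEQ [OF p(1)] convergentI convergent_imp_Bseq by blast
    then obtain B where B: "norm (qfac p n) \<le> B" for n unfolding Bseq_def by blast
    have "(\<lambda>n. inverse (qfac p n)) \<longlonglongrightarrow> inverse (qpoch p p)"
      by (intro tendsto_inverse qfac_LIMSEQ qpoch_self_nonzero p)
    then have "Bseq (\<lambda>n. inverse (qfac p n))" using convergentI convergent_imp_Bseq by blast
    then obtain D where D: "norm (inverse (qfac p n)) \<le> D" for n unfolding Bseq_def by blast
    have nn: "0 \<le> B" "0 \<le> D" using B [of 0] D [of 0] norm_ge_zero order_trans by blast+
    have "norm (qbin p n k) \<le> B * D * D" for n k
    proof (cases "k \<le> n")
      case True
      then have "norm (qbin p n k) = norm (qfac p n) * norm (inverse (qfac p k)) * norm (inverse (qfac p (n - k)))"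
        by (simp add: qbin_def norm_mult norm_divide norm_inverse divide_inverse)
      also have "\<dots> \<le> B * D * D" using nn by (intro mult_mono B D mult_nonneg_nonneg) auto
      finally show ?thesis .
    qed (use nn in \<open>auto simp: qbin_def\<close>)
    then have "norm (c N k) \<le> B * D * D" for N k using nn by (auto simp: c_def)
    then show ?thesis by (rule that)
  qed
  have "((\<lambda>k. (1 / qpoch p p) * theta_term z p k) has_sum jtheta z p) UNIV"
  proof (rule tannery_int)
    show "(\<lambda>N. c N k * theta_term z p k) \<longlonglongrightarrow> (1 / qpoch p p) * theta_term z p k" for k
      by (intro tendsto_intros c_lim)
    show "norm (c N k * theta_term z p k) \<le> K * norm (theta_term z p k)" for N k
      using K by (simp add: norm_mult mult_right_mono)
    show "(\<lambda>k. K * norm (theta_term z p k)) summable_on UNIV"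
      by (intro summable_on_cmult_right theta_term_abs_summable assms)
    show "((\<lambda>k. c N k * theta_term z p k) has_sum (\<Prod>i<N. (1 - z * p ^ i) * (1 - p / z * p ^ i))) UNIV" for N
    proof (rule has_sum_finite_neutralI [where B = "{- int N..int N}"])
      have "(\<Sum>k\<in>{- int N..int N}. c N k * theta_term z p k) = (\<Sum>k\<le>2*N. c N (int k - int N) * theta_term z p (int k - int N))"
        by (rule sum.reindex_bij_witness [where i = "\<lambda>k. int k - int N" and j = "\<lambda>k. nat (k + int N)"]) auto
      also have "\<dots> = (\<Sum>k\<le>2*N. qbin p (2*N) k * theta_term z p (int k - int N))"
        by (rule sum.cong) (auto simp: c_def)
      also have "\<dots> = (\<Prod>i<N. (1 - z * p ^ i) * (1 - p / z * p ^ i))"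
        unfolding theta_term_def by (rule finite_jacobi_triple_product [OF p z, symmetric])
      finally show "(\<Prod>i<N. (1 - z * p ^ i) * (1 - p / z * p ^ i)) = (\<Sum>k\<in>{- int N..int N}. c N k * theta_term z p k)"
        by (rule sym)
    qed (auto simp: c_def)
    show "(\<lambda>N. \<Prod>i<N. (1 - z * p ^ i) * (1 - p / z * p ^ i)) \<longlonglongrightarrow> jtheta z p"
      unfolding prod.distrib jtheta_def by (intro tendsto_intros qpoch_LIMSEQ p)
  qed
  from has_sum_cmult_right [OF this, of "qpoch p p"] show ?thesis
    using qpoch_self_nonzero [OF p(1)] by simp
qed

subsection \<open>The three-term relation\<close>

lemma has_sum_product:
  fixes f :: "'a \<Rightarrow> complex" and g :: "'b \<Rightarrow> complex"
  assumes f: "(f has_sum a) A" and g: "(g has_sum b) B"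
  shows "((\<lambda>(x, y). f x * g y) has_sum a * b) (A \<times> B)"
proof (rule has_sum_SigmaI)
  show "((\<lambda>y. case (x, y) of (x, y) \<Rightarrow> f x * g y) has_sum f x * b) B" for x
    using g by (simp add: has_sum_cmult_right)
  show "((\<lambda>x. f x * b) has_sum a * b) A" using f by (rule has_sum_cmult_left)
  have "f summable_on A" "g summable_on B" using f g has_sum_imp_summable by auto
  then have "(\<lambda>x. norm (f x)) summable_on A" "(\<lambda>x. norm (g x)) summable_on B"
    by (simp_all add: summable_on_iff_abs_summable_on_complex)
  then have "(\<lambda>z. norm (case z of (x, y) \<Rightarrow> f x * g y)) summable_on (A \<times> B)"
    by (subst Infinite_Sum.abs_summable_on_Sigma_iff)
      (auto simp: norm_mult infsum_cmult_right abs_mult infsum_nonneg intro!: summable_on_cmult_right summable_on_cmult_left)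
  then show "(\<lambda>(x, y). f x * g y) summable_on (A \<times> B)"
    by (simp only: summable_on_iff_abs_summable_on_complex)
qed

text \<open>For \<open>x\<close> = e^(iz) this is Jacobi's theta_3 with nome \<open>p\<close>;
  \<open>theta_odd\<close> is theta_2 without its factor p^(1/4).\<close>

definition theta_even :: "complex \<Rightarrow> complex \<Rightarrow> complex" where
  "theta_even x p = (\<Sum>\<^sub>\<infinity>k::int. x powi (2 * k) * p powi (k * k))"

definition theta_odd :: "complex \<Rightarrow> complex \<Rightarrow> complex" where
  "theta_odd x p = (\<Sum>\<^sub>\<infinity>k::int. x powi (2 * k + 1) * p powi (k * k + k))"

lemma theta_even_odd_has_sum:
  assumes p: "norm p < 1" "p \<noteq> 0" and x: "x \<noteq> 0"
  shows "((\<lambda>k::int. x powi (2 * k) * p powi (k * k)) has_sum theta_even x p) UNIV"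
    and "((\<lambda>k::int. x powi (2 * k + 1) * p powi (k * k + k)) has_sum theta_odd x p) UNIV"
proof -
  have p2: "norm (p ^ 2) < 1" "p ^ 2 \<noteq> 0" using p by (auto simp: norm_power power_less_one_iff)
  have sq: "(a ^ 2) powi k = a powi (2 * k)" for a :: complex and k
    by (simp only: power_int_mult [of a 2 k]) simp
  have neg: "(- (- a)) powi k = a powi k" for a :: complex and k by simp
  have "theta_term (- (x\<^sup>2 * p)) (p\<^sup>2) summable_on UNIV"
    using theta_term_abs_summable [OF p2, of "- (x\<^sup>2 * p)"] p x
    by (simp add: summable_on_iff_abs_summable_on_complex)
  moreover have "theta_term (- (x\<^sup>2 * p)) (p\<^sup>2) k = x powi (2 * k) * p powi (k * k)" for k
  proof -
    have "2 * (k * (k - 1) div 2) = k * (k - 1)" by simp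
    then have "p powi k * p powi (2 * (k * (k - 1) div 2)) = p powi (k * k)"
      using p by (simp add: algebra_simps flip: power_int_add)
    then show ?thesis by (simp add: theta_term_def power_int_mult_distrib sq)
  qed
  ultimately show "((\<lambda>k::int. x powi (2 * k) * p powi (k * k)) has_sum theta_even x p) UNIV"
    unfolding theta_even_def by (intro has_sum_infsum) (simp cong: summable_on_cong)
  have "(\<lambda>k. x * theta_term (- (x\<^sup>2 * p\<^sup>2)) (p\<^sup>2) k) summable_on UNIV"
    using theta_term_abs_summable [OF p2, of "- (x\<^sup>2 * p\<^sup>2)"] p x
    by (intro summable_on_cmult_right) (simp add: summable_on_iff_abs_summable_on_complex)
  moreover have "x * theta_term (- (x\<^sup>2 * p\<^sup>2)) (p\<^sup>2) k = x powi (2 * k + 1) * p powi (k * k + k)" for k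
  proof -
    have "2 * (k * (k - 1) div 2) = k * (k - 1)" by simp
    then have "p powi (2 * k) * p powi (2 * (k * (k - 1) div 2)) = p powi (k * k + k)"
      using p by (simp add: algebra_simps flip: power_int_add)
    then show ?thesis using x by (simp add: theta_term_def power_int_mult_distrib sq power_int_add_1)
  qed
  ultimately show "((\<lambda>k::int. x powi (2 * k + 1) * p powi (k * k + k)) has_sum theta_odd x p) UNIV"
    unfolding theta_odd_def by (intro has_sum_infsum) (simp cong: summable_on_cong)
qed

text \<open>In the indices \<open>j + k\<close> and \<open>j - k\<close> the sum of the two
  quadratic exponents has no mixed term \<open>j * k\<close>; this separates \<open>x\<close> from
  \<open>y\<close>. The second formula serves pairs of indices with odd sum.\<close>

lemma theta_term_add_diff:
  fixes j k :: int
  assumes "p \<noteq> 0" "x \<noteq> 0" "y \<noteq> 0"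
  shows "theta_term (x * y) p (j + k) * theta_term (x / y) p (j - k) =
      x powi (2 * j) * p powi (j * j - j) * (y powi (2 * k) * p powi (k * k))"
    and "theta_term (x * y) p (j + k + 1) * theta_term (x / y) p (j - k) =
      - (x powi (2 * j + 1) * p powi (j * j) * (y powi (2 * k + 1) * p powi (k * k + k)))"
proof -
  have gen: "theta_term (x * y) p m * theta_term (x / y) p n =
     (- 1) powi (m + n) * x powi (m + n) * y powi (m - n) * p powi (m * (m - 1) div 2 + n * (n - 1) div 2)" for m n
  proof -
    have "(- (x * y)) powi m = (- 1) powi m * x powi m * y powi m"
         "(- (x / y)) powi n = (- 1) powi n * x powi n / y powi n"
      by (metis mult_minus1 power_int_mult_distrib mult.assoc, metis mult_minus1 power_int_mult_distrib power_int_divide_distrib times_divide_eq_right)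
    then show ?thesis using assms
      by (simp add: theta_term_def power_int_add power_int_diff)
  qed
  have half: "m * (m - 1) div 2 + n * (n - 1) div 2 = c" if "m * (m - 1) + n * (n - 1) = 2 * c" for m n c :: int
  proof -
    have "2 * (m * (m - 1) div 2) = m * (m - 1)" "2 * (n * (n - 1) div 2) = n * (n - 1)" by simp_all
    with that show ?thesis by linarith
  qed
  have "(j + k) * (j + k - 1) div 2 + (j - k) * (j - k - 1) div 2 = j * j - j + k * k"
    by (rule half) (simp add: algebra_simps)
  then show "theta_term (x * y) p (j + k) * theta_term (x / y) p (j - k) =
      x powi (2 * j) * p powi (j * j - j) * (y powi (2 * k) * p powi (k * k))"
    unfolding gen using assms by (simp add: power_int_add)
  have "(j + k + 1) * (j + k + 1 - 1) div 2 + (j - k) * (j - k - 1) div 2 = j * j + (k * k + k)"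
    by (rule half) (simp add: algebra_simps)
  moreover have "j + k + 1 + (j - k) = 2 * j + 1" "j + k + 1 - (j - k) = 2 * k + 1" by simp_all
  ultimately show "theta_term (x * y) p (j + k + 1) * theta_term (x / y) p (j - k) =
      - (x powi (2 * j + 1) * p powi (j * j) * (y powi (2 * k + 1) * p powi (k * k + k)))"
    unfolding gen using assms by (simp add: power_int_add)
qed

text \<open>Multiply two triple product series and sort the pairs of indices by the parity of their
  sum: each class factors into a series in \<open>x\<close> times a series in \<open>y\<close>. The
  point of the result is its shape, a 2 by 2 determinant in the columns (\<open>theta_odd\<close>,
  \<open>theta_even\<close>) at \<open>x\<close> and at \<open>y\<close>.\<close>

lemma jtheta_mult_jtheta:
  assumes p: "norm p < 1" "p \<noteq> 0" and xy: "x \<noteq> 0" "y \<noteq> 0"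
  shows "qpoch p p ^ 2 * (jtheta (x * y) p * jtheta (x / y) p) =
    x * (theta_odd x p * theta_even y p - theta_even x p * theta_odd y p)"
proof -
  define F where "F = (\<lambda>(m, n). theta_term (x * y) p m * theta_term (x / y) p n)"
  let ?U = "UNIV :: (int \<times> int) set"
  \<comment> \<open>The pairs with even sum and those with odd sum.\<close>
  define S0 S1 where "S0 = range (\<lambda>(j, k). (j + k, j - k :: int))" and "S1 = range (\<lambda>(j, k). (j + k + 1, j - k :: int))"
  have i0: "inj (\<lambda>(j, k). (j + k, j - k :: int))" and i1: "inj (\<lambda>(j, k). (j + k + 1, j - k :: int))"
    by (auto simp: inj_def)
  have disj: "S0 \<inter> S1 = {}"
  proof -
    have "z \<notin> S1" if z: "z \<in> S0" for z
    proof
      assume "z \<in> S1"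
      then obtain j k where "z = (j + k + 1, j - k)" unfolding S1_def by auto
      moreover obtain j' k' where "z = (j' + k', j' - k')" using z unfolding S0_def by auto
      ultimately have "j + k + 1 = j' + k'" "j - k = j' - k'" by auto
      then show False by presburger
    qed
    then show ?thesis by blast
  qed
  have un: "S0 \<union> S1 = ?U"
  proof (intro set_eqI iffI UNIV_I)
    fix z :: "int \<times> int"
    obtain m n where z: "z = (m, n)" by fastforce
    show "z \<in> S0 \<union> S1"
    proof (cases "even (m + n)")
      case True
      then have "z = (\<lambda>(j, k). (j + k, j - k)) ((m + n) div 2, (m - n) div 2)" by (simp add: z) presburger
      then show ?thesis unfolding S0_def by blast
    next
      case False
      then have "z = (\<lambda>(j, k). (j + k + 1, j - k)) ((m + n - 1) div 2, (m - n - 1) div 2)" by (simp add: z) presburger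
      then show ?thesis unfolding S1_def by blast
    qed
  qed
  note E = theta_even_odd_has_sum [OF p]
  \<comment> \<open>On even pairs the exponent of \<open>p\<close> is \<open>j * j - j\<close>;
    replacing \<open>j\<close> by \<open>j + 1\<close> shows that this series is again
    \<open>theta_odd\<close>, times \<open>x\<close>.\<close>
  have shift: "((\<lambda>j::int. x powi (2 * j) * p powi (j * j - j)) has_sum x * theta_odd x p) UNIV"
  proof -
    have "((\<lambda>j. x * (x powi (2 * j + 1) * p powi (j * j + j))) has_sum x * theta_odd x p) UNIV"
      by (intro has_sum_cmult_right E xy)
    moreover have "bij_betw (\<lambda>j::int. j - 1) UNIV UNIV" by (rule bij_betw_byWitness [of _ "\<lambda>j. j + 1"]) auto
    ultimately have "((\<lambda>j. x * (x powi (2 * (j - 1) + 1) * p powi ((j - 1) * (j - 1) + (j - 1)))) has_sum x * theta_odd x p) UNIV"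
      using has_sum_reindex_bij_betw [of "\<lambda>j::int. j - 1" UNIV UNIV "\<lambda>j. x * (x powi (2 * j + 1) * p powi (j * j + j))"] by simp
    moreover have "x * (x powi (2 * (j - 1) + 1) * p powi ((j - 1) * (j - 1) + (j - 1))) = x powi (2 * j) * p powi (j * j - j)" for j
    proof -
      have "2 * j = (2 * (j - 1) + 1) + 1" "(j - 1) * (j - 1) + (j - 1) = j * j - j" by (simp_all add: algebra_simps)
      then show ?thesis using xy by (metis power_int_add_1' mult.assoc)
    qed
    ultimately show ?thesis by simp
  qed
  have "((\<lambda>(j, k). x powi (2 * j) * p powi (j * j - j) * (y powi (2 * k) * p powi (k * k))) has_sum x * theta_odd x p * theta_even y p) ?U"
    using has_sum_product [OF shift E(1) [OF xy(2)]] by simp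
  then have 0: "(F has_sum x * theta_odd x p * theta_even y p) S0"
    unfolding S0_def has_sum_reindex [OF i0]
    by (simp add: o_def F_def case_prod_unfold theta_term_add_diff [OF p(2) xy])
  have "((\<lambda>k::int. x powi (2 * k + 1) * p powi (k * k)) has_sum x * theta_even x p) UNIV"
    using has_sum_cmult_right [OF E(1) [OF xy(1)], of x] xy by (simp add: power_int_add_1' mult.assoc)
  from has_sum_product [OF this E(2) [OF xy(2)]]
  have "((\<lambda>(j, k). - (x powi (2 * j + 1) * p powi (j * j) * (y powi (2 * k + 1) * p powi (k * k + k)))) has_sum - (x * theta_even x p * theta_odd y p)) ?U"
    unfolding case_prod_unfold by (subst has_sum_uminus) simp
  then have 1: "(F has_sum - (x * theta_even x p * theta_odd y p)) S1"
    unfolding S1_def has_sum_reindex [OF i1]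
    by (simp add: o_def F_def case_prod_unfold theta_term_add_diff [OF p(2) xy])
  have "(F has_sum x * theta_odd x p * theta_even y p + - (x * theta_even x p * theta_odd y p)) ?U"
    using has_sum_Un_disjoint [OF 0 1 disj] un by simp
  moreover have "(F has_sum (qpoch p p * jtheta (x * y) p) * (qpoch p p * jtheta (x / y) p)) ?U"
    using has_sum_product [OF jacobi_triple_product [OF p, of "x * y"] jacobi_triple_product [OF p, of "x / y"]] xy
    by (simp add: F_def)
  ultimately have "qpoch p p * jtheta (x * y) p * (qpoch p p * jtheta (x / y) p) =
      x * theta_odd x p * theta_even y p + - (x * theta_even x p * theta_odd y p)"
    by (rule has_sum_unique [rotated])
  then show ?thesis by (simp add: algebra_simps power2_eq_square)
qed

text \<open>The \<open>T\<close> of the overview. The factor \<open>exp (- w / 2)\<close> makes it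
  odd in \<open>w\<close>, at the price of a sign under translation by
  \<open>2 * pi * \<i>\<close>.\<close>

definition jsigma :: "complex \<Rightarrow> complex \<Rightarrow> complex" where
  "jsigma p w = exp (- w / 2) * jtheta (exp w) p"

text \<open>By \<open>jtheta_mult_jtheta\<close> each product of values at a sum and a difference is
  a 2 by 2 minor of the matrix with columns (\<open>theta_odd\<close>, \<open>theta_even\<close>) at
  \<open>w\<close>, \<open>v\<close>, \<open>s\<close>, \<open>t\<close>, divided by a constant. The
  relation is the Pluecker identity for the six minors.\<close>

theorem jsigma_three_term:
  assumes p: "norm p < 1" "p \<noteq> 0"
  shows "jsigma p (w + v) * jsigma p (w - v) * (jsigma p (s + t) * jsigma p (s - t))
    - jsigma p (w + s) * jsigma p (w - s) * (jsigma p (v + t) * jsigma p (v - t))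
    + jsigma p (w + t) * jsigma p (w - t) * (jsigma p (v + s) * jsigma p (v - s)) = 0"
proof -
  have W: "jsigma p (w + v) * jsigma p (w - v) =
    (theta_odd (exp w) p * theta_even (exp v) p - theta_even (exp w) p * theta_odd (exp v) p) / qpoch p p ^ 2" for w v
  proof -
    have "exp (- (w + v) / 2) * exp (- (w - v) / 2) = exp (- w)"
      by (simp add: exp_add [symmetric] add_divide_distrib diff_divide_distrib)
    then have "jsigma p (w + v) * jsigma p (w - v) = exp (- w) * (jtheta (exp w * exp v) p * jtheta (exp w / exp v) p)"
      by (simp add: jsigma_def exp_add exp_diff algebra_simps)
    then have "exp w * (jsigma p (w + v) * jsigma p (w - v) * qpoch p p ^ 2) =
        qpoch p p ^ 2 * (jtheta (exp w * exp v) p * jtheta (exp w / exp v) p)"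
      by (simp add: exp_minus divide_simps mult_ac)
    also have "\<dots> = exp w * (theta_odd (exp w) p * theta_even (exp v) p - theta_even (exp w) p * theta_odd (exp v) p)"
      using jtheta_mult_jtheta [OF p, of "exp w" "exp v"] by simp
    finally have "jsigma p (w + v) * jsigma p (w - v) * qpoch p p ^ 2 =
        theta_odd (exp w) p * theta_even (exp v) p - theta_even (exp w) p * theta_odd (exp v) p"
      by (simp only: mult_cancel_left exp_not_eq_zero simp_thms)
    then show ?thesis using qpoch_self_nonzero [OF p(1)] by (simp add: eq_divide_eq)
  qed
  show ?thesis
    unfolding W times_divide_times_eq diff_divide_distrib [symmetric] add_divide_distrib [symmetric]
    by (simp add: algebra_simps)
qed

lemma qpoch_rec:
  assumes p: "norm p < 1"
  shows "qpoch z p = (1 - z) * qpoch (z * p) p"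
proof (rule LIMSEQ_unique [OF LIMSEQ_Suc [OF qpoch_LIMSEQ [OF p]]])
  show "(\<lambda>n. \<Prod>i<Suc n. 1 - z * p ^ i) \<longlonglongrightarrow> (1 - z) * qpoch (z * p) p"
    by (simp only: prod.lessThan_Suc_shift) (auto intro!: tendsto_intros qpoch_LIMSEQ [OF p, of "z * p", simplified mult.assoc])
qed

lemma jsigma_minus:
  assumes p: "norm p < 1"
  shows "jsigma p (- w) = - jsigma p w"
proof -
  note * = qpoch_rec [OF p]
  have "exp (w / 2) * (1 - exp (- w)) = - (exp (- w / 2) * (1 - exp w))"
    by (simp add: algebra_simps exp_add [symmetric])
  moreover have "jsigma p (- w) = exp (w / 2) * (1 - exp (- w)) * (qpoch (p / exp w) p * qpoch (exp w * p) p)"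
    unfolding jsigma_def jtheta_def * [of "exp (- w)"] by (simp add: exp_minus field_simps)
  moreover have "jsigma p w = exp (- w / 2) * (1 - exp w) * (qpoch (p / exp w) p * qpoch (exp w * p) p)"
    unfolding jsigma_def jtheta_def * [of "exp w"] by simp
  ultimately show ?thesis by simp
qed

subsection \<open>Logarithmic derivatives\<close>

text \<open>Uniform convergence on discs makes the product entire in \<open>z\<close> and permits
  termwise logarithmic differentiation.\<close>

lemma uniform_limit_qpoch:
  assumes p: "norm p < 1"
  shows "uniform_limit (cball 0 R) (\<lambda>n z. \<Prod>i<n. 1 - z * p ^ i) (\<lambda>z. qpoch z p) sequentially"
proof -
  have "uniformly_convergent_on (cball 0 R) (\<lambda>N z. \<Prod>n<N. 1 - z * p ^ n)"
  proof (rule uniformly_convergent_on_prod')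
    show "uniformly_convergent_on (cball 0 R) (\<lambda>N z. \<Sum>n<N. norm (1 - z * p ^ n - 1))"
    proof (rule Weierstrass_m_test')
      show "norm (norm (1 - z * p ^ n - 1)) \<le> \<bar>R\<bar> * norm p ^ n" if "z \<in> cball 0 R" for n z
        using that by (auto simp: norm_mult norm_power intro!: mult_right_mono)
      show "summable (\<lambda>n. \<bar>R\<bar> * norm p ^ n)" using p by (intro summable_mult summable_geometric) auto
    qed
  qed (auto intro!: continuous_intros)
  then obtain l where l: "uniform_limit (cball 0 R) (\<lambda>N z. \<Prod>n<N. 1 - z * p ^ n) l sequentially"
    by (auto simp: uniformly_convergent_on_def)
  have "l z = qpoch z p" if "z \<in> cball 0 R" for z
    using LIMSEQ_unique [OF tendsto_uniform_limitI [OF l that] qpoch_LIMSEQ [OF p]] .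
  then show ?thesis using l uniform_limit_cong' [of "cball 0 R" "\<lambda>n z. \<Prod>i<n. 1 - z * p ^ i" "\<lambda>n z. \<Prod>i<n. 1 - z * p ^ i" l "\<lambda>z. qpoch z p"] by blast
qed

lemma holomorphic_qpoch:
  assumes p: "norm p < 1"
  shows "(\<lambda>z. qpoch z p) holomorphic_on A"
proof -
  have "(\<lambda>z. qpoch z p) holomorphic_on UNIV"
  proof (rule holomorphic_uniform_sequence)
    show "\<exists>d>0. cball x d \<subseteq> UNIV \<and> uniform_limit (cball x d) (\<lambda>n z. \<Prod>i<n. 1 - z * p ^ i) (\<lambda>z. qpoch z p) sequentially" for x
    proof (intro exI [of _ 1] conjI)
      have "cball x 1 \<subseteq> cball 0 (norm x + 1)"
        by (simp add: cball_subset_cball_iff)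
      then show "uniform_limit (cball x 1) (\<lambda>n z. \<Prod>i<n. 1 - z * p ^ i) (\<lambda>z. qpoch z p) sequentially"
        by (rule uniform_limit_on_subset [OF uniform_limit_qpoch [OF p]])
    qed auto
  qed (auto intro!: holomorphic_intros)
  then show ?thesis by (rule holomorphic_on_subset) auto
qed

text \<open>The operator z d/dz becomes d/dw for z = e^w, the variable of
  \<open>jsigma\<close>.\<close>

definition qpoch_logderiv :: "complex \<Rightarrow> complex \<Rightarrow> complex" where
  "qpoch_logderiv z p = z * (deriv (\<lambda>z. qpoch z p) z / qpoch z p)"

lemma qpoch_logderiv_sums:
  assumes p: "norm p < 1" and nz: "qpoch z p \<noteq> 0"
  shows "(\<lambda>n. - (z * p ^ n) / (1 - z * p ^ n)) sums qpoch_logderiv z p"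
proof -
  have "(\<lambda>k. deriv (\<lambda>z. 1 - z * p ^ k) z / (1 - z * p ^ k)) sums (deriv (\<lambda>z. qpoch z p) z / qpoch z p)"
  proof (rule logderiv_prodinf_complex_uniform_limit [where A = "ball 0 (norm z + 1)"])
    show "uniform_limit (ball 0 (norm z + 1)) (\<lambda>n z. \<Prod>i<n. 1 - z * p ^ i) (\<lambda>z. qpoch z p) sequentially"
      by (rule uniform_limit_on_subset [OF uniform_limit_qpoch [OF p]]) (rule ball_subset_cball)
  qed (use nz in \<open>auto intro!: holomorphic_intros\<close>)
  moreover have "deriv (\<lambda>z. 1 - z * p ^ k) z = - (p ^ k)" for k
    by (rule DERIV_imp_deriv) (auto intro!: derivative_eq_intros)
  ultimately have "(\<lambda>k. - (p ^ k) / (1 - z * p ^ k)) sums (deriv (\<lambda>z. qpoch z p) z / qpoch z p)" by simp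
  from sums_mult [OF this, of z] show ?thesis by (simp add: qpoch_logderiv_def)
qed

text \<open>The term \<open>m = 0\<close> is \<open>1 / 0 = 0\<close>, so the sum effectively starts
  at \<open>m = 1\<close>.\<close>

definition lambert :: "complex \<Rightarrow> complex \<Rightarrow> complex" where
  "lambert x p = (\<Sum>m. x ^ m / (1 - p ^ m))"

text \<open>Both series are iterated sums of the absolutely convergent double series with terms
  \<open>x ^ Suc m * p ^ (n * Suc m)\<close>, geometric in \<open>m\<close> for fixed
  \<open>n\<close> and geometric in \<open>n\<close> for fixed \<open>m\<close>.\<close>

lemma sums_swap_power:
  fixes x p :: complex
  assumes x: "norm x < 1" and p: "norm p < 1"
  obtains S where "(\<lambda>n. x * p ^ n / (1 - x * p ^ n)) sums S" "(\<lambda>m. x ^ Suc m / (1 - p ^ Suc m)) sums S"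
proof -
  define f where "f = (\<lambda>(n, m). x ^ Suc m * p ^ (n * Suc m))"
  have "(\<lambda>(n, m). norm p ^ n * norm x ^ m) summable_on (UNIV :: (nat \<times> nat) set)"
  proof -
    have g: "((\<lambda>n. of_real r ^ n) has_sum 1 / (1 - of_real r :: complex)) UNIV" if "0 \<le> r" "r < 1" for r :: real
    proof (rule norm_summable_imp_has_sum)
      show "summable (\<lambda>n. norm (complex_of_real r ^ n))"
        using that by (simp add: norm_power summable_geometric)
      show "(\<lambda>n. complex_of_real r ^ n) sums (1 / (1 - of_real r))"
        by (rule geometric_sums) (use that in simp)
    qed
    have "(\<lambda>(n, m). of_real (norm p) ^ n * of_real (norm x) ^ m :: complex) summable_on (UNIV \<times> UNIV)"
      using has_sum_product [OF g g, of "norm p" "norm x"] x p has_sum_imp_summable by auto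
    then show ?thesis
      unfolding summable_on_iff_abs_summable_on_complex
      by (simp add: case_prod_unfold norm_mult norm_power)
  qed
  then have "(\<lambda>z. norm (f z)) summable_on (UNIV :: (nat \<times> nat) set)"
  proof (rule summable_on_comparison_test)
    fix z :: "nat \<times> nat"
    obtain n m where z: "z = (n, m)" by fastforce
    have "norm p ^ (n * Suc m) \<le> norm p ^ n" using p by (intro power_decreasing) auto
    moreover have "norm x ^ Suc m \<le> norm x ^ m" using x by (intro power_decreasing) auto
    ultimately have "norm x ^ Suc m * norm p ^ (n * Suc m) \<le> norm x ^ m * norm p ^ n"
      by (intro mult_mono) auto
    then show "norm (f z) \<le> (case z of (n, m) \<Rightarrow> norm p ^ n * norm x ^ m)"
      by (simp add: z f_def norm_mult norm_power mult.commute)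
  qed auto
  then have sf: "f summable_on (UNIV \<times> UNIV)"
    by (simp add: summable_on_iff_abs_summable_on_complex)
  then have S: "(f has_sum infsum f (UNIV \<times> UNIV)) (UNIV \<times> UNIV)" by (rule has_sum_infsum)
  have geo: "((\<lambda>m. c * a ^ m) has_sum (c / (1 - a))) UNIV" if "norm a < 1" for a c :: complex
  proof -
    have "((\<lambda>m. a ^ m) has_sum (1 / (1 - a))) UNIV"
      using that by (intro norm_summable_imp_has_sum geometric_sums) (auto simp: norm_power)
    from has_sum_cmult_right [OF this, of c] show ?thesis by simp
  qed
  have xp: "norm (x * p ^ n) < 1" for n
  proof -
    have "norm (x * p ^ n) \<le> norm x * 1"
      unfolding norm_mult norm_power using p by (intro mult_left_mono power_le_one) auto
    then show ?thesis using x by simp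
  qed
  have 1: "((\<lambda>n. x * p ^ n / (1 - x * p ^ n)) has_sum infsum f (UNIV \<times> UNIV)) UNIV"
  proof (rule has_sum_SigmaD [OF S])
    fix n :: nat
    show "((\<lambda>m. f (n, m)) has_sum x * p ^ n / (1 - x * p ^ n)) UNIV"
      using geo [OF xp, of "x * p ^ n" n] by (simp add: f_def power_mult_distrib power_mult [symmetric] power_add mult_ac)
  qed
  have S': "((\<lambda>(m, n). f (n, m)) has_sum infsum f (UNIV \<times> UNIV)) (UNIV \<times> UNIV)"
    using has_sum_swap [of f UNIV UNIV "infsum f (UNIV \<times> UNIV)"] S by simp
  have 2: "((\<lambda>m. x ^ Suc m / (1 - p ^ Suc m)) has_sum infsum f (UNIV \<times> UNIV)) UNIV"
  proof (rule has_sum_SigmaD [OF S'])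
    fix m :: nat
    have "norm (p ^ Suc m) < 1"
      using power_Suc_less_one [of "norm p" m] p by (cases "p = 0") (auto simp: norm_power norm_mult)
    moreover have "(p ^ Suc m) ^ n = p ^ (n * Suc m)" for n
      by (simp only: power_mult [symmetric] mult.commute)
    ultimately show "((\<lambda>n. case (m, n) of (m, n) \<Rightarrow> f (n, m)) has_sum x ^ Suc m / (1 - p ^ Suc m)) UNIV"
      using geo [of "p ^ Suc m" "x ^ Suc m"] by (simp add: f_def del: power_Suc mult_Suc_right)
  qed
  show ?thesis using that has_sum_imp_sums [OF 1] has_sum_imp_sums [OF 2] by blast
qed

lemma lambert_sums:
  assumes x: "norm x < 1" and p: "norm p < 1"
  shows "(\<lambda>n. x * p ^ n / (1 - x * p ^ n)) sums lambert x p"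
    and "(\<lambda>m. x ^ m / (1 - p ^ m)) sums lambert x p"
proof -
  obtain S where S: "(\<lambda>n. x * p ^ n / (1 - x * p ^ n)) sums S" "(\<lambda>m. x ^ Suc m / (1 - p ^ Suc m)) sums S"
    using sums_swap_power assms by blast
  from S(2) have "(\<lambda>m. x ^ m / (1 - p ^ m)) sums (S + x ^ 0 / (1 - p ^ 0))"
    by (subst (asm) sums_Suc_iff)  simp
  then show 2: "(\<lambda>m. x ^ m / (1 - p ^ m)) sums lambert x p"
    unfolding lambert_def by (simp add: sums_iff)
  with \<open>_ sums (S + _)\<close> have "S = lambert x p" using sums_unique2 by fastforce
  with S(1) show "(\<lambda>n. x * p ^ n / (1 - x * p ^ n)) sums lambert x p" by simp
qed

lemma qpoch_nonzero:
  assumes p: "norm p < 1" and x: "norm x < 1"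
  shows "qpoch x p \<noteq> 0"
proof -
  have "x * p ^ n \<noteq> 1" for n
  proof
    assume "x * p ^ n = 1"
    then have "norm x * norm p ^ n = 1" by (metis norm_mult norm_one norm_power)
    moreover have "norm x * norm p ^ n \<le> norm x * 1"
      using p by (intro mult_left_mono power_le_one) auto
    ultimately show False using x by simp
  qed
  then show "qpoch x p \<noteq> 0" using p by (simp add: qpoch_eq_0_iff)
qed

lemma qpoch_logderiv_eq_lambert:
  assumes p: "norm p < 1" and x: "norm x < 1"
  shows "qpoch_logderiv x p = - lambert x p"
proof -
  have "qpoch x p \<noteq> 0" using p x by (rule qpoch_nonzero)
  from sums_minus [OF lambert_sums(1) [OF x p]] qpoch_logderiv_sums [OF p this]
  show ?thesis using sums_unique2 by force
qed

text \<open>At a root of unity \<open>x\<close> the series \<open>lambert x p\<close> is out of its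
  disc of convergence. Splitting off the first factor of the product leaves the argument
  \<open>x * p\<close>, which is inside.\<close>

lemma qpoch_logderiv_rec:
  assumes p: "norm p < 1" and nz: "qpoch x p \<noteq> 0" and xp: "norm (x * p) < 1"
  shows "qpoch_logderiv x p = - x / (1 - x) - lambert (x * p) p"
proof -
  have nz': "qpoch (x * p) p \<noteq> 0" using nz qpoch_rec [OF p, of x] by auto
  have "(\<lambda>n. - (x * p ^ Suc n) / (1 - x * p ^ Suc n)) sums qpoch_logderiv (x * p) p"
    using qpoch_logderiv_sums [OF p nz'] by (simp add: mult_ac)
  then have "(\<lambda>n. - (x * p ^ n) / (1 - x * p ^ n)) sums (qpoch_logderiv (x * p) p + - x / (1 - x))"
    by (subst (asm) sums_Suc_iff) simp
  then show ?thesis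
    using qpoch_logderiv_sums [OF p nz] sums_unique2 qpoch_logderiv_eq_lambert [OF p xp] by fastforce
qed

lemma lambert_shift:
  assumes p: "norm p < 1" and x: "norm x < 1"
  shows "lambert x p = x / (1 - x) + lambert (x * p) p"
proof -
  have xp: "norm (x * p) < 1" using x p norm_mult_less [of x 1 p 1] by simp
  have "qpoch x p \<noteq> 0" using p x by (rule qpoch_nonzero)
  from qpoch_logderiv_rec [OF p this xp] qpoch_logderiv_eq_lambert [OF p x]
  show ?thesis by (simp add: algebra_simps)
qed

section \<open>The entire function \<open>jsigma p\<close> and its logarithmic derivative\<close>

lemma holomorphic_jsigma:
  assumes p: "norm p < 1"
  shows "jsigma p holomorphic_on A"
proof -
  have h: "(\<lambda>w. qpoch (f w) p) holomorphic_on A" if "f holomorphic_on A" for f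
    using holomorphic_on_compose [OF that holomorphic_qpoch [OF p]] by (simp add: o_def)
  show ?thesis unfolding jsigma_def [abs_def] jtheta_def
    by (intro holomorphic_intros h) auto
qed

lemma DERIV_jsigma:
  assumes "norm p < 1"
  shows "(jsigma p has_field_derivative deriv (jsigma p) w) (at w)"
    and "(deriv (jsigma p) has_field_derivative deriv (deriv (jsigma p)) w) (at w)"
proof -
  show "(jsigma p has_field_derivative deriv (jsigma p) w) (at w)"
    using holomorphic_jsigma [OF assms, of UNIV] by (rule holomorphic_derivI) auto
  have "deriv (jsigma p) holomorphic_on UNIV"
    using holomorphic_jsigma [OF assms] by (intro holomorphic_deriv) auto
  then show "(deriv (jsigma p) has_field_derivative deriv (deriv (jsigma p)) w) (at w)"
    by (rule holomorphic_derivI) auto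
qed

text \<open>The \<open>L\<close> of the overview, the analogue of Weierstrass' zeta
  function.\<close>

definition jzeta :: "complex \<Rightarrow> complex \<Rightarrow> complex" where
  "jzeta p w = deriv (jsigma p) w / jsigma p w"

lemma deriv_jsigma_minus:
  assumes p: "norm p < 1"
  shows "deriv (jsigma p) (- w) = deriv (jsigma p) w"
proof -
  have "((\<lambda>w. - jsigma p (- w)) has_field_derivative deriv (jsigma p) (- w)) (at w)"
    by (rule derivative_eq_intros DERIV_chain2 [OF DERIV_jsigma(1) [OF p]] refl)+ simp
  then have "(jsigma p has_field_derivative deriv (jsigma p) (- w)) (at w)"
    using jsigma_minus [OF p] by simp
  then show ?thesis by (rule DERIV_imp_deriv [symmetric])
qed

lemma jzeta_minus: "norm p < 1 \<Longrightarrow> jzeta p (- w) = - jzeta p w"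
  by (simp add: jzeta_def jsigma_minus deriv_jsigma_minus)

lemma jsigma_0: "norm p < 1 \<Longrightarrow> jsigma p 0 = 0"
  using jsigma_minus [of p 0] by simp

text \<open>Write \<open>jsigma p w\<close> as \<open>(1 - exp w) * H w\<close>; at 0 only the
  derivative of the first factor contributes, and \<open>H 0\<close> is
  \<open>qpoch p p ^ 2\<close>.\<close>

lemma deriv_jsigma_0:
  assumes p: "norm p < 1"
  shows "deriv (jsigma p) 0 = - (qpoch p p ^ 2)"
proof -
  define H where "H w = exp (- w / 2) * (qpoch (exp w * p) p * qpoch (p / exp w) p)" for w
  have eq: "jsigma p = (\<lambda>w. (1 - exp w) * H w)"
    unfolding jsigma_def [abs_def] jtheta_def H_def by (subst qpoch_rec [OF p]) (simp add: mult_ac)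
  have h: "(\<lambda>w. qpoch (f w) p) holomorphic_on A" if "f holomorphic_on A" for f A
    using holomorphic_on_compose [OF that holomorphic_qpoch [OF p]] by (simp add: o_def)
  have "H holomorphic_on UNIV" unfolding H_def [abs_def]
    by (intro holomorphic_intros h) auto
  then have "(H has_field_derivative deriv H 0) (at 0)" by (rule holomorphic_derivI) auto
  then have "(jsigma p has_field_derivative - H 0) (at 0)"
    unfolding eq by (auto intro!: derivative_eq_intros)
  then show ?thesis by (simp add: DERIV_imp_deriv H_def power2_eq_square)
qed

text \<open>Put \<open>s = w + e\<close> and \<open>t = 0\<close> in the three-term relation and
  differentiate at \<open>e = 0\<close>. One term contains \<open>jsigma p e\<close>, so only its
  derivative at 0 contributes; the other two produce the logarithmic derivatives.\<close>

theorem jzeta_addition: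
  assumes p: "norm p < 1" "p \<noteq> 0"
    and nz: "jsigma p w \<noteq> 0" "jsigma p (w + v) \<noteq> 0" "jsigma p (w - v) \<noteq> 0"
  shows "jzeta p (w + v) + jzeta p (w - v) - 2 * jzeta p w =
     - (qpoch p p ^ 2) * jsigma p (2 * w) * jsigma p v ^ 2 /
       (jsigma p w ^ 2 * jsigma p (w + v) * jsigma p (w - v))"
proof -
  let ?T = "jsigma p" let ?D = "deriv (jsigma p)"
  note D = DERIV_chain2 [OF DERIV_jsigma(1) [OF p(1)]]
  have rel: "?T (w + v) * ?T (w - v) * ?T (w + e) ^ 2 + ?T (2 * w + e) * ?T e * ?T v ^ 2
      - ?T w ^ 2 * (?T (w + v + e) * ?T (w - v + e)) = 0" for e
  proof -
    have m: "?T (w - (w + e)) = - ?T e" "?T (v - (w + e)) = - ?T (w - v + e)"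
      using jsigma_minus [OF p(1), of e] jsigma_minus [OF p(1), of "w - v + e"] by (simp_all add: algebra_simps)
    have e: "w + (w + e) = 2 * w + e" "v + (w + e) = w + v + e" by simp_all
    show ?thesis
      using jsigma_three_term [OF p, of w v "w + e" 0] unfolding m e by (simp add: power2_eq_square)
  qed
  have "((\<lambda>e. ?T (w + v) * ?T (w - v) * ?T (w + e) ^ 2 + ?T (2 * w + e) * ?T e * ?T v ^ 2
      - ?T w ^ 2 * (?T (w + v + e) * ?T (w - v + e))) has_field_derivative
      (?T (w + v) * ?T (w - v) * (2 * ?T w * ?D w) + ?T (2 * w) * ?D 0 * ?T v ^ 2
       - ?T w ^ 2 * (?D (w + v) * ?T (w - v) + ?T (w + v) * ?D (w - v)))) (at 0)"
    by (rule derivative_eq_intros D refl)+ (simp add: jsigma_0 p)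
  then have "?T (w + v) * ?T (w - v) * (2 * ?T w * ?D w) + ?T (2 * w) * ?D 0 * ?T v ^ 2
       - ?T w ^ 2 * (?D (w + v) * ?T (w - v) + ?T (w + v) * ?D (w - v)) = 0"
    unfolding rel by (rule DERIV_unique [OF _ DERIV_const])
  then have "?T w ^ 2 * (?D (w + v) * ?T (w - v) + ?T (w + v) * ?D (w - v)) - 2 * ?D w * ?T w * ?T (w + v) * ?T (w - v)
     = - (qpoch p p ^ 2) * ?T (2 * w) * ?T v ^ 2"
    by (simp add: deriv_jsigma_0 p algebra_simps)
  moreover have "jzeta p (w + v) + jzeta p (w - v) - 2 * jzeta p w =
     (?T w ^ 2 * (?D (w + v) * ?T (w - v) + ?T (w + v) * ?D (w - v)) - 2 * ?D w * ?T w * ?T (w + v) * ?T (w - v))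
      / (?T w ^ 2 * ?T (w + v) * ?T (w - v))"
    unfolding jzeta_def using nz by (simp add: field_simps power2_eq_square)
  ultimately show ?thesis by simp
qed

lemma DERIV_jzeta:
  assumes p: "norm p < 1" and nz: "jsigma p w \<noteq> 0"
  shows "(jzeta p has_field_derivative
     (deriv (deriv (jsigma p)) w * jsigma p w - deriv (jsigma p) w ^ 2) / jsigma p w ^ 2) (at w)"
  unfolding jzeta_def [abs_def]
  by (rule derivative_eq_intros DERIV_jsigma [OF p] refl nz)+ (simp add: power2_eq_square)

text \<open>The analogue of the formula that writes a difference of two values of Weierstrass'
  elliptic function by sigma functions. Put \<open>s = e\<close>, \<open>t = 0\<close> in the
  three-term relation and differentiate twice at \<open>e = 0\<close>: \<open>jsigma p e ^ 2\<close>
  contributes twice the square of the derivative at 0, and the products at \<open>w + e\<close>,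
  \<open>w - e\<close> contribute the numerator of the derivative of \<open>jzeta\<close>.\<close>

theorem jzeta_deriv_diff:
  assumes p: "norm p < 1" "p \<noteq> 0"
    and nz: "jsigma p w \<noteq> 0" "jsigma p v \<noteq> 0"
  shows "deriv (jzeta p) w - deriv (jzeta p) v =
     qpoch p p ^ 4 * jsigma p (w + v) * jsigma p (w - v) / (jsigma p w ^ 2 * jsigma p v ^ 2)"
proof -
  let ?T = "jsigma p" let ?D = "deriv (jsigma p)" let ?D2 = "deriv (deriv (jsigma p))"
  note D = DERIV_chain2 [OF DERIV_jsigma(1) [OF p(1)]] DERIV_chain2 [OF DERIV_jsigma(2) [OF p(1)]]
  define A where "A = ?T (w + v) * ?T (w - v)"
  have rel: "A * ?T e ^ 2 - ?T (w + e) * ?T (w - e) * ?T v ^ 2 + ?T w ^ 2 * (?T (v + e) * ?T (v - e)) = 0" for e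
    using jsigma_three_term [OF p, of w v e 0] by (simp add: A_def power2_eq_square mult_ac)
  have "((\<lambda>e. A * ?T e ^ 2 - ?T (w + e) * ?T (w - e) * ?T v ^ 2 + ?T w ^ 2 * (?T (v + e) * ?T (v - e))) has_field_derivative
     (A * (2 * ?T e * ?D e) - (?D (w + e) * ?T (w - e) - ?T (w + e) * ?D (w - e)) * ?T v ^ 2
      + ?T w ^ 2 * (?D (v + e) * ?T (v - e) - ?T (v + e) * ?D (v - e)))) (at e)" for e
    by (rule derivative_eq_intros D refl)+ (simp add: algebra_simps)
  then have rel2: "A * (2 * ?T e * ?D e) - (?D (w + e) * ?T (w - e) - ?T (w + e) * ?D (w - e)) * ?T v ^ 2
      + ?T w ^ 2 * (?D (v + e) * ?T (v - e) - ?T (v + e) * ?D (v - e)) = 0" for e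
    unfolding rel by (rule DERIV_unique [OF _ DERIV_const])
  have "((\<lambda>e. A * (2 * ?T e * ?D e) - (?D (w + e) * ?T (w - e) - ?T (w + e) * ?D (w - e)) * ?T v ^ 2
      + ?T w ^ 2 * (?D (v + e) * ?T (v - e) - ?T (v + e) * ?D (v - e))) has_field_derivative
     (A * (2 * ?D 0 ^ 2) - 2 * (?D2 w * ?T w - ?D w ^ 2) * ?T v ^ 2 + ?T w ^ 2 * (2 * (?D2 v * ?T v - ?D v ^ 2)))) (at 0)"
    by (rule derivative_eq_intros D refl)+ (simp add: jsigma_0 p algebra_simps power2_eq_square)
  then have "A * (2 * ?D 0 ^ 2) - 2 * (?D2 w * ?T w - ?D w ^ 2) * ?T v ^ 2 + ?T w ^ 2 * (2 * (?D2 v * ?T v - ?D v ^ 2)) = 0"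
    unfolding rel2 by (rule DERIV_unique [OF _ DERIV_const])
  then have "2 * ((?D2 w * ?T w - ?D w ^ 2) * ?T v ^ 2 - (?D2 v * ?T v - ?D v ^ 2) * ?T w ^ 2) = 2 * (A * ?D 0 ^ 2)"
    by (simp add: algebra_simps)
  then have "(?D2 w * ?T w - ?D w ^ 2) * ?T v ^ 2 - (?D2 v * ?T v - ?D v ^ 2) * ?T w ^ 2 = A * ?D 0 ^ 2"
    by (simp only: mult_cancel_left) simp
  then have "(?D2 w * ?T w - ?D w ^ 2) * ?T v ^ 2 - (?D2 v * ?T v - ?D v ^ 2) * ?T w ^ 2 = qpoch p p ^ 4 * A"
    by (simp add: deriv_jsigma_0 p)
  moreover have "deriv (jzeta p) w - deriv (jzeta p) v =
      ((?D2 w * ?T w - ?D w ^ 2) * ?T v ^ 2 - (?D2 v * ?T v - ?D v ^ 2) * ?T w ^ 2) / (?T w ^ 2 * ?T v ^ 2)"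
    using nz by (simp add: DERIV_imp_deriv [OF DERIV_jzeta [OF p(1)]] diff_frac_eq)
  ultimately show ?thesis by (simp add: A_def mult_ac)
qed

lemma jsigma_eq_0_iff:
  assumes p: "norm p < 1"
  shows "jsigma p w = 0 \<longleftrightarrow> (\<exists>n. exp w * p ^ n = 1) \<or> (\<exists>n. p / exp w * p ^ n = 1)"
  by (simp add: jsigma_def jtheta_def qpoch_eq_0_iff [OF p])

text \<open>The pole term stays separate, so that the formula holds on an annulus around the unit
  circle and can be used at roots of unity.\<close>

theorem jzeta_eq_lambert:
  assumes p: "norm p < 1" and nz: "jsigma p w \<noteq> 0"
    and w: "norm (exp w * p) < 1" "norm (p / exp w) < 1"
  shows "jzeta p w = - 1 / 2 - exp w / (1 - exp w) - lambert (exp w * p) p + lambert (p / exp w) p"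
proof -
  define Q where "Q = deriv (\<lambda>z. qpoch z p)"
  have D: "((\<lambda>z. qpoch z p) has_field_derivative Q z) (at z)" for z
    unfolding Q_def using holomorphic_qpoch [OF p, of UNIV] by (rule holomorphic_derivI) auto
  note D' = DERIV_chain2 [OF D]
  have nz1: "qpoch (exp w) p \<noteq> 0" and nz2: "qpoch (p / exp w) p \<noteq> 0"
    using nz by (auto simp: jsigma_def jtheta_def)
  have "(jsigma p has_field_derivative
     jsigma p w * (- 1 / 2) + exp (- w / 2) * (Q (exp w) * exp w * qpoch (p / exp w) p - qpoch (exp w) p * (Q (p / exp w) * (p / exp w)))) (at w)"
    unfolding jsigma_def [abs_def] jtheta_def
    by (rule derivative_eq_intros D' refl | simp)+
  then have "jzeta p w = - 1 / 2 + qpoch_logderiv (exp w) p - qpoch_logderiv (p / exp w) p"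
    using nz1 nz2 unfolding jzeta_def qpoch_logderiv_def Q_def [symmetric]
    by (simp add: DERIV_imp_deriv jsigma_def jtheta_def field_simps)
  then show ?thesis
    using qpoch_logderiv_rec [OF p nz1 w(1)] qpoch_logderiv_eq_lambert [OF p w(2)] by simp
qed

subsection \<open>Theta functions of level five\<close>

lemma norm_power_less_one: "norm (q :: complex) < 1 \<Longrightarrow> n > 0 \<Longrightarrow> norm (q ^ n) < 1"
  by (simp add: norm_power power_less_one_iff)

text \<open>Inside the unit circle \<open>lambert_shift\<close> absorbs the pole term; this form
  serves the powers of \<open>q\<close>.\<close>

lemma jzeta_eq_lambert':
  assumes p: "norm p < 1" and w: "norm (exp w) < 1" "norm (p / exp w) < 1"
  shows "jzeta p w = - 1 / 2 - lambert (exp w) p + lambert (p / exp w) p"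
proof -
  have "jsigma p w \<noteq> 0"
    using qpoch_nonzero [OF p(1) w(1)] qpoch_nonzero [OF p(1) w(2)] by (simp add: jsigma_def jtheta_def)
  moreover have "norm (exp w * p) < 1" using w p norm_mult_less [of "exp w" 1 p 1] by simp
  ultimately show ?thesis using jzeta_eq_lambert [OF p _ _ w(2)] lambert_shift [OF p w(1)] by simp
qed

lemma jtheta_level_five:
  assumes q: "q \<noteq> 0"
  shows "jtheta q (q ^ 5) = qpoch q (q ^ 5) * qpoch (q ^ 4) (q ^ 5)"
    and "jtheta (q ^ 2) (q ^ 5) = qpoch (q ^ 2) (q ^ 5) * qpoch (q ^ 3) (q ^ 5)"
    and "jtheta (q ^ 3) (q ^ 5) = jtheta (q ^ 2) (q ^ 5)"
    and "jtheta (q ^ 4) (q ^ 5) = jtheta q (q ^ 5)"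
proof -
  have "q ^ 5 / q = q ^ 4" "q ^ 5 / q ^ 2 = q ^ 3" "q ^ 5 / q ^ 3 = q ^ 2" "q ^ 5 / q ^ 4 = q"
    using q by (simp_all add: eval_nat_numeral)
  then show "jtheta q (q ^ 5) = qpoch q (q ^ 5) * qpoch (q ^ 4) (q ^ 5)"
    "jtheta (q ^ 2) (q ^ 5) = qpoch (q ^ 2) (q ^ 5) * qpoch (q ^ 3) (q ^ 5)"
    "jtheta (q ^ 3) (q ^ 5) = jtheta (q ^ 2) (q ^ 5)"
    "jtheta (q ^ 4) (q ^ 5) = jtheta q (q ^ 5)"
    by (simp_all add: jtheta_def mult.commute)
qed

lemma qpoch_power_nonzero:
  assumes "norm q < 1" "0 < j" "0 < k"
  shows "qpoch (q ^ j) (q ^ k) \<noteq> 0"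
proof -
  have "q ^ j * (q ^ k) ^ n \<noteq> 1" for n
  proof -
    have "norm (q ^ (j + k * n)) < 1" using assms by (intro norm_power_less_one) auto
    then show ?thesis by (metis norm_one less_irrefl power_add power_mult)
  qed
  then show ?thesis using assms by (simp add: qpoch_eq_0_iff norm_power_less_one)
qed

lemma jtheta_level_five_nonzero:
  assumes q: "norm q < 1" "q \<noteq> 0"
  shows "jtheta q (q ^ 5) \<noteq> 0" "jtheta (q ^ 2) (q ^ 5) \<noteq> 0"
  using qpoch_power_nonzero [OF q(1), of 1 5] qpoch_power_nonzero [OF q(1), of 2 5]
    qpoch_power_nonzero [OF q(1), of 3 5] qpoch_power_nonzero [OF q(1), of 4 5]
  by (auto simp: jtheta_level_five [OF q(2)])

text \<open>Sort the factors \<open>1 - q ^ m\<close> by \<open>m\<close> modulo 5; the first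
  \<open>5 * n\<close> factors form a subsequence of the partial products.\<close>

lemma qpoch_level_five:
  assumes q: "norm q < 1" "q \<noteq> 0"
  shows "qpoch q q = jtheta q (q ^ 5) * jtheta (q ^ 2) (q ^ 5) * qpoch (q ^ 5) (q ^ 5)"
proof (rule LIMSEQ_unique)
  have p: "norm (q ^ 5) < 1" using q by (simp add: norm_power_less_one)
  have "(\<lambda>n. (\<Prod>i<n. 1 - q * (q ^ 5) ^ i) * (\<Prod>i<n. 1 - q ^ 4 * (q ^ 5) ^ i) *
      ((\<Prod>i<n. 1 - q ^ 2 * (q ^ 5) ^ i) * (\<Prod>i<n. 1 - q ^ 3 * (q ^ 5) ^ i)) * (\<Prod>i<n. 1 - q ^ 5 * (q ^ 5) ^ i))
    \<longlonglongrightarrow> jtheta q (q ^ 5) * jtheta (q ^ 2) (q ^ 5) * qpoch (q ^ 5) (q ^ 5)"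
    unfolding jtheta_level_five(1,2) [OF q(2)] by (intro tendsto_intros qpoch_LIMSEQ p)
  moreover have "(\<Prod>i<n. 1 - q * (q ^ 5) ^ i) * (\<Prod>i<n. 1 - q ^ 4 * (q ^ 5) ^ i) *
      ((\<Prod>i<n. 1 - q ^ 2 * (q ^ 5) ^ i) * (\<Prod>i<n. 1 - q ^ 3 * (q ^ 5) ^ i)) * (\<Prod>i<n. 1 - q ^ 5 * (q ^ 5) ^ i)
     = (\<Prod>i<5 * n. 1 - q * q ^ i)" for n
  proof (induction n)
    case (Suc n)
    have "(\<Prod>i<5 * Suc n. 1 - q * q ^ i) = (\<Prod>i<5 * n. 1 - q * q ^ i) *
       ((1 - q * (q ^ 5) ^ n) * (1 - q ^ 2 * (q ^ 5) ^ n) * (1 - q ^ 3 * (q ^ 5) ^ n) * (1 - q ^ 4 * (q ^ 5) ^ n) * (1 - q ^ 5 * (q ^ 5) ^ n))"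
    proof -
      have 5: "5 * Suc n = Suc (Suc (Suc (Suc (Suc (5 * n)))))" by simp
      have "(q ^ 5) ^ n = q ^ (5 * n)" by (simp add: power_mult)
      moreover have "q * q ^ Suc (5 * n) = q ^ 2 * q ^ (5 * n)" "q * q ^ Suc (Suc (5 * n)) = q ^ 3 * q ^ (5 * n)"
        "q * q ^ Suc (Suc (Suc (5 * n))) = q ^ 4 * q ^ (5 * n)" "q * q ^ Suc (Suc (Suc (Suc (5 * n)))) = q ^ 5 * q ^ (5 * n)"
        by (simp_all add: eval_nat_numeral)
      ultimately show ?thesis by (simp only: 5 prod.lessThan_Suc mult.assoc)
    qed
    then show ?case unfolding Suc [symmetric] by (simp add: mult_ac del: power_Suc)
  qed simp
  ultimately show "(\<lambda>n. \<Prod>i<5 * n. 1 - q * q ^ i) \<longlonglongrightarrow> jtheta q (q ^ 5) * jtheta (q ^ 2) (q ^ 5) * qpoch (q ^ 5) (q ^ 5)"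
    by simp
  show "(\<lambda>n. \<Prod>i<5 * n. 1 - q * q ^ i) \<longlonglongrightarrow> qpoch q q"
    by (rule filterlim_compose [OF qpoch_LIMSEQ [OF q(1)]]) (simp add: mult_nat_left_at_top)
qed

text \<open>By \<open>lambert_sums(1)\<close> this is the sum of
  \<open>c m * q ^ m / (1 - q ^ m)\<close> with the odd coefficient \<open>c\<close> modulo 5 that
  is 1 at 1, -1 at 4 and 0 elsewhere. \<open>lambert23\<close> is its counterpart for the residues 2
  and 3.\<close>

definition lambert14 :: "complex \<Rightarrow> complex" where
  "lambert14 q = lambert q (q ^ 5) - lambert (q ^ 4) (q ^ 5)"

definition lambert23 :: "complex \<Rightarrow> complex" where
  "lambert23 q = lambert (q ^ 2) (q ^ 5) - lambert (q ^ 3) (q ^ 5)"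

text \<open>The addition formula with base \<open>q ^ 5\<close> and \<open>exp w = q\<close>,
  applied to the pairs (\<open>w\<close>, \<open>2 * w\<close>) and (\<open>2 * w\<close>,
  \<open>w\<close>). Every \<open>jsigma\<close> that occurs is one of two theta values up to a
  half-integral power of \<open>q\<close>, because \<open>jtheta\<close> takes the same value at
  \<open>q ^ k\<close> and at \<open>q ^ (5 - k)\<close>.\<close>

lemma theta_quotient_lambert:
  assumes q: "norm q < 1" "q \<noteq> 0"
  shows "qpoch (q ^ 5) (q ^ 5) ^ 2 * jtheta (q ^ 2) (q ^ 5) ^ 2 / jtheta q (q ^ 5) ^ 3 = 1 + 3 * lambert14 q + lambert23 q"
    and "q * qpoch (q ^ 5) (q ^ 5) ^ 2 * jtheta q (q ^ 5) ^ 2 / jtheta (q ^ 2) (q ^ 5) ^ 3 = lambert14 q - 3 * lambert23 q"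
proof -
  define p where "p = q ^ 5"
  define w where "w = Ln q"
  \<comment> \<open>An inverse square root of \<open>q\<close>. In the first formula its powers
    cancel; in the second they leave \<open>1 / r ^ 2 = q\<close>.\<close>
  define r where "r = exp (- w / 2)"
  define t1 t2 where "t1 = jtheta q p" and "t2 = jtheta (q ^ 2) p"
  have p: "norm p < 1" "p \<noteq> 0" using q by (simp_all add: p_def norm_power_less_one)
  have ew: "exp (of_nat k * w) = q ^ k" for k using q by (simp add: exp_of_nat_mult w_def)
  have t: "t1 \<noteq> 0" "t2 \<noteq> 0" using jtheta_level_five_nonzero [OF q] by (simp_all add: t1_def t2_def p_def)
  have r: "r \<noteq> 0" "r ^ 2 * q = 1"
  proof -
    have "r ^ 2 = exp (- w)" by (simp add: r_def exp_double [symmetric])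
    then show "r ^ 2 * q = 1" using q by (simp add: exp_minus w_def)
  qed (simp add: r_def)
  have s: "jsigma p (of_nat k * w) = r ^ k * jtheta (q ^ k) p" for k
  proof -
    have "exp (- (of_nat k * w) / 2) = r ^ k" unfolding r_def by (simp flip: exp_of_nat_mult)
    then show ?thesis by (simp add: jsigma_def ew)
  qed
  have s1: "jsigma p w = r * t1" and s2: "jsigma p (2 * w) = r ^ 2 * t2"
    and s3: "jsigma p (3 * w) = r ^ 3 * t2" and s4: "jsigma p (4 * w) = r ^ 4 * t1"
    using s [of 1] s [of 2] s [of 3] s [of 4]
    by (simp_all add: t1_def t2_def p_def jtheta_level_five(3,4) [OF q(2)])
  have z: "jzeta p (of_nat k * w) = - 1 / 2 - lambert (q ^ k) p + lambert (q ^ (5 - k)) p" if "0 < k" "k < 5" for k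
  proof -
    have "p / q ^ k = q ^ (5 - k)" using that q by (simp add: p_def power_diff)
    then show ?thesis
      using jzeta_eq_lambert' [OF p(1), of "of_nat k * w"] that q by (simp add: ew norm_power_less_one)
  qed
  define a b where "a = lambert14 q" and "b = lambert23 q"
  have z1: "jzeta p w = - 1 / 2 - a" and z2: "jzeta p (2 * w) = - 1 / 2 - b" and z3: "jzeta p (3 * w) = - 1 / 2 + b"
    using z [of 1] z [of 2] z [of 3] by (simp_all add: a_def b_def lambert14_def lambert23_def p_def)
  have "jzeta p (w + 2 * w) + jzeta p (w - 2 * w) - 2 * jzeta p w =
     - (qpoch p p ^ 2) * jsigma p (2 * w) * jsigma p (2 * w) ^ 2 /
       (jsigma p w ^ 2 * jsigma p (w + 2 * w) * jsigma p (w - 2 * w))"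
    by (rule jzeta_addition [OF p]) (use t r in \<open>simp_all add: s1 s3 jsigma_minus p\<close>)
  moreover have "w + 2 * w = 3 * w" "w - 2 * w = - w" by simp_all
  ultimately have "- 1 / 2 + b + (1 / 2 + a) - 2 * (- 1 / 2 - a) =
      - (qpoch p p ^ 2) * (r ^ 2 * t2) * (r ^ 2 * t2) ^ 2 / ((r * t1) ^ 2 * (r ^ 3 * t2) * (- (r * t1)))"
    by (simp only: s1 s2 s3 z1 z3 jzeta_minus [OF p(1)] jsigma_minus [OF p(1)]) simp
  then have "1 + 3 * a + b = qpoch p p ^ 2 * (r ^ 2 * t2) ^ 3 / ((r * t1) ^ 3 * (r ^ 3 * t2))"
    by (simp add: power2_eq_square power3_eq_cube algebra_simps)
  also have "\<dots> = qpoch p p ^ 2 * t2 ^ 2 / t1 ^ 3"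
    using r t by (simp add: field_simps power2_eq_square power3_eq_cube)
  finally show "qpoch (q ^ 5) (q ^ 5) ^ 2 * jtheta (q ^ 2) (q ^ 5) ^ 2 / jtheta q (q ^ 5) ^ 3 = 1 + 3 * lambert14 q + lambert23 q"
    by (simp add: a_def b_def t1_def t2_def p_def)
  have "jzeta p (2 * w + w) + jzeta p (2 * w - w) - 2 * jzeta p (2 * w) =
     - (qpoch p p ^ 2) * jsigma p (2 * (2 * w)) * jsigma p w ^ 2 /
       (jsigma p (2 * w) ^ 2 * jsigma p (2 * w + w) * jsigma p (2 * w - w))"
    by (rule jzeta_addition [OF p]) (use t r in \<open>simp_all add: s1 s2 s3\<close>)
  moreover have "2 * w + w = 3 * w" "2 * w - w = w" "2 * (2 * w) = 4 * w" by simp_all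
  ultimately have "- 1 / 2 + b + (- 1 / 2 - a) - 2 * (- 1 / 2 - b) =
      - (qpoch p p ^ 2) * (r ^ 4 * t1) * (r * t1) ^ 2 / ((r ^ 2 * t2) ^ 2 * (r ^ 3 * t2) * (r * t1))"
    by (simp only: s1 s2 s3 s4 z1 z2 z3)
  then have "a - 3 * b = qpoch p p ^ 2 * (r ^ 4 * t1) * (r * t1) ^ 2 / ((r ^ 2 * t2) ^ 2 * (r ^ 3 * t2) * (r * t1))"
    by (simp add: algebra_simps)
  also have "\<dots> = qpoch p p ^ 2 * t1 ^ 2 / t2 ^ 3 / r ^ 2"
    using r t by (simp add: field_simps eval_nat_numeral)
  also have "\<dots> = q * qpoch p p ^ 2 * t1 ^ 2 / t2 ^ 3"
    using r t by (simp add: divide_simps) (metis mult.assoc mult.commute mult_1)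
  finally show "q * qpoch (q ^ 5) (q ^ 5) ^ 2 * jtheta q (q ^ 5) ^ 2 / jtheta (q ^ 2) (q ^ 5) ^ 3 = lambert14 q - 3 * lambert23 q"
    by (simp add: a_def b_def t1_def t2_def p_def)
qed

text \<open>Passage from base \<open>q\<close> to base \<open>q ^ 5\<close>: the terms with
  \<open>m\<close> congruent to \<open>j\<close> modulo 5 add up to
  \<open>lambert (q ^ j) (q ^ 5)\<close> in its first expansion. \<open>c 0 = 0\<close> removes the
  multiples of 5.\<close>

lemma sums_level_five:
  fixes c :: "nat \<Rightarrow> complex"
  assumes q: "norm q < 1"
    and c: "\<And>m. c (m + 5) = c m" "c 0 = 0"
    and f: "(\<lambda>m. c m * (q ^ m / (1 - q ^ m))) sums s"
  shows "s = c 1 * lambert q (q ^ 5) + c 2 * lambert (q ^ 2) (q ^ 5) + c 3 * lambert (q ^ 3) (q ^ 5) + c 4 * lambert (q ^ 4) (q ^ 5)"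
proof -
  have p: "norm (q ^ 5) < 1" using q by (simp add: norm_power_less_one)
  have per: "c (n * 5 + j) = c j" for n j
  proof (induction n)
    case (Suc n)
    have "c (Suc n * 5 + j) = c (n * 5 + j + 5)" by (simp add: algebra_simps)
    with Suc c show ?case by simp
  qed simp
  have l: "(\<lambda>n. q ^ (n * 5 + j) / (1 - q ^ (n * 5 + j))) sums lambert (q ^ j) (q ^ 5)" if "0 < j" for j
    using lambert_sums(1) [OF _ p, of "q ^ j"] that q
    by (simp add: norm_power_less_one power_add power_mult mult_ac flip: power_mult)
  define g where "g m = q ^ m / (1 - q ^ m)" for m
  have "(\<lambda>n. \<Sum>m = n * 5..<n * 5 + 5. c m * g m) sums s"
    by (rule sums_group) (use f in \<open>simp_all add: g_def\<close>)
  moreover have "(\<Sum>m = n * 5..<n * 5 + 5. c m * g m) =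
     c 1 * g (n * 5 + 1) + c 2 * g (n * 5 + 2) + c 3 * g (n * 5 + 3) + c 4 * g (n * 5 + 4)" for n
  proof -
    have "(\<Sum>m = n * 5..<n * 5 + 5. c m * g m) = (\<Sum>j = 0..<5. c (n * 5 + j) * g (n * 5 + j))"
      using sum.shift_bounds_nat_ivl [of "\<lambda>m. c m * g m" 0 "n * 5" 5] by (simp add: add.commute)
    also have "\<dots> = (\<Sum>j \<in> {0, 1, 2, 3, 4}. c j * g (n * 5 + j))"
      by (rule sum.cong) (auto simp: per)
    finally show ?thesis using c(2) by simp
  qed
  ultimately have "(\<lambda>n. c 1 * (q ^ (n * 5 + 1) / (1 - q ^ (n * 5 + 1))) + c 2 * (q ^ (n * 5 + 2) / (1 - q ^ (n * 5 + 2))) +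
     c 3 * (q ^ (n * 5 + 3) / (1 - q ^ (n * 5 + 3))) + c 4 * (q ^ (n * 5 + 4) / (1 - q ^ (n * 5 + 4)))) sums s" by (simp only: g_def)
  moreover have "(\<lambda>n. c 1 * (q ^ (n * 5 + 1) / (1 - q ^ (n * 5 + 1))) + c 2 * (q ^ (n * 5 + 2) / (1 - q ^ (n * 5 + 2))) +
     c 3 * (q ^ (n * 5 + 3) / (1 - q ^ (n * 5 + 3))) + c 4 * (q ^ (n * 5 + 4) / (1 - q ^ (n * 5 + 4)))) sums
     (c 1 * lambert (q ^ 1) (q ^ 5) + c 2 * lambert (q ^ 2) (q ^ 5) + c 3 * lambert (q ^ 3) (q ^ 5) + c 4 * lambert (q ^ 4) (q ^ 5))"
    by (intro sums_add sums_mult l) auto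
  ultimately show ?thesis using sums_unique2 by fastforce
qed

subsection \<open>Values at the fifth roots of unity\<close>

definition zeta5 :: complex where
  "zeta5 = exp (2 * of_real pi * \<i> / 5)"

lemma zeta5_power_5: "zeta5 ^ 5 = 1"
proof -
  have "zeta5 ^ 5 = exp (of_nat 5 * (2 * of_real pi * \<i> / 5))"
    unfolding zeta5_def by (rule exp_of_nat_mult [symmetric])
  also have "of_nat 5 * (2 * of_real pi * \<i> / 5) = 2 * of_real pi * \<i>" by simp
  finally show ?thesis by (simp only: exp_two_pi_i)
qed

lemma zeta5_neq_1: "zeta5 \<noteq> 1"
proof
  assume "zeta5 = 1"
  then obtain n :: int where "2 * pi / 5 = real_of_int (2 * n) * pi"
    by (auto simp: zeta5_def exp_eq_1)
  then have "1 / 5 = real_of_int n" by simp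
  then have "real_of_int (5 * n) = 1" by simp
  then have "5 * n = 1" by linarith
  then show False by presburger
qed

lemma zeta5_sum: "1 + zeta5 + zeta5 ^ 2 + zeta5 ^ 3 + zeta5 ^ 4 = 0"
proof -
  have "(zeta5 - 1) * (1 + zeta5 + zeta5 ^ 2 + zeta5 ^ 3 + zeta5 ^ 4) = zeta5 ^ 5 - 1"
    by (simp add: algebra_simps eval_nat_numeral)
  then show ?thesis using zeta5_power_5 zeta5_neq_1 by simp
qed

lemma zeta5_power_mod: "zeta5 ^ n = zeta5 ^ (n mod 5)"
proof -
  have "zeta5 ^ n = zeta5 ^ (5 * (n div 5) + n mod 5)" by simp
  also have "\<dots> = zeta5 ^ (n mod 5)" by (simp only: power_add power_mult zeta5_power_5) simp
  finally show ?thesis .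
qed

lemma zeta5_power_neq_1: "0 < k \<Longrightarrow> k < 5 \<Longrightarrow> zeta5 ^ k \<noteq> 1"
proof -
  assume "0 < k" "k < 5"
  then have "k \<in> {1, 2, 3, 4}" by auto
  moreover have "(zeta5 ^ 2) ^ 3 = zeta5" "(zeta5 ^ 3) ^ 2 = zeta5" "(zeta5 ^ 4) ^ 4 = zeta5"
    using zeta5_power_mod [of 6] zeta5_power_mod [of 16] by (simp_all flip: power_mult)
  then have "zeta5 ^ 2 \<noteq> 1" "zeta5 ^ 3 \<noteq> 1" "zeta5 ^ 4 \<noteq> 1"
    using zeta5_neq_1 by (metis power_one)+
  ultimately show "zeta5 ^ k \<noteq> 1" using zeta5_neq_1 by auto
qed

text \<open>The quadratic Gauss sum modulo 5; its value is sqrt 5.\<close>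

definition gauss5 :: complex where
  "gauss5 = zeta5 - zeta5 ^ 2 - zeta5 ^ 3 + zeta5 ^ 4"

text \<open>Once denominators are cleared, these are polynomial identities modulo the cyclotomic
  relation \<open>zeta5_sum\<close>. The quotients \<open>zeta5 / (1 - zeta5)\<close> and
  \<open>zeta5 ^ 2 / (1 - zeta5 ^ 2)\<close> are cotangent values, written in the basis
  \<open>d1\<close>, \<open>d2\<close> in which the Lambert series at roots of unity also
  appear.\<close>

lemma zeta5_relations:
  defines "d1 \<equiv> zeta5 - zeta5 ^ 4" and "d2 \<equiv> zeta5 ^ 2 - zeta5 ^ 3"
  shows "gauss5 ^ 2 = 5" "d1 * d2 = - gauss5" "d1 ^ 2 - d2 ^ 2 = - gauss5"
    and "zeta5 / (1 - zeta5) = - 1 / 2 + (3 * d1 + d2) / 10"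
    and "zeta5 ^ 2 / (1 - zeta5 ^ 2) = - 1 / 2 + (3 * d2 - d1) / 10"
    and "zeta5 / (1 - zeta5) ^ 2 - zeta5 ^ 2 / (1 - zeta5 ^ 2) ^ 2 = - gauss5 / 5"
    and "- zeta5 * (1 - zeta5) * (1 - zeta5 ^ 2) = - gauss5"
proof -
  define z where "z = zeta5"
  have s: "1 + z + z ^ 2 + z ^ 3 + z ^ 4 = 0" unfolding z_def by (rule zeta5_sum)
  have nz: "1 - z \<noteq> 0" "1 - z ^ 2 \<noteq> 0" using zeta5_power_neq_1 [of 1] zeta5_power_neq_1 [of 2] by (auto simp: z_def)
  have g: "gauss5 = z - z ^ 2 - z ^ 3 + z ^ 4" by (simp add: gauss5_def z_def)
  note defs = g d1_def d2_def
  note f = z_def [symmetric]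
  show "gauss5 ^ 2 = 5" unfolding g using s by algebra
  show "d1 * d2 = - gauss5" unfolding defs f using s by algebra
  show "d1 ^ 2 - d2 ^ 2 = - gauss5" unfolding defs f using s by algebra
  have frac: "a / b = - 1 / 2 + c / 10" if "10 * a = b * (- 5 + c)" "b \<noteq> 0" for a b c :: complex
  proof -
    have "a / b = (- 5 + c) / 10" using that by (simp add: frac_eq_eq mult.commute)
    then show ?thesis by (simp add: diff_divide_distrib)
  qed
  have "10 * z = (1 - z) * (- 5 + (3 * d1 + d2))" unfolding defs f using s by algebra
  then show "zeta5 / (1 - zeta5) = - 1 / 2 + (3 * d1 + d2) / 10" using nz unfolding f by (intro frac)
  have "10 * z ^ 2 = (1 - z ^ 2) * (- 5 + (3 * d2 - d1))" unfolding defs f using s by algebra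
  then show "zeta5 ^ 2 / (1 - zeta5 ^ 2) = - 1 / 2 + (3 * d2 - d1) / 10" using nz unfolding f by (intro frac)
  have "5 * (z * (1 - z ^ 2) ^ 2 - z ^ 2 * (1 - z) ^ 2) = - gauss5 * ((1 - z) ^ 2 * (1 - z ^ 2) ^ 2)" unfolding defs f using s by algebra
  then show "zeta5 / (1 - zeta5) ^ 2 - zeta5 ^ 2 / (1 - zeta5 ^ 2) ^ 2 = - gauss5 / 5"
  proof -
    have "N / D = - gauss5 / 5" if "5 * N = - gauss5 * D" "D \<noteq> 0" for N D :: complex
      using that frac_eq_eq [of D 5 N "- gauss5"] by (simp add: mult.commute)
    then show ?thesis
      using nz \<open>5 * _ = - gauss5 * _\<close> unfolding f by (simp add: diff_frac_eq mult.commute)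
  qed
  show "- zeta5 * (1 - zeta5) * (1 - zeta5 ^ 2) = - gauss5" unfolding defs f by (simp add: algebra_simps eval_nat_numeral)
qed

lemma jsigma_add_2pi_i: "jsigma p (w + 2 * of_real pi * \<i>) = - jsigma p w"
proof -
  have "- (w + 2 * of_real pi * \<i>) / 2 = - w / 2 + - (of_real pi * \<i>)"
    by (simp add: add_divide_distrib diff_divide_distrib)
  then have "exp (- (w + 2 * of_real pi * \<i>) / 2) = exp (- w / 2) * exp (- (of_real pi * \<i>))"
    by (simp only: exp_add)
  also have "exp (- (of_real pi * \<i>)) = -1" by (simp add: exp_minus)
  finally show ?thesis by (simp add: jsigma_def exp_add)
qed

lemma jzeta_add_2pi_i:
  assumes "norm p < 1"
  shows "jzeta p (w + 2 * of_real pi * \<i>) = jzeta p w"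
proof -
  have "((\<lambda>w. - jsigma p (w + 2 * of_real pi * \<i>)) has_field_derivative - deriv (jsigma p) (w + 2 * of_real pi * \<i>)) (at w)"
    by (rule derivative_eq_intros DERIV_chain2 [OF DERIV_jsigma(1) [OF assms]] refl)+ simp
  then have "deriv (jsigma p) w = - deriv (jsigma p) (w + 2 * of_real pi * \<i>)"
    by (intro DERIV_imp_deriv) (simp add: jsigma_add_2pi_i)
  then show ?thesis by (simp add: jzeta_def jsigma_add_2pi_i)
qed

text \<open>Factor by factor: the product of \<open>1 - zeta5 ^ k * x\<close> over all residues
  \<open>k\<close> modulo 5 is \<open>1 - x ^ 5\<close>.\<close>

lemma prod_roots_qpoch:
  assumes q: "norm q < 1"
  shows "qpoch (zeta5 * q) q * qpoch (zeta5 ^ 2 * q) q * qpoch (zeta5 ^ 3 * q) q * qpoch (zeta5 ^ 4 * q) q * qpoch q q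
    = qpoch (q ^ 5) (q ^ 5)"
proof (rule LIMSEQ_unique)
  have eq: "(1 - zeta5 * x) * (1 - zeta5 ^ 2 * x) * (1 - zeta5 ^ 3 * x) * (1 - zeta5 ^ 4 * x) * (1 - x) = 1 - x ^ 5" for x
    using zeta5_sum by algebra
  have "(\<lambda>n. (\<Prod>i<n. 1 - zeta5 * q * q ^ i) * (\<Prod>i<n. 1 - zeta5 ^ 2 * q * q ^ i) * (\<Prod>i<n. 1 - zeta5 ^ 3 * q * q ^ i) *
     (\<Prod>i<n. 1 - zeta5 ^ 4 * q * q ^ i) * (\<Prod>i<n. 1 - q * q ^ i)) \<longlonglongrightarrow>
     qpoch (zeta5 * q) q * qpoch (zeta5 ^ 2 * q) q * qpoch (zeta5 ^ 3 * q) q * qpoch (zeta5 ^ 4 * q) q * qpoch q q"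
    by (intro tendsto_intros qpoch_LIMSEQ q)
  moreover have "(\<Prod>i<n. 1 - zeta5 * q * q ^ i) * (\<Prod>i<n. 1 - zeta5 ^ 2 * q * q ^ i) * (\<Prod>i<n. 1 - zeta5 ^ 3 * q * q ^ i) *
     (\<Prod>i<n. 1 - zeta5 ^ 4 * q * q ^ i) * (\<Prod>i<n. 1 - q * q ^ i) = (\<Prod>i<n. 1 - q ^ 5 * (q ^ 5) ^ i)" for n
  proof -
    have "(1 - zeta5 * q * q ^ i) * (1 - zeta5 ^ 2 * q * q ^ i) * (1 - zeta5 ^ 3 * q * q ^ i) * (1 - zeta5 ^ 4 * q * q ^ i) * (1 - q * q ^ i)
       = 1 - q ^ 5 * (q ^ 5) ^ i" for i
    proof -
      have "(q * q ^ i) ^ 5 = q ^ 5 * (q ^ 5) ^ i" by (simp only: power_mult_distrib power_mult [symmetric] mult.commute)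
      then show ?thesis using eq [of "q * q ^ i"] by (simp only: mult.assoc)
    qed
    then show ?thesis by (simp only: prod.distrib [symmetric])
  qed
  ultimately show "(\<lambda>n. \<Prod>i<n. 1 - q ^ 5 * (q ^ 5) ^ i) \<longlonglongrightarrow>
     qpoch (zeta5 * q) q * qpoch (zeta5 ^ 2 * q) q * qpoch (zeta5 ^ 3 * q) q * qpoch (zeta5 ^ 4 * q) q * qpoch q q" by simp
  show "(\<lambda>n. \<Prod>i<n. 1 - q ^ 5 * (q ^ 5) ^ i) \<longlonglongrightarrow> qpoch (q ^ 5) (q ^ 5)"
    using q by (intro qpoch_LIMSEQ norm_power_less_one) auto
qed

text \<open>In the expansion in powers of the argument, the root of unity only contributes the
  coefficient \<open>zeta5 ^ (i * m)\<close>, which has period 5 in \<open>m\<close>. So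
  \<open>sums_level_five\<close> applies, and since the difference of conjugate coefficients is odd,
  two series remain.\<close>

lemma lambert_zeta5_diff:
  assumes q: "norm q < 1"
  defines "d1 \<equiv> zeta5 - zeta5 ^ 4" and "d2 \<equiv> zeta5 ^ 2 - zeta5 ^ 3"
  shows "lambert (zeta5 * q) q - lambert (zeta5 ^ 4 * q) q = d1 * lambert14 q + d2 * lambert23 q"
    and "lambert (zeta5 ^ 2 * q) q - lambert (zeta5 ^ 3 * q) q = d2 * lambert14 q - d1 * lambert23 q"
proof -
  have nz: "norm (zeta5 ^ k * q) < 1" for k
    using q by (simp add: zeta5_def norm_mult norm_power norm_exp)
  have gen: "lambert (zeta5 ^ i * q) q - lambert (zeta5 ^ j * q) q =
    c 1 * lambert q (q ^ 5) + c 2 * lambert (q ^ 2) (q ^ 5) + c 3 * lambert (q ^ 3) (q ^ 5) + c 4 * lambert (q ^ 4) (q ^ 5)"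
    if "c = (\<lambda>m. zeta5 ^ (i * m) - zeta5 ^ (j * m))" for c i j
  proof (rule sums_level_five [OF q])
    have "zeta5 ^ (i * (m + 5)) = zeta5 ^ (i * m)" for i m
      by (simp only: distrib_left power_add) (simp add: power_mult zeta5_power_5 mult.commute [of i 5])
    then show "c (m + 5) = c m" for m by (simp only: that)
    show "c 0 = 0" by (simp add: that)
    have "(\<lambda>m. (zeta5 ^ i * q) ^ m / (1 - q ^ m) - (zeta5 ^ j * q) ^ m / (1 - q ^ m)) sums
       (lambert (zeta5 ^ i * q) q - lambert (zeta5 ^ j * q) q)"
      by (intro sums_diff lambert_sums(2) nz q)
    then show "(\<lambda>m. c m * (q ^ m / (1 - q ^ m))) sums (lambert (zeta5 ^ i * q) q - lambert (zeta5 ^ j * q) q)"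
      by (simp add: that power_mult_distrib power_mult left_diff_distrib diff_divide_distrib)
  qed
  note m = zeta5_power_mod [of 6] zeta5_power_mod [of 8] zeta5_power_mod [of 9] zeta5_power_mod [of 12] zeta5_power_mod [of 16]
  show "lambert (zeta5 * q) q - lambert (zeta5 ^ 4 * q) q = d1 * lambert14 q + d2 * lambert23 q"
    using gen [OF refl, of 1 4] m by (simp add: d1_def d2_def lambert14_def lambert23_def algebra_simps power2_eq_square)
  show "lambert (zeta5 ^ 2 * q) q - lambert (zeta5 ^ 3 * q) q = d2 * lambert14 q - d1 * lambert23 q"
    using gen [OF refl, of 2 3] m by (simp add: d1_def d2_def lambert14_def lambert23_def algebra_simps power2_eq_square)
qed

definition omega5 :: complex where
  "omega5 = 2 * of_real pi * \<i> / 5"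

lemma exp_omega5: "exp (of_nat k * omega5) = zeta5 ^ k"
  unfolding omega5_def zeta5_def by (rule exp_of_nat_mult)

lemma jsigma_omega5_nonzero:
  assumes q: "norm q < 1" and k: "0 < k" "k < 5"
  shows "jsigma q (of_nat k * omega5) \<noteq> 0"
proof -
  have n: "norm (zeta5 ^ k) = 1" by (simp add: zeta5_def norm_power norm_exp)
  have "zeta5 ^ k * q ^ n \<noteq> 1" for n
  proof (cases n)
    case 0 then show ?thesis using zeta5_power_neq_1 [OF k] by simp
  next
    case (Suc m)
    then have "norm (zeta5 ^ k * q ^ n) < 1" using norm_power_less_one [OF q, of n] n by (simp only: norm_mult) simp
    then show ?thesis by force
  qed
  moreover have "q / zeta5 ^ k * q ^ n \<noteq> 1" for n
  proof -
    have "norm (q / zeta5 ^ k * q ^ n) = norm (q ^ Suc n)" using n by (simp add: norm_mult norm_divide)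
    also have "\<dots> < 1" using q by (intro norm_power_less_one) auto
    finally show ?thesis by force
  qed
  ultimately show ?thesis unfolding jsigma_eq_0_iff [OF q] exp_omega5 by blast
qed

lemma jsigma_omega5:
  assumes q: "norm q < 1"
  shows "jsigma q (3 * omega5) = jsigma q (2 * omega5)" "jsigma q (4 * omega5) = jsigma q omega5"
    and "jzeta q (3 * omega5) = - jzeta q (2 * omega5)"
proof -
  have 3: "3 * omega5 = - (2 * omega5) + 2 * of_real pi * \<i>" and 4: "4 * omega5 = - omega5 + 2 * of_real pi * \<i>"
    by (simp_all add: omega5_def field_simps)
  show "jsigma q (3 * omega5) = jsigma q (2 * omega5)" "jsigma q (4 * omega5) = jsigma q omega5"
    unfolding 3 4 jsigma_add_2pi_i by (simp_all add: jsigma_minus q)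
  show "jzeta q (3 * omega5) = - jzeta q (2 * omega5)"
    unfolding 3 jzeta_add_2pi_i [OF q] by (rule jzeta_minus [OF q])
qed

lemma jsigma_omega5_mult:
  assumes q: "norm q < 1"
  shows "jsigma q omega5 * jsigma q (2 * omega5) * qpoch q q = - gauss5 * qpoch (q ^ 5) (q ^ 5)"
proof -
  \<comment> \<open>\<open>5 * omega5 / 2\<close> is \<open>pi * \<i>\<close>, hence
    \<open>- 3 * omega5 / 2\<close> equals \<open>omega5 - pi * \<i>\<close>.\<close>
  have e: "exp (- omega5 / 2) * exp (- (2 * omega5) / 2) = - zeta5"
  proof -
    have "exp (- omega5 / 2) * exp (- (2 * omega5) / 2) = exp (omega5 + - (of_real pi * \<i>))"
      by (simp add: omega5_def exp_add [symmetric] field_simps)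
    also have "\<dots> = - exp omega5" by (simp only: exp_add) (simp add: exp_minus)
    finally show ?thesis using exp_omega5 [of 1] by simp
  qed
  have z: "q / zeta5 = zeta5 ^ 4 * q" "q / zeta5 ^ 2 = zeta5 ^ 3 * q"
    using zeta5_power_5 by (simp_all add: divide_simps eval_nat_numeral zeta5_def mult_ac)
  have "exp omega5 = zeta5" "exp (2 * omega5) = zeta5 ^ 2" using exp_omega5 [of 1] exp_omega5 [of 2] by simp_all
  then have "jsigma q omega5 * jsigma q (2 * omega5) = exp (- omega5 / 2) * exp (- (2 * omega5) / 2) *
     (1 - zeta5) * (1 - zeta5 ^ 2) *
     (qpoch (zeta5 * q) q * qpoch (zeta5 ^ 2 * q) q * qpoch (zeta5 ^ 3 * q) q * qpoch (zeta5 ^ 4 * q) q)"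
    unfolding jsigma_def jtheta_def by (simp add: z qpoch_rec [OF q, of zeta5] qpoch_rec [OF q, of "zeta5 ^ 2"])
  then show ?thesis unfolding e zeta5_relations(7) by (simp add: prod_roots_qpoch [OF q, symmetric])
qed

text \<open>The addition formula at (\<open>omega5\<close>, \<open>2 * omega5\<close>) and at the
  swapped pair expresses E^2 t2^2 / t1^3 and - E^2 t1^2 / t2^3 linearly in the two Lambert series,
  where t1, t2 are the theta values and E is \<open>qpoch q q\<close>. In their product the theta
  values survive only as t1 t2, which \<open>jsigma_omega5_mult\<close> evaluates.\<close>

lemma eta_quotient_lambert:
  assumes q: "norm q < 1" "q \<noteq> 0"
  defines "\<alpha> \<equiv> 1 + 3 * lambert14 q + lambert23 q" and "\<beta> \<equiv> lambert14 q - 3 * lambert23 q"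
  shows "qpoch q q ^ 5 / qpoch (q ^ 5) (q ^ 5) = \<alpha> ^ 2 - 11 * \<alpha> * \<beta> - \<beta> ^ 2"
proof -
  define d1 d2 where "d1 = zeta5 - zeta5 ^ 4" and "d2 = zeta5 ^ 2 - zeta5 ^ 3"
  \<comment> \<open>The shifts absorb the constants from the pole terms: \<open>jzeta\<close>
    becomes a linear form in \<open>a\<close>, \<open>b\<close> without constant term, and \<alpha>
    = \<open>3 * a + b\<close>, \<beta> = \<open>a - 3 * b\<close>.\<close>
  define a b where "a = lambert14 q + 3 / 10" and "b = lambert23 q + 1 / 10"
  let ?w = omega5
  define t1 t2 where "t1 = jsigma q ?w" and "t2 = jsigma q (2 * ?w)"
  define E where "E = qpoch q q"
  have t: "t1 \<noteq> 0" "t2 \<noteq> 0"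
    using jsigma_omega5_nonzero [OF q(1), of 1] jsigma_omega5_nonzero [OF q(1), of 2] by (simp_all add: t1_def t2_def)
  have ew: "exp ?w = zeta5" "exp (2 * ?w) = zeta5 ^ 2" using exp_omega5 [of 1] exp_omega5 [of 2] by simp_all
  have nz: "norm zeta5 = 1" by (simp add: zeta5_def norm_exp)
  have zq: "q / zeta5 = zeta5 ^ 4 * q" "q / zeta5 ^ 2 = zeta5 ^ 3 * q"
    using zeta5_power_5 by (simp_all add: divide_simps eval_nat_numeral zeta5_def mult_ac)
  have L1: "jzeta q ?w = - (d1 * a + d2 * b)"
  proof -
    have "jzeta q ?w = - 1 / 2 - zeta5 / (1 - zeta5) - (lambert (zeta5 * q) q - lambert (zeta5 ^ 4 * q) q)"
      using jzeta_eq_lambert [OF q(1), of ?w] t q nz unfolding ew zq t1_def by (simp add: norm_mult norm_power)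
    also have "\<dots> = - ((3 * d1 + d2) / 10) - (d1 * lambert14 q + d2 * lambert23 q)"
      unfolding lambert_zeta5_diff [OF q(1)] zeta5_relations d1_def [symmetric] d2_def [symmetric] by simp
    also have "\<dots> = - (d1 * a + d2 * b)" by (simp add: a_def b_def algebra_simps add_divide_distrib)
    finally show ?thesis .
  qed
  have L2: "jzeta q (2 * ?w) = - (d2 * a - d1 * b)"
  proof -
    have "jzeta q (2 * ?w) = - 1 / 2 - zeta5 ^ 2 / (1 - zeta5 ^ 2) - (lambert (zeta5 ^ 2 * q) q - lambert (zeta5 ^ 3 * q) q)"
      using jzeta_eq_lambert [OF q(1), of "2 * ?w"] t q nz unfolding ew zq t2_def by (simp add: norm_mult norm_power)
    also have "\<dots> = - ((3 * d2 - d1) / 10) - (d2 * lambert14 q - d1 * lambert23 q)"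
      unfolding lambert_zeta5_diff [OF q(1)] zeta5_relations d1_def [symmetric] d2_def [symmetric] by simp
    also have "\<dots> = - (d2 * a - d1 * b)" by (simp add: a_def b_def algebra_simps add_divide_distrib diff_divide_distrib)
    finally show ?thesis .
  qed
  note J = jsigma_omega5 [OF q(1)] jsigma_minus [OF q(1)] jzeta_minus [OF q(1)]
  have e: "?w + 2 * ?w = 3 * ?w" "?w - 2 * ?w = - ?w" "2 * ?w + ?w = 3 * ?w" "2 * ?w - ?w = ?w" "2 * (2 * ?w) = 4 * ?w"
    by simp_all
  have "jzeta q (?w + 2 * ?w) + jzeta q (?w - 2 * ?w) - 2 * jzeta q ?w =
     - (qpoch q q ^ 2) * jsigma q (2 * ?w) * jsigma q (2 * ?w) ^ 2 /
       (jsigma q ?w ^ 2 * jsigma q (?w + 2 * ?w) * jsigma q (?w - 2 * ?w))"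
    by (rule jzeta_addition [OF q]) (use t in \<open>simp_all only: e J t1_def t2_def, simp_all\<close>)
  then have *: "- jzeta q (2 * ?w) + - jzeta q ?w - 2 * jzeta q ?w = - (E ^ 2) * t2 * t2 ^ 2 / (t1 ^ 2 * t2 * - t1)"
    unfolding e J t1_def [symmetric] t2_def [symmetric] E_def [symmetric] .
  have "- 3 * jzeta q ?w - jzeta q (2 * ?w) = - jzeta q (2 * ?w) + - jzeta q ?w - 2 * jzeta q ?w" by simp
  also have "\<dots> = E ^ 2 * t2 ^ 2 / t1 ^ 3"
    unfolding * using t by (simp add: field_simps power2_eq_square power3_eq_cube)
  finally have A: "- 3 * jzeta q ?w - jzeta q (2 * ?w) = E ^ 2 * t2 ^ 2 / t1 ^ 3" .
  have "jzeta q (2 * ?w + ?w) + jzeta q (2 * ?w - ?w) - 2 * jzeta q (2 * ?w) =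
     - (qpoch q q ^ 2) * jsigma q (2 * (2 * ?w)) * jsigma q ?w ^ 2 /
       (jsigma q (2 * ?w) ^ 2 * jsigma q (2 * ?w + ?w) * jsigma q (2 * ?w - ?w))"
    by (rule jzeta_addition [OF q]) (use t in \<open>simp_all only: e J t1_def t2_def, simp_all\<close>)
  then have *: "- jzeta q (2 * ?w) + jzeta q ?w - 2 * jzeta q (2 * ?w) = - (E ^ 2) * t1 * t1 ^ 2 / (t2 ^ 2 * t2 * t1)"
    unfolding e J t1_def [symmetric] t2_def [symmetric] E_def [symmetric] .
  have "jzeta q ?w - 3 * jzeta q (2 * ?w) = - jzeta q (2 * ?w) + jzeta q ?w - 2 * jzeta q (2 * ?w)" by simp
  also have "\<dots> = - (E ^ 2) * t1 ^ 2 / t2 ^ 3"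
    unfolding * using t by (simp add: field_simps power2_eq_square power3_eq_cube)
  finally have B: "jzeta q ?w - 3 * jzeta q (2 * ?w) = - (E ^ 2) * t1 ^ 2 / t2 ^ 3" .
  have "(- 3 * jzeta q ?w - jzeta q (2 * ?w)) * (jzeta q ?w - 3 * jzeta q (2 * ?w)) = - (E ^ 4) / (t1 * t2)"
    unfolding A B using t by (simp add: field_simps eval_nat_numeral)
  moreover have "(- 3 * jzeta q ?w - jzeta q (2 * ?w)) * (jzeta q ?w - 3 * jzeta q (2 * ?w))
      = gauss5 * (\<alpha> ^ 2 - 11 * \<alpha> * \<beta> - \<beta> ^ 2) / 5"
  proof -
    have ab: "a = (3 * \<alpha> + \<beta>) / 10" "b = (\<alpha> - 3 * \<beta>) / 10"
      by (simp_all add: a_def b_def \<alpha>_def \<beta>_def field_simps)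
    have r: "d1 * d2 = - gauss5" "d1 ^ 2 - d2 ^ 2 = - gauss5"
      unfolding d1_def d2_def by (rule zeta5_relations)+
    \<comment> \<open>The factor 100 clears the denominators 10 of the two linear forms. What
      remains is a polynomial identity modulo the relations for \<open>d1\<close> and
      \<open>d2\<close>; the coefficient 11 comes from here.\<close>
    have "25 * ((- 3 * jzeta q ?w - jzeta q (2 * ?w)) * (jzeta q ?w - 3 * jzeta q (2 * ?w))) * 4 =
        20 * gauss5 * (\<alpha> ^ 2 - 11 * \<alpha> * \<beta> - \<beta> ^ 2)"
    proof -
      have 1: "10 * (- 3 * jzeta q ?w - jzeta q (2 * ?w)) = 3 * (d1 * (3 * \<alpha> + \<beta>) + d2 * (\<alpha> - 3 * \<beta>)) + (d2 * (3 * \<alpha> + \<beta>) - d1 * (\<alpha> - 3 * \<beta>))"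
        unfolding L1 L2 ab by (simp add: field_simps)
      have 2: "10 * (jzeta q ?w - 3 * jzeta q (2 * ?w)) = - (d1 * (3 * \<alpha> + \<beta>) + d2 * (\<alpha> - 3 * \<beta>)) + 3 * (d2 * (3 * \<alpha> + \<beta>) - d1 * (\<alpha> - 3 * \<beta>))"
        unfolding L1 L2 ab by (simp add: field_simps)
      have "(3 * (d1 * (3 * \<alpha> + \<beta>) + d2 * (\<alpha> - 3 * \<beta>)) + (d2 * (3 * \<alpha> + \<beta>) - d1 * (\<alpha> - 3 * \<beta>))) *
         (- (d1 * (3 * \<alpha> + \<beta>) + d2 * (\<alpha> - 3 * \<beta>)) + 3 * (d2 * (3 * \<alpha> + \<beta>) - d1 * (\<alpha> - 3 * \<beta>)))
         = 20 * gauss5 * (\<alpha> ^ 2 - 11 * \<alpha> * \<beta> - \<beta> ^ 2)"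
        using r by algebra
      moreover have "25 * (X * Y) * 4 = (10 * X) * (10 * Y)" for X Y :: complex by simp
      ultimately show ?thesis by (simp only: 1 2)
    qed
    moreover have "X * Y = g * Z / 5" if "25 * (X * Y) * 4 = 20 * g * Z" for X Y Z g :: complex
      using that by (simp add: eq_divide_eq mult_ac)
    ultimately show ?thesis by blast
  qed
  ultimately have *: "gauss5 * (\<alpha> ^ 2 - 11 * \<alpha> * \<beta> - \<beta> ^ 2) / 5 = - (E ^ 4) / (t1 * t2)"
    by (simp only:)
  have "gauss5 * (\<alpha> ^ 2 - 11 * \<alpha> * \<beta> - \<beta> ^ 2) / 5 * (t1 * t2) = - (E ^ 4)"
    unfolding * using t by simp
  moreover have "X * (t1 * t2 * E) = - (E ^ 5)" if "X * (t1 * t2) = - (E ^ 4)" for X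
  proof -
    have "X * (t1 * t2 * E) = X * (t1 * t2) * E" by (simp only: mult.assoc)
    also have "\<dots> = - (E ^ 5)" unfolding that by (simp add: eval_nat_numeral)
    finally show ?thesis .
  qed
  ultimately have "gauss5 * (\<alpha> ^ 2 - 11 * \<alpha> * \<beta> - \<beta> ^ 2) / 5 * (t1 * t2 * E) = - (E ^ 5)" by blast
  then have "gauss5 * (\<alpha> ^ 2 - 11 * \<alpha> * \<beta> - \<beta> ^ 2) / 5 * (- gauss5 * qpoch (q ^ 5) (q ^ 5)) = - (E ^ 5)"
    unfolding t1_def t2_def E_def jsigma_omega5_mult [OF q(1)] .
  then have "gauss5 ^ 2 * (\<alpha> ^ 2 - 11 * \<alpha> * \<beta> - \<beta> ^ 2) * qpoch (q ^ 5) (q ^ 5) = 5 * E ^ 5"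
    by (simp add: field_simps power2_eq_square)
  moreover have "C / F = X" if "5 * X * F = 5 * C" "F \<noteq> 0" for C F X :: complex
    using that by (simp add: divide_eq_eq mult.assoc)
  moreover have "qpoch (q ^ 5) (q ^ 5) \<noteq> 0" using q by (intro qpoch_power_nonzero) auto
  ultimately show ?thesis unfolding zeta5_relations E_def by blast
qed

text \<open>By \<open>theta_quotient_lambert\<close> \<alpha> and \<beta> are theta quotients with
  \<beta> / \<alpha> = \<open>u\<close>. Dividing the quadratic form by \<alpha>^2 gives the
  left-hand polynomial, and \<open>qpoch_level_five\<close> removes the theta values that are left
  over.\<close>

theorem theta_quotient_relation:
  assumes q: "norm q < 1" "q \<noteq> 0"
  defines "u \<equiv> q * jtheta q (q ^ 5) ^ 5 / jtheta (q ^ 2) (q ^ 5) ^ 5"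
  shows "(1 - 11 * u - u ^ 2) * (q * qpoch (q ^ 5) (q ^ 5) ^ 6) = u * qpoch q q ^ 6"
proof -
  define E F s t where "E = qpoch q q" and "F = qpoch (q ^ 5) (q ^ 5)" and "s = jtheta q (q ^ 5)" and "t = jtheta (q ^ 2) (q ^ 5)"
  have nz: "s \<noteq> 0" "t \<noteq> 0" "F \<noteq> 0" "q \<noteq> 0"
    using jtheta_level_five_nonzero [OF q] qpoch_power_nonzero [OF q(1), of 5 5] q by (simp_all add: s_def t_def F_def)
  have E: "E = s * t * F" unfolding E_def F_def s_def t_def by (rule qpoch_level_five [OF q])
  have "E ^ 5 / F = (F ^ 2 * t ^ 2 / s ^ 3) ^ 2 - 11 * (F ^ 2 * t ^ 2 / s ^ 3) * (q * F ^ 2 * s ^ 2 / t ^ 3) - (q * F ^ 2 * s ^ 2 / t ^ 3) ^ 2"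
    using eta_quotient_lambert [OF q] unfolding theta_quotient_lambert [OF q, symmetric] E_def F_def s_def t_def .
  also have "\<dots> = (F ^ 4 * t ^ 4 / s ^ 6) * (1 - 11 * (q * s ^ 5 / t ^ 5) - (q * s ^ 5 / t ^ 5) ^ 2)"
    using nz by (simp add: field_simps eval_nat_numeral)
  finally have "E ^ 5 / F = (F ^ 4 * t ^ 4 / s ^ 6) * (1 - 11 * u - u ^ 2)"
    by (simp add: u_def s_def t_def)
  then have "(1 - 11 * u - u ^ 2) = E ^ 5 * s ^ 6 / (F ^ 5 * t ^ 4)"
    using nz by (simp add: field_simps eval_nat_numeral)
  then have "(1 - 11 * u - u ^ 2) * (q * F ^ 6) = E ^ 5 * s ^ 6 / (F ^ 5 * t ^ 4) * (q * F ^ 6)" by simp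
  also have "\<dots> = (q * s ^ 5 / t ^ 5) * (E ^ 5 * (s * t * F))"
    using nz by (simp add: field_simps eval_nat_numeral)
  also have "\<dots> = u * E ^ 6" unfolding E [symmetric] by (simp add: u_def s_def t_def eval_nat_numeral)
  finally show ?thesis by (simp add: E_def F_def)
qed

section \<open>Differentiated Lambert series and the quadratic character\<close>

lemma DERIV_lambert:
  assumes x: "norm x < 1" and p: "norm p < 1"
  obtains D where "((\<lambda>x. lambert x p) has_field_derivative D) (at x)"
    "(\<lambda>m. of_nat m * (x ^ m / (1 - p ^ m))) sums (x * D)"
proof -
  define c where "c m = 1 / (1 - p ^ m)" for m
  have s: "(\<lambda>m. c m * y ^ m) sums lambert y p" if "norm y < 1" for y
    using lambert_sums(2) [OF that p] by (simp add: c_def)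
  obtain r where r: "norm x < r" "r < 1" using dense x by blast
  then have "0 \<le> r" using norm_ge_zero [of x] by linarith
  have "(\<lambda>x. \<Sum>m. c m * x ^ m) = (\<lambda>x. lambert x p)"
    by (simp add: lambert_def c_def)
  moreover have "((\<lambda>x. \<Sum>m. c m * x ^ m) has_field_derivative (\<Sum>m. diffs c m * x ^ m)) (at x)"
  proof (rule termdiffs_strong)
    show "summable (\<lambda>m. c m * of_real r ^ m)" using s [of "of_real r"] r \<open>0 \<le> r\<close> by (simp add: sums_iff)
    show "norm x < norm (of_real r :: complex)" using r by simp
  qed
  ultimately have D: "((\<lambda>x. lambert x p) has_field_derivative (\<Sum>m. diffs c m * x ^ m)) (at x)" by simp
  have "summable (\<lambda>m. diffs c m * x ^ m)"
    by (rule termdiff_converges [OF x]) (use s in \<open>simp add: sums_iff\<close>)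
  then have "(\<lambda>m. x * (diffs c m * x ^ m)) sums (x * (\<Sum>m. diffs c m * x ^ m))"
    by (intro sums_mult summable_sums)
  then have "(\<lambda>m. of_nat (Suc m) * (x ^ Suc m / (1 - p ^ Suc m))) sums (x * (\<Sum>m. diffs c m * x ^ m))"
    by (simp add: diffs_def c_def mult_ac)
  then have "(\<lambda>m. of_nat m * (x ^ m / (1 - p ^ m))) sums (x * (\<Sum>m. diffs c m * x ^ m))"
    by (subst (asm) sums_Suc_iff) simp
  with D show ?thesis by (rule that)
qed

text \<open>\<open>jzeta_eq_lambert\<close> holds on a neighbourhood of each such point of the unit
  circle, so its right-hand side may be differentiated term by term.\<close>

lemma deriv_jzeta:
  assumes p: "norm p < 1" "p \<noteq> 0" and w: "norm (exp w) = 1" "exp w \<noteq> 1"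
  shows "(\<lambda>m. (exp w ^ m + (1 / exp w) ^ m) * (of_nat m * (p ^ m / (1 - p ^ m)))) sums
    (- exp w / (1 - exp w) ^ 2 - deriv (jzeta p) w)"
proof -
  define z where "z = exp w"
  have z: "z \<noteq> 0" "norm z = 1" "z \<noteq> 1" using w by (auto simp: z_def)
  have n: "norm (z * p) < 1" "norm (p / z) < 1" using p z by (simp_all add: norm_mult norm_divide)
  obtain D1 where D1: "((\<lambda>x. lambert x p) has_field_derivative D1) (at (z * p))"
    "(\<lambda>m. of_nat m * ((z * p) ^ m / (1 - p ^ m))) sums (z * p * D1)"
    using DERIV_lambert [OF n(1) p(1)] by blast
  obtain D2 where D2: "((\<lambda>x. lambert x p) has_field_derivative D2) (at (p / z))"
    "(\<lambda>m. of_nat m * ((p / z) ^ m / (1 - p ^ m))) sums (p / z * D2)"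
    using DERIV_lambert [OF n(2) p(1)] by blast
  define S where "S = {w. norm (exp w * p) < 1} \<inter> {w. norm (p / exp w) < 1} \<inter> {w. jsigma p w \<noteq> 0}"
  have opn: "open S"
  proof -
    have "continuous_on UNIV (jsigma p)"
      using holomorphic_jsigma [OF p(1)] by (rule holomorphic_on_imp_continuous_on)
    then show ?thesis unfolding S_def
      by (intro open_Int open_Collect_less open_Collect_neq continuous_intros) auto
  qed
  have wS: "w \<in> S"
  proof -
    have "z * p ^ k \<noteq> 1" for k
    proof (cases k)
      case (Suc m)
      then have "norm (z * p ^ k) < 1" using norm_power_less_one [OF p(1), of k] z by (simp only: norm_mult) simp
      then show ?thesis by force
    qed (use z in simp)
    moreover have "p / z * p ^ k \<noteq> 1" for k
    proof -
      have "norm (p / z * p ^ k) = norm (p ^ Suc k)" using z by (simp add: norm_mult norm_divide)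
      also have "\<dots> < 1" using p by (intro norm_power_less_one) auto
      finally show ?thesis by force
    qed
    ultimately have "jsigma p w \<noteq> 0" unfolding jsigma_eq_0_iff [OF p(1)] z_def by blast
    then show ?thesis using n by (simp add: S_def z_def)
  qed
  have "((\<lambda>w. exp w * p) has_field_derivative z * p) (at w)"
    unfolding z_def by (auto intro!: derivative_eq_intros)
  from DERIV_chain2 [of "\<lambda>x. lambert x p" D1 "\<lambda>w. exp w * p", OF _ this]
  have c1: "((\<lambda>w. lambert (exp w * p) p) has_field_derivative D1 * (z * p)) (at w)"
    using D1(1) by (simp add: z_def)
  have "((\<lambda>w. p / exp w) has_field_derivative - (p / z)) (at w)"
    unfolding z_def by (auto intro!: derivative_eq_intros simp: field_simps)
  from DERIV_chain2 [of "\<lambda>x. lambert x p" D2 "\<lambda>w. p / exp w", OF _ this]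
  have c2: "((\<lambda>w. lambert (p / exp w) p) has_field_derivative D2 * - (p / z)) (at w)"
    using D2(1) by (simp add: z_def)
  have c3: "((\<lambda>w. exp w / (1 - exp w)) has_field_derivative z / (1 - z) ^ 2) (at w)"
    unfolding z_def using w by (auto intro!: derivative_eq_intros simp: field_simps power2_eq_square)
  have "((\<lambda>w. - 1 / 2 - exp w / (1 - exp w) - lambert (exp w * p) p + lambert (p / exp w) p) has_field_derivative
     - z / (1 - z) ^ 2 - D1 * (z * p) - D2 * (p / z)) (at w)"
    by (rule derivative_eq_intros c1 c2 c3 refl)+ simp
  then have "(jzeta p has_field_derivative - z / (1 - z) ^ 2 - D1 * (z * p) - D2 * (p / z)) (at w)"
    by (rule has_field_derivative_transform_within_open [OF _ opn wS]) (auto simp: S_def jzeta_eq_lambert [OF p(1)])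
  then have "deriv (jzeta p) w = - z / (1 - z) ^ 2 - D1 * (z * p) - D2 * (p / z)" by (rule DERIV_imp_deriv)
  moreover have "(\<lambda>m. of_nat m * ((z * p) ^ m / (1 - p ^ m)) + of_nat m * ((p / z) ^ m / (1 - p ^ m))) sums (z * p * D1 + p / z * D2)"
    by (intro sums_add D1 D2)
  moreover have "of_nat m * ((z * p) ^ m / (1 - p ^ m)) + of_nat m * ((p / z) ^ m / (1 - p ^ m)) =
      (z ^ m + (1 / z) ^ m) * (of_nat m * (p ^ m / (1 - p ^ m)))" for m
    by (simp add: power_mult_distrib divide_inverse power_inverse algebra_simps)
  moreover have "z * p * D1 + p / z * D2 = - z / (1 - z) ^ 2 - deriv (jzeta p) w"
    using calculation(1) by simp
  ultimately show ?thesis by (simp only: z_def)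
qed

text \<open>The Legendre symbol modulo 5.\<close>

definition chi5 :: "nat \<Rightarrow> real" where
  "chi5 m = (if m mod 5 = 1 \<or> m mod 5 = 4 then 1 else if m mod 5 = 2 \<or> m mod 5 = 3 then - 1 else 0)"

text \<open>Separability of the quadratic Gauss sum: replacing \<open>zeta5\<close> by
  \<open>zeta5 ^ m\<close> multiplies it by the Legendre symbol of \<open>m\<close>.\<close>

lemma gauss5_chi5: "zeta5 ^ m + zeta5 ^ (4 * m) - zeta5 ^ (2 * m) - zeta5 ^ (3 * m) = gauss5 * of_real (chi5 m)"
proof -
  define r where "r = m mod 5"
  have e: "zeta5 ^ (k * m) = zeta5 ^ ((k * r) mod 5)" for k
    unfolding r_def by (subst zeta5_power_mod) (simp add: mod_mult_right_eq)
  have "r < 5" by (simp add: r_def)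
  then have "r = 0 \<or> r = 1 \<or> r = 2 \<or> r = 3 \<or> r = 4" by auto
  moreover have e1: "zeta5 ^ m = zeta5 ^ r" unfolding r_def by (rule zeta5_power_mod)
  ultimately show ?thesis
    unfolding e e1 chi5_def r_def [symmetric] by (auto simp: gauss5_def simp del: One_nat_def)
qed

text \<open>\<open>jzeta_deriv_diff\<close> at \<open>omega5\<close> and \<open>2 * omega5\<close>
  evaluates to E^5 / (F \<open>gauss5\<close>), with E and F as in the proof, while
  \<open>deriv_jzeta\<close> turns the same difference into a series whose coefficients are Gauss
  sums. One minus five times this series is the logarithmic derivative of R(q)^5, see
  \<open>DERIV_rr_u\<close>.\<close>

theorem eta_quotient_sums:
  assumes q: "norm q < 1" "q \<noteq> 0"
  shows "(\<lambda>m. of_real (chi5 m) * (of_nat m * (q ^ m / (1 - q ^ m)))) sums ((1 - qpoch q q ^ 5 / qpoch (q ^ 5) (q ^ 5)) / 5)"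
proof -
  let ?w = omega5
  define t1 t2 where "t1 = jsigma q ?w" and "t2 = jsigma q (2 * ?w)"
  define E F where "E = qpoch q q" and "F = qpoch (q ^ 5) (q ^ 5)"
  have t: "t1 \<noteq> 0" "t2 \<noteq> 0"
    using jsigma_omega5_nonzero [OF q(1), of 1] jsigma_omega5_nonzero [OF q(1), of 2] by (simp_all add: t1_def t2_def)
  have EF: "E \<noteq> 0" "F \<noteq> 0"
    using qpoch_power_nonzero [OF q(1), of 1 1] qpoch_power_nonzero [OF q(1), of 5 5] by (simp_all add: E_def F_def)
  have ew: "exp ?w = zeta5" "exp (2 * ?w) = zeta5 ^ 2" using exp_omega5 [of 1] exp_omega5 [of 2] by simp_all
  have nz: "norm zeta5 = 1" by (simp add: zeta5_def norm_exp)
  have inv: "1 / zeta5 = zeta5 ^ 4" "1 / zeta5 ^ 2 = zeta5 ^ 3"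
    using zeta5_power_5 by (simp_all add: divide_simps eval_nat_numeral zeta5_def mult_ac)
  have g: "gauss5 \<noteq> 0" using zeta5_relations(1) by auto
  have m: "t1 * t2 * E = - gauss5 * F"
    unfolding t1_def t2_def E_def F_def by (rule jsigma_omega5_mult [OF q(1)])
  have e: "?w + 2 * ?w = 3 * ?w" "?w - 2 * ?w = - ?w" by simp_all
  have "deriv (jzeta q) ?w - deriv (jzeta q) (2 * ?w) =
     qpoch q q ^ 4 * jsigma q (?w + 2 * ?w) * jsigma q (?w - 2 * ?w) / (jsigma q ?w ^ 2 * jsigma q (2 * ?w) ^ 2)"
    by (rule jzeta_deriv_diff [OF q]) (use t in \<open>simp_all add: t1_def t2_def\<close>)
  also have "\<dots> = E ^ 4 * t2 * (- t1) / (t1 ^ 2 * t2 ^ 2)"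
    unfolding e jsigma_omega5 [OF q(1)] jsigma_minus [OF q(1)] E_def t1_def t2_def by simp
  also have "\<dots> = - (E ^ 5) / (t1 * t2 * E)"
    using t EF by (simp add: field_simps eval_nat_numeral)
  also have "\<dots> = E ^ 5 / F / gauss5" unfolding m using g EF by simp
  finally have d: "deriv (jzeta q) ?w - deriv (jzeta q) (2 * ?w) = E ^ 5 / F / gauss5" .
  have "(\<lambda>m. (zeta5 ^ m + (1 / zeta5) ^ m) * (of_nat m * (q ^ m / (1 - q ^ m)))) sums
    (- zeta5 / (1 - zeta5) ^ 2 - deriv (jzeta q) ?w)"
    using deriv_jzeta [OF q, of ?w] zeta5_neq_1 nz by (simp add: ew)
  moreover have "(\<lambda>m. ((zeta5 ^ 2) ^ m + (1 / zeta5 ^ 2) ^ m) * (of_nat m * (q ^ m / (1 - q ^ m)))) sums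
    (- (zeta5 ^ 2) / (1 - zeta5 ^ 2) ^ 2 - deriv (jzeta q) (2 * ?w))"
    using deriv_jzeta [OF q, of "2 * ?w"] zeta5_power_neq_1 [of 2] nz by (simp add: ew norm_power)
  ultimately have "(\<lambda>m. (zeta5 ^ m + (1 / zeta5) ^ m) * (of_nat m * (q ^ m / (1 - q ^ m))) -
      ((zeta5 ^ 2) ^ m + (1 / zeta5 ^ 2) ^ m) * (of_nat m * (q ^ m / (1 - q ^ m)))) sums
     ((- zeta5 / (1 - zeta5) ^ 2 - deriv (jzeta q) ?w) - (- (zeta5 ^ 2) / (1 - zeta5 ^ 2) ^ 2 - deriv (jzeta q) (2 * ?w)))"
    by (rule sums_diff)
  moreover have "(zeta5 ^ m + (1 / zeta5) ^ m) * x - ((zeta5 ^ 2) ^ m + (1 / zeta5 ^ 2) ^ m) * x =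
     gauss5 * (of_real (chi5 m) * x)" for m x
    unfolding inv mult.assoc [symmetric] gauss5_chi5 [symmetric] by (simp add: power_mult [symmetric] algebra_simps)
  moreover have "(- zeta5 / (1 - zeta5) ^ 2 - deriv (jzeta q) ?w) - (- (zeta5 ^ 2) / (1 - zeta5 ^ 2) ^ 2 - deriv (jzeta q) (2 * ?w))
     = gauss5 / 5 - E ^ 5 / F / gauss5"
  proof -
    have "(- a / A - X) - (- b / B - Y) = - (a / A - b / B) - (X - Y)" for a A b B X Y :: complex by simp
    then show ?thesis unfolding d zeta5_relations(6) by (simp only:) (simp add: zeta5_relations(6) d)
  qed
  ultimately have "(\<lambda>m. gauss5 * (of_real (chi5 m) * (of_nat m * (q ^ m / (1 - q ^ m))))) sums (gauss5 / 5 - E ^ 5 / F / gauss5)"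
    by (simp only:)
  from sums_divide [OF this, of gauss5] have "(\<lambda>m. of_real (chi5 m) * (of_nat m * (q ^ m / (1 - q ^ m)))) sums ((gauss5 / 5 - E ^ 5 / F / gauss5) / gauss5)"
    using g by simp
  also have "(gauss5 / 5 - E ^ 5 / F / gauss5) / gauss5 = (1 - E ^ 5 / F) / 5"
  proof -
    have "X / gauss5 / gauss5 = X / 5" for X
      using zeta5_relations(1) by (simp add: power2_eq_square)
    then show ?thesis using g by (simp only: diff_divide_distrib) simp
  qed
  finally show ?thesis by (simp only: E_def F_def)
qed

subsection \<open>The Rogers--Ramanujan continued fraction\<close>

text \<open>The heptagonal numbers r(5r - 3)/2, by a recursion free of subtraction and
  division.\<close>

primrec rr_exponent :: "nat \<Rightarrow> nat" where
  "rr_exponent 0 = 0"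
| "rr_exponent (Suc r) = rr_exponent r + 5 * r + 1"

definition rqfac :: "real \<Rightarrow> nat \<Rightarrow> real" where
  "rqfac q n = (\<Prod>i<n. 1 - q ^ Suc i)"

text \<open>
  With \<open>a = q ^ Suc j\<close> these are the terms of \<open>H\<^sub>2(a)\<close> and \<open>H\<^sub>1(a)\<close> in the proof of the
  Rogers--Ramanujan identities in Hardy and Wright, Section 19.14, up to the common factor
  \<open>\<Prod>n. 1 - q ^ Suc n\<close>; the exponent there is \<open>r * (5 * r + 1) div 2 = rr_exponent r + 2 * r\<close>.
\<close>

definition hw_term2 :: "real \<Rightarrow> nat \<Rightarrow> nat \<Rightarrow> real" where
  "hw_term2 q j r = (- 1) ^ r * q ^ (2 * Suc j * r + rr_exponent r) * (1 - q ^ (2 * Suc j + 4 * r)) * (rqfac q (j + r) / rqfac q r)"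

definition hw_term1 :: "real \<Rightarrow> nat \<Rightarrow> nat \<Rightarrow> real" where
  "hw_term1 q j r = (- 1) ^ r * q ^ (2 * Suc j * r + rr_exponent r + r) * (1 - q ^ (Suc j + 2 * r)) * (rqfac q (j + r) / rqfac q r)"

definition hw_sum :: "real \<Rightarrow> nat \<Rightarrow> real" where
  "hw_sum q j = (\<Sum>r. hw_term2 q j r)"

lemma rqfac_Suc: "rqfac q (Suc n) = rqfac q n * (1 - q ^ Suc n)"
  by (simp add: rqfac_def)

context
  fixes q :: real
  assumes q: "0 < q" "q < 1"
begin

lemma q_power_bounds: "0 \<le> 1 - q ^ n" "1 - q ^ n \<le> 1" "0 < 1 - q ^ Suc n"
proof -
  show "0 \<le> 1 - q ^ n" "1 - q ^ n \<le> 1" using q by (simp_all add: power_le_one)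
  have "q ^ Suc n < 1" using q by (intro power_Suc_less_one) auto
  then show "0 < 1 - q ^ Suc n" by simp
qed

lemma rqfac_bounds: "0 < rqfac q n" "rqfac q n \<le> 1"
  unfolding rqfac_def using q_power_bounds by (auto intro!: prod_pos prod_le_1 simp del: power_Suc)

lemma of_real_rqfac: "of_real (rqfac q n) = qfac (of_real q) n"
  by (simp add: rqfac_def qfac_def)

lemma rqfac_LIMSEQ: obtains L where "0 < L" "rqfac q \<longlonglongrightarrow> L"
proof -
  have n: "norm (complex_of_real q) < 1" using q by simp
  have l: "(\<lambda>n. complex_of_real (rqfac q n)) \<longlonglongrightarrow> qpoch (of_real q) (of_real q)"
    unfolding of_real_rqfac by (rule qfac_LIMSEQ [OF n])
  have "(\<lambda>n. Re (complex_of_real (rqfac q n))) \<longlonglongrightarrow> Re (qpoch (of_real q) (of_real q))"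
    by (intro tendsto_intros l)
  then have r: "rqfac q \<longlonglongrightarrow> Re (qpoch (of_real q) (of_real q))" by (simp add: fun_eq_iff)
  then have "(\<lambda>n. complex_of_real (rqfac q n)) \<longlonglongrightarrow> of_real (Re (qpoch (of_real q) (of_real q)))"
    by (rule tendsto_of_real)
  then have "qpoch (of_real q) (of_real q) = of_real (Re (qpoch (of_real q) (of_real q)))"
    by (rule LIMSEQ_unique [OF l])
  then have nz: "Re (qpoch (of_real q) (of_real q)) \<noteq> 0"
    using qpoch_self_nonzero [OF n] by auto
  have "0 \<le> Re (qpoch (of_real q) (of_real q))"
    by (rule LIMSEQ_le_const [OF r]) (use rqfac_bounds in \<open>auto intro: less_imp_le\<close>)
  with nz have "0 < Re (qpoch (of_real q) (of_real q))" by linarith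
  from that [OF this r] show ?thesis .
qed

lemma rqfac_ratio_bound:
  obtains K where "0 < K" "\<And>j r. \<bar>rqfac q (j + r) / rqfac q r\<bar> \<le> K"
proof -
  obtain L where L: "0 < L" "rqfac q \<longlonglongrightarrow> L" using rqfac_LIMSEQ .
  have "decseq (rqfac q)"
  proof (rule decseq_SucI)
    fix n show "rqfac q (Suc n) \<le> rqfac q n"
      unfolding rqfac_Suc using rqfac_bounds(1) [of n] q_power_bounds(2) [of "Suc n"] by (simp add: mult_le_cancel_left1 del: power_Suc)
  qed
  then have ge: "L \<le> rqfac q n" for n using L by (simp add: decseq_ge)
  have "\<bar>rqfac q (j + r) / rqfac q r\<bar> \<le> 1 / L" for j r
  proof -
    have "rqfac q (j + r) / rqfac q r \<le> 1 / L"
      using rqfac_bounds [of "j + r"] ge [of r] L by (intro frac_le) auto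
    moreover have "0 \<le> rqfac q (j + r) / rqfac q r"
      using rqfac_bounds(1) [of "j + r"] rqfac_bounds(1) [of r] by simp
    ultimately show ?thesis by simp
  qed
  moreover have "0 < 1 / L" using L by simp
  ultimately show ?thesis by (intro that)
qed

text \<open>One geometric majorant, uniform in \<open>j\<close> and in the extra exponents: it
  yields summability of all the series and domination for \<open>j\<close> tending to
  infinity.\<close>

lemma hw_bound:
  obtains K where "\<And>j r e d. \<bar>(- 1) ^ r * q ^ (2 * Suc j * r + e) * (1 - q ^ d) * (rqfac q (j + r) / rqfac q r)\<bar> \<le> K * q ^ r"
    "\<And>j r e. \<bar>(- 1) ^ r * q ^ (2 * Suc j * r + e) * (rqfac q (Suc j + r) / rqfac q r)\<bar> \<le> K * q ^ r"
proof -
  obtain K where K: "0 < K" "\<And>j r. \<bar>rqfac q (j + r) / rqfac q r\<bar> \<le> K" by (rule rqfac_ratio_bound) (rule that)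
  have p: "q ^ (2 * Suc j * r + e) \<le> q ^ r" for j r e
    using q by (intro power_decreasing) auto
  have 2: "\<bar>(- 1) ^ r * q ^ (2 * Suc j * r + e) * (rqfac q (i + r) / rqfac q r)\<bar> \<le> K * q ^ r" for i j r e
  proof -
    have "\<bar>(- 1) ^ r * q ^ (2 * Suc j * r + e) * (rqfac q (i + r) / rqfac q r)\<bar> =
        q ^ (2 * Suc j * r + e) * \<bar>rqfac q (i + r) / rqfac q r\<bar>"
      using q by (simp only: abs_mult power_abs abs_minus_cancel abs_one power_one)
    also have "\<dots> \<le> q ^ r * K" using p K q by (intro mult_mono) auto
    finally show ?thesis by (simp add: mult.commute)
  qed
  have "\<bar>(- 1) ^ r * q ^ (2 * Suc j * r + e) * (1 - q ^ d) * (rqfac q (j + r) / rqfac q r)\<bar> \<le> K * q ^ r" for j r e d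
  proof -
    have "\<bar>(- 1) ^ r * q ^ (2 * Suc j * r + e) * (1 - q ^ d) * (rqfac q (j + r) / rqfac q r)\<bar> =
      \<bar>(- 1) ^ r * q ^ (2 * Suc j * r + e) * (rqfac q (j + r) / rqfac q r)\<bar> * \<bar>1 - q ^ d\<bar>"
      by (simp only: abs_mult mult_ac)
    also have "\<dots> \<le> (K * q ^ r) * 1" using 2 q_power_bounds [of d] K q by (intro mult_mono) auto
    finally show ?thesis by simp
  qed
  from that [OF this 2] show ?thesis .
qed

lemma hw_summable:
  "summable (hw_term2 q j)" "summable (hw_term1 q j)"
  "summable (\<lambda>r. (- 1) ^ r * q ^ (2 * Suc j * r + f r) * (rqfac q (Suc j + r) / rqfac q r))"
proof -
  obtain K where K: "\<And>j r e d. \<bar>(- 1) ^ r * q ^ (2 * Suc j * r + e) * (1 - q ^ d) * (rqfac q (j + r) / rqfac q r)\<bar> \<le> K * q ^ r"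
    "\<And>j r e. \<bar>(- 1) ^ r * q ^ (2 * Suc j * r + e) * (rqfac q (Suc j + r) / rqfac q r)\<bar> \<le> K * q ^ r"
    by (rule hw_bound) (rule that)
  have s: "summable (\<lambda>r. K * q ^ r)" using q by (intro summable_mult summable_geometric) auto
  show "summable (hw_term2 q j)"
    by (rule summable_comparison_test' [OF s, of 0]) (simp only: hw_term2_def real_norm_def K(1))
  show "summable (hw_term1 q j)"
    by (rule summable_comparison_test' [OF s, of 0]) (simp only: hw_term1_def real_norm_def K(1) add.assoc)
  show "summable (\<lambda>r. (- 1) ^ r * q ^ (2 * Suc j * r + f r) * (rqfac q (Suc j + r) / rqfac q r))"
    by (rule summable_comparison_test' [OF s, of 0]) (simp only: real_norm_def K(2))
qed

text \<open>Both contiguous relations split a term into \<open>A r + B r\<close> and then pair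
  \<open>A r\<close> with \<open>B (Suc r)\<close>; \<open>B 0 = 0\<close> makes this shift
  lossless.\<close>

lemma sums_combine:
  fixes A B :: "nat \<Rightarrow> real"
  assumes "summable A" "summable (\<lambda>r. B (Suc r))" "B 0 = 0"
  shows "(\<lambda>r. A r + B r) sums (\<Sum>r. A r + B (Suc r))"
proof -
  have "B sums (\<Sum>r. B (Suc r))"
    using summable_sums [OF assms(2)] assms(3) by (subst (asm) sums_Suc_iff) simp
  then have "(\<lambda>r. A r + B r) sums (suminf A + (\<Sum>r. B (Suc r)))"
    by (intro sums_add summable_sums assms)
  then show ?thesis using suminf_add [OF assms(1,2)] by simp
qed

text \<open>Split \<open>1 - q ^ (Suc j + 2 * r)\<close> as
  \<open>q ^ r * (1 - q ^ Suc (j + r)) + (1 - q ^ r)\<close>. The first factor extends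
  \<open>rqfac q (j + r)\<close>, the second cancels the last factor of \<open>rqfac q r\<close>;
  after the shift the pairs are the terms for \<open>Suc j\<close>.\<close>

lemma hw_sum1: "(\<Sum>r. hw_term1 q j r) = hw_sum q (Suc j)"
proof -
  define A B where "A r = (- 1) ^ r * q ^ (2 * Suc j * r + (rr_exponent r + 2 * r)) * (rqfac q (Suc j + r) / rqfac q r)"
    and "B r = (- 1) ^ r * q ^ (2 * Suc j * r + rr_exponent r + r) * (1 - q ^ r) * (rqfac q (j + r) / rqfac q r)" for r
  have B: "B (Suc r) = - ((- 1) ^ r * q ^ (2 * Suc j * r + (2 * Suc j + rr_exponent r + 6 * r + 2)) * (rqfac q (Suc j + r) / rqfac q r))" for r
  proof -
    have e: "2 * Suc j * Suc r + rr_exponent (Suc r) + Suc r = 2 * Suc j * r + (2 * Suc j + rr_exponent r + 6 * r + 2)"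
      by (simp add: algebra_simps)
    have "B (Suc r) = (- 1) ^ Suc r * q ^ (2 * Suc j * Suc r + rr_exponent (Suc r) + Suc r) * ((1 - q ^ Suc r) * (rqfac q (j + Suc r) / rqfac q (Suc r)))"
      by (simp only: B_def mult.assoc)
    also have "(1 - q ^ Suc r) * (rqfac q (j + Suc r) / rqfac q (Suc r)) = rqfac q (Suc j + r) / rqfac q r"
      using q_power_bounds(3) [of r] by (simp add: rqfac_Suc [of q r] del: power_Suc)
    finally show ?thesis by (simp only: e) simp
  qed
  have eq: "hw_term1 q j r = A r + B r" for r
  proof -
    have "rqfac q (Suc j + r) = rqfac q (j + r) * (1 - q ^ Suc (j + r))" using rqfac_Suc [of q "j + r"] by simp
    show ?thesis unfolding hw_term1_def A_def B_def \<open>rqfac q (Suc j + r) = _\<close>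
      by (simp add: algebra_simps power_add add_divide_distrib diff_divide_distrib eval_nat_numeral)
  qed
  have AB: "A r + B (Suc r) = hw_term2 q (Suc j) r" for r
    unfolding B A_def hw_term2_def by (simp add: algebra_simps power_add eval_nat_numeral)
  have "(\<lambda>r. A r + B r) sums (\<Sum>r. A r + B (Suc r))"
  proof (rule sums_combine)
    show "summable A" unfolding A_def [abs_def] by (rule hw_summable)
    show "summable (\<lambda>r. B (Suc r))" unfolding B by (intro summable_minus hw_summable)
  qed (simp add: B_def)
  then show ?thesis unfolding eq [symmetric] AB hw_sum_def by (rule sums_unique [symmetric])
qed

text \<open>The same device for the difference of the two families: its bracket is
  \<open>(1 - q ^ r) + q ^ (Suc j + 3 * r) * (1 - q ^ Suc (j + r))\<close>. The shifted pairs form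
  \<open>q ^ Suc j\<close> times the first family at \<open>Suc j\<close>, which
  \<open>hw_sum1\<close> sums.\<close>

lemma hw_sum_rec: "hw_sum q j = hw_sum q (Suc j) + q ^ Suc j * hw_sum q (Suc (Suc j))"
proof -
  define A B where "A r = (- 1) ^ r * q ^ (2 * Suc j * r + (rr_exponent r + 3 * r + Suc j)) * (rqfac q (Suc j + r) / rqfac q r)"
    and "B r = (- 1) ^ r * q ^ (2 * Suc j * r + rr_exponent r) * (1 - q ^ r) * (rqfac q (j + r) / rqfac q r)" for r
  have B: "B (Suc r) = - ((- 1) ^ r * q ^ (2 * Suc j * r + (2 * Suc j + rr_exponent r + 5 * r + 1)) * (rqfac q (Suc j + r) / rqfac q r))" for r
  proof -
    have e: "2 * Suc j * Suc r + rr_exponent (Suc r) = 2 * Suc j * r + (2 * Suc j + rr_exponent r + 5 * r + 1)"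
      by (simp add: algebra_simps)
    have "B (Suc r) = (- 1) ^ Suc r * q ^ (2 * Suc j * Suc r + rr_exponent (Suc r)) * ((1 - q ^ Suc r) * (rqfac q (j + Suc r) / rqfac q (Suc r)))"
      by (simp only: B_def mult.assoc)
    also have "(1 - q ^ Suc r) * (rqfac q (j + Suc r) / rqfac q (Suc r)) = rqfac q (Suc j + r) / rqfac q r"
      using q_power_bounds(3) [of r] by (simp add: rqfac_Suc [of q r] del: power_Suc)
    finally show ?thesis by (simp only: e) simp
  qed
  have eq: "hw_term2 q j r - hw_term1 q j r = A r + B r" for r
  proof -
    have "rqfac q (Suc j + r) = rqfac q (j + r) * (1 - q ^ Suc (j + r))" using rqfac_Suc [of q "j + r"] by simp
    show ?thesis unfolding hw_term1_def hw_term2_def A_def B_def \<open>rqfac q (Suc j + r) = _\<close>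
      by (simp add: algebra_simps power_add add_divide_distrib diff_divide_distrib eval_nat_numeral)
  qed
  have AB: "A r + B (Suc r) = q ^ Suc j * hw_term1 q (Suc j) r" for r
    unfolding B A_def hw_term1_def by (simp add: algebra_simps power_add eval_nat_numeral)
  have "(\<lambda>r. A r + B r) sums (\<Sum>r. A r + B (Suc r))"
  proof (rule sums_combine)
    show "summable A" unfolding A_def [abs_def] by (rule hw_summable)
    show "summable (\<lambda>r. B (Suc r))" unfolding B by (intro summable_minus hw_summable)
  qed (simp add: B_def)
  then have "(\<Sum>r. hw_term2 q j r - hw_term1 q j r) = (\<Sum>r. q ^ Suc j * hw_term1 q (Suc j) r)"
    unfolding eq [symmetric] AB by (rule sums_unique [symmetric])
  then show ?thesis
    using hw_sum1 suminf_diff [OF hw_summable(1,2), of j j] suminf_mult [OF hw_summable(2) [of "Suc j"], of "q ^ Suc j"]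
    by (simp add: hw_sum_def del: power_Suc)
qed

text \<open>For growing \<open>j\<close> every term with \<open>r > 0\<close> tends to 0, and the
  term \<open>r = 0\<close> tends to the limit of \<open>rqfac q\<close>, which is positive.\<close>

lemma hw_sum_LIMSEQ: obtains L where "0 < L" "hw_sum q \<longlonglongrightarrow> L"
proof -
  obtain L where L: "0 < L" "rqfac q \<longlonglongrightarrow> L" using rqfac_LIMSEQ .
  obtain K where K: "\<And>j r e d. \<bar>(- 1) ^ r * q ^ (2 * Suc j * r + e) * (1 - q ^ d) * (rqfac q (j + r) / rqfac q r)\<bar> \<le> K * q ^ r"
    "\<And>j r e. \<bar>(- 1) ^ r * q ^ (2 * Suc j * r + e) * (rqfac q (Suc j + r) / rqfac q r)\<bar> \<le> K * q ^ r"
    by (rule hw_bound) (rule that)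
  define b where "b r = (if r = 0 then L else 0)" for r :: nat
  have q0: "(\<lambda>j. q ^ Suc j) \<longlonglongrightarrow> 0" using q by (intro LIMSEQ_Suc LIMSEQ_power_zero) simp
  have "(\<lambda>j. hw_term2 q j r) \<longlonglongrightarrow> b r" for r
  proof -
    have eq: "hw_term2 q j r = (- 1) ^ r * ((q ^ Suc j) ^ (2 * r) * q ^ rr_exponent r) * (1 - (q ^ Suc j) ^ 2 * q ^ (4 * r)) * (rqfac q (j + r) / rqfac q r)" for j
    proof -
      have e1: "q ^ (2 * Suc j * r) = (q ^ Suc j) ^ (2 * r)" and e2: "q ^ (2 * Suc j) = (q ^ Suc j) ^ 2"
        by (simp_all only: power_mult [symmetric] mult_ac)
      show ?thesis by (simp only: hw_term2_def power_add e1 e2)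
    qed
    have "(\<lambda>j. hw_term2 q j r) \<longlonglongrightarrow> (- 1) ^ r * (0 ^ (2 * r) * q ^ rr_exponent r) * (1 - 0 ^ 2 * q ^ (4 * r)) * (L / rqfac q r)"
      unfolding eq using rqfac_bounds(1) [of r] by (intro tendsto_intros q0 LIMSEQ_ignore_initial_segment L) auto
    then show ?thesis by (cases r) (auto simp: b_def rqfac_def)
  qed
  moreover have "eventually (\<lambda>(r, j). norm (hw_term2 q j r) \<le> K * q ^ r) (at_top \<times>\<^sub>F sequentially)"
    by (intro always_eventually) (use K(1) in \<open>simp only: hw_term2_def real_norm_def case_prod_unfold\<close>, simp)
  moreover have "summable (\<lambda>r. K * q ^ r)" using q by (intro summable_mult summable_geometric) auto
  ultimately have "(\<lambda>j. suminf (hw_term2 q j)) \<longlonglongrightarrow> suminf b"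
    by (rule tannerys_theorem [of "\<lambda>r j. hw_term2 q j r" b sequentially "\<lambda>r. K * q ^ r", THEN conjunct2, THEN conjunct2, OF _ _ _ sequentially_bot])
  moreover have "suminf b = L" unfolding b_def by (subst suminf_finite [of "{0}"]) auto
  ultimately show ?thesis using that L by (simp add: hw_sum_def [abs_def])
qed

text \<open>The limit gives positivity for large \<open>j\<close>; the recurrence has positive
  coefficients and carries it downwards.\<close>

lemma hw_sum_pos: "0 < hw_sum q j"
proof -
  obtain L where L: "0 < L" "hw_sum q \<longlonglongrightarrow> L" using hw_sum_LIMSEQ .
  then have "eventually (\<lambda>j. 0 < hw_sum q j) sequentially" by (simp add: order_tendstoD)
  then obtain N where N: "\<And>n. N \<le> n \<Longrightarrow> 0 < hw_sum q n" unfolding eventually_sequentially by blast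
  have "0 < hw_sum q j \<and> 0 < hw_sum q (Suc j)"
  proof (cases "j \<le> N")
    case True
    then show ?thesis
    proof (induction rule: inc_induct)
      case (step n)
      then show ?case using q by (subst hw_sum_rec [of n]) (auto intro!: add_pos_pos mult_pos_pos)
    qed (use N in auto)
  qed (use N in auto)
  then show ?thesis by blast
qed

lemma rr_denom_ge_1: "1 \<le> rr_denom n k q"
proof (induction n arbitrary: k)
  case (Suc n)
  have "0 \<le> q ^ k / rr_denom n (Suc k) q" using Suc [of "Suc k"] q by (intro divide_nonneg_nonneg) auto
  then show ?case by simp
qed simp

text \<open>The ratios \<open>X j\<close> satisfy the recursion of the infinite fraction, and a
  truncation replaces a tail \<open>X (j + n)\<close> by 1. It remains to see that this error dies
  out.\<close>

lemma rr_denom_LIMSEQ: "(\<lambda>n. rr_denom n 1 q) \<longlonglongrightarrow> hw_sum q 0 / hw_sum q 1"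
proof -
  define X where "X j = hw_sum q j / hw_sum q (Suc j)" for j
  have X: "X j = 1 + q ^ Suc j / X (Suc j)" for j
    using hw_sum_pos [of "Suc j"] hw_sum_pos [of "Suc (Suc j)"]
    by (simp add: X_def hw_sum_rec [of j] add_divide_distrib del: power_Suc)
  have Xpos: "0 < X j" for j using hw_sum_pos by (simp add: X_def)
  have X1: "1 \<le> X j" for j
    using Xpos [of "Suc j"] q by (simp add: X [of j] less_imp_le del: power_Suc)
  \<comment> \<open>Both denominators are at least 1, so each level of the fraction multiplies the
    error by at most \<open>q\<close>.\<close>
  have bound: "\<bar>rr_denom n (Suc j) q - X j\<bar> \<le> q ^ n * \<bar>1 - X (j + n)\<bar>" for n j
  proof (induction n arbitrary: j)
    case (Suc n)
    define d where "d = rr_denom n (Suc (Suc j)) q"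
    have d: "1 \<le> d" unfolding d_def by (rule rr_denom_ge_1)
    have "rr_denom (Suc n) (Suc j) q - X j = q ^ Suc j / d - q ^ Suc j / X (Suc j)"
      by (simp only: rr_denom.simps X [of j] d_def add_diff_cancel_left)
    also have "\<dots> = q ^ Suc j * ((X (Suc j) - d) / (d * X (Suc j)))"
      using d Xpos [of "Suc j"] by (simp add: diff_frac_eq right_diff_distrib del: power_Suc)
    also have "\<bar>\<dots>\<bar> = q ^ Suc j * (\<bar>d - X (Suc j)\<bar> / (d * X (Suc j)))"
      using d Xpos [of "Suc j"] q by (simp add: abs_mult abs_minus_commute)
    also have "\<dots> \<le> q * (\<bar>d - X (Suc j)\<bar> / 1)"
    proof (intro mult_mono divide_left_mono)
      show "q ^ Suc j \<le> q" using q power_decreasing [of 1 "Suc j" q] by simp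
      show "1 \<le> d * X (Suc j)" using d X1 [of "Suc j"] mult_mono [of 1 d 1 "X (Suc j)"] by simp
      then show "0 < d * X (Suc j) * 1" by simp
      show "0 \<le> \<bar>d - X (Suc j)\<bar> / (d * X (Suc j))" using d Xpos [of "Suc j"] by simp
    qed (use q in auto)
    also have "\<dots> \<le> q * (q ^ n * \<bar>1 - X (Suc j + n)\<bar>)"
      using Suc.IH [of "Suc j"] q by (simp add: d_def)
    finally show ?case by simp
  qed simp
  obtain L where L: "0 < L" "hw_sum q \<longlonglongrightarrow> L" using hw_sum_LIMSEQ .
  have "X \<longlonglongrightarrow> L / L" unfolding X_def [abs_def] using L by (intro tendsto_intros LIMSEQ_Suc) auto
  then have "(\<lambda>n. q ^ n * \<bar>1 - X n\<bar>) \<longlonglongrightarrow> 0 * \<bar>1 - L / L\<bar>"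
    using q by (intro tendsto_intros LIMSEQ_power_zero) auto
  then have "(\<lambda>n. q ^ n * \<bar>1 - X n\<bar>) \<longlonglongrightarrow> 0" by simp
  then have "(\<lambda>n. rr_denom n 1 q - X 0) \<longlonglongrightarrow> 0"
    by (rule Lim_null_comparison [rotated]) (use bound [of _ 0] in \<open>auto intro!: always_eventually\<close>)
  then show ?thesis by (simp add: X_def LIM_zero_iff)
qed

end

section \<open>Identification of the continued fraction with a theta quotient\<close>

lemma has_sum_int_imp_sums:
  fixes f :: "int \<Rightarrow> complex"
  assumes "(f has_sum S) UNIV"
  shows "(\<lambda>r. f (int r) + f (- int (Suc r))) sums S"
proof -
  let ?A = "range int" and ?B = "range (\<lambda>r. - int (Suc r))"
  have f: "f summable_on UNIV" using assms has_sum_imp_summable by blast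
  have A: "(f has_sum infsum f ?A) ?A" and B: "(f has_sum infsum f ?B) ?B"
    by (intro has_sum_infsum summable_on_subset [OF f]; simp)+
  have "?A \<union> ?B = UNIV"
  proof (intro set_eqI iffI UNIV_I)
    fix x :: int show "x \<in> ?A \<union> ?B" by (cases x rule: int_cases) auto
  qed
  moreover have "?A \<inter> ?B = {}" by auto
  ultimately have S: "S = infsum f ?A + infsum f ?B"
    using has_sum_Un_disjoint [OF A B] has_sum_unique [OF assms] by simp
  have "((\<lambda>r. f (int r)) has_sum infsum f ?A) UNIV" "((\<lambda>r. f (- int (Suc r))) has_sum infsum f ?B) UNIV"
    using A B has_sum_reindex [of int UNIV f] has_sum_reindex [of "\<lambda>r. - int (Suc r)" UNIV f]
    by (simp_all add: o_def inj_on_def)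
  then have "(\<lambda>r. f (int r)) sums infsum f ?A" "(\<lambda>r. f (- int (Suc r))) sums infsum f ?B"
    by (simp_all add: has_sum_imp_sums)
  then show ?thesis unfolding S by (rule sums_add)
qed

lemma rr_exponent_int: "2 * int (rr_exponent r) = 5 * (int r * int r) - 3 * int r"
  by (induction r) (simp_all add: algebra_simps)

text \<open>At \<open>j = 0\<close> the quotient of the \<open>rqfac\<close> is 1, and the terms of
  the two families are the pairs of indices \<open>r\<close>, \<open>- r - 1\<close> in the triple
  product series at \<open>c ^ 3\<close> and \<open>c ^ 4\<close> with base \<open>c ^ 5\<close>.
  \<open>hw_sum q 1\<close> is reached through \<open>hw_sum1\<close>.\<close>

lemma hw_sum_jtheta:
  fixes q :: real
  assumes q: "0 < q" "q < 1"
  defines "c \<equiv> complex_of_real q"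
  shows "of_real (hw_sum q 0) = qpoch (c ^ 5) (c ^ 5) * jtheta (c ^ 2) (c ^ 5)"
    and "of_real (hw_sum q 1) = qpoch (c ^ 5) (c ^ 5) * jtheta c (c ^ 5)"
proof -
  have c: "norm c < 1" "c \<noteq> 0" using q by (simp_all add: c_def)
  have c5: "norm (c ^ 5) < 1" "c ^ 5 \<noteq> 0" using c by (simp_all add: norm_power_less_one)
  have tt: "theta_term (c ^ k) (c ^ 5) n = (- 1) powi n * c powi (int k * n + 5 * (n * (n - 1) div 2))" for k n
  proof -
    have "(- (c ^ k)) powi n = (- 1) powi n * (c powi (int k * n))"
      by (metis mult_minus1 power_int_mult_distrib power_int_mult power_int_of_nat)
    moreover have "(c ^ 5) powi (n * (n - 1) div 2) = c powi (5 * (n * (n - 1) div 2))"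
      by (metis of_nat_numeral power_int_mult power_int_of_nat)
    ultimately show ?thesis using c by (simp add: theta_term_def power_int_add)
  qed
  have pm: "(- 1 :: complex) powi (- int (Suc r)) = - ((- 1) ^ r)" for r
  proof -
    have "(- 1 :: complex) powi (- int (Suc r)) = inverse ((- 1) ^ Suc r)"
      by (simp only: power_int_minus power_int_of_nat)
    also have "\<dots> = - ((- 1) ^ r)" by (cases "even r") auto
    finally show ?thesis .
  qed
  have gen: "theta_term (c ^ k) (c ^ 5) (int r) + theta_term (c ^ k) (c ^ 5) (- int (Suc r)) =
     (- 1) ^ r * c ^ a * (1 - c ^ b)"
    if "2 * int a = 2 * int k * int r + 5 * (int r * (int r - 1))"
       "2 * int (a + b) = 5 * ((int r + 1) * (int r + 2)) - 2 * int k * (int r + 1)" for k r a b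
  proof -
    have "2 * (int r * (int r - 1) div 2) = int r * (int r - 1)" by simp
    then have 1: "int k * int r + 5 * (int r * (int r - 1) div 2) = int a" using that(1) by linarith
    define d where "d = - int (Suc r) * (- int (Suc r) - 1) div 2"
    have "2 * d = - int (Suc r) * (- int (Suc r) - 1)" unfolding d_def by simp
    then have "2 * (int k * - int (Suc r) + 5 * d) = 2 * int (a + b)"
      unfolding that(2) by (simp add: algebra_simps)
    then have 2: "int k * - int (Suc r) + 5 * (- int (Suc r) * (- int (Suc r) - 1) div 2) = int (a + b)"
      by (simp only: d_def mult_cancel_left) simp
    show ?thesis unfolding tt 1 2 pm power_int_of_nat by (simp add: power_add algebra_simps)
  qed
  have h: "(\<lambda>r. complex_of_real (hw_term2 q 0 r)) sums of_real (hw_sum q 0)"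
    unfolding sums_of_real_iff hw_sum_def by (rule summable_sums [OF hw_summable(1) [OF q]])
  have "(\<lambda>r. theta_term (c ^ 3) (c ^ 5) (int r) + theta_term (c ^ 3) (c ^ 5) (- int (Suc r))) sums
      (qpoch (c ^ 5) (c ^ 5) * jtheta (c ^ 3) (c ^ 5))"
    using has_sum_int_imp_sums [OF jacobi_triple_product [OF c5, of "c ^ 3"]] c by simp
  moreover have "theta_term (c ^ 3) (c ^ 5) (int r) + theta_term (c ^ 3) (c ^ 5) (- int (Suc r)) = of_real (hw_term2 q 0 r)" for r
  proof -
    have "theta_term (c ^ 3) (c ^ 5) (int r) + theta_term (c ^ 3) (c ^ 5) (- int (Suc r)) =
       (- 1) ^ r * c ^ (2 * r + rr_exponent r) * (1 - c ^ (2 + 4 * r))"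
      using rr_exponent_int [of r] by (intro gen) (simp_all add: algebra_simps)
    then show ?thesis using rqfac_bounds(1) [OF q, of r] by (simp add: hw_term2_def c_def)
  qed
  ultimately have "(\<lambda>r. complex_of_real (hw_term2 q 0 r)) sums (qpoch (c ^ 5) (c ^ 5) * jtheta (c ^ 3) (c ^ 5))" by simp
  then show "of_real (hw_sum q 0) = qpoch (c ^ 5) (c ^ 5) * jtheta (c ^ 2) (c ^ 5)"
    using sums_unique2 [OF h] jtheta_level_five(3) [OF c(2)] by simp
  have h: "(\<lambda>r. complex_of_real (hw_term1 q 0 r)) sums of_real (hw_sum q 1)"
    using summable_sums [OF hw_summable(2) [OF q, of 0]] hw_sum1 [OF q, of 0] unfolding sums_of_real_iff by simp
  have "(\<lambda>r. theta_term (c ^ 4) (c ^ 5) (int r) + theta_term (c ^ 4) (c ^ 5) (- int (Suc r))) sums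
      (qpoch (c ^ 5) (c ^ 5) * jtheta (c ^ 4) (c ^ 5))"
    using has_sum_int_imp_sums [OF jacobi_triple_product [OF c5, of "c ^ 4"]] c by simp
  moreover have "theta_term (c ^ 4) (c ^ 5) (int r) + theta_term (c ^ 4) (c ^ 5) (- int (Suc r)) = of_real (hw_term1 q 0 r)" for r
  proof -
    have "theta_term (c ^ 4) (c ^ 5) (int r) + theta_term (c ^ 4) (c ^ 5) (- int (Suc r)) =
       (- 1) ^ r * c ^ (2 * r + rr_exponent r + r) * (1 - c ^ (1 + 2 * r))"
      using rr_exponent_int [of r] by (intro gen) (simp_all add: algebra_simps)
    then show ?thesis using rqfac_bounds(1) [OF q, of r] by (simp add: hw_term1_def c_def)
  qed
  ultimately have "(\<lambda>r. complex_of_real (hw_term1 q 0 r)) sums (qpoch (c ^ 5) (c ^ 5) * jtheta (c ^ 4) (c ^ 5))" by simp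
  then show "of_real (hw_sum q 1) = qpoch (c ^ 5) (c ^ 5) * jtheta c (c ^ 5)"
    using sums_unique2 [OF h] jtheta_level_five(4) [OF c(2)] by simp
qed

lemma rr_fraction_eq:
  assumes q: "0 < q" "q < 1"
  shows "rr_fraction q = root 5 q * (hw_sum q 1 / hw_sum q 0)"
proof -
  have "(\<lambda>n. root 5 q / rr_denom n 1 q) \<longlonglongrightarrow> root 5 q / (hw_sum q 0 / hw_sum q 1)"
    using hw_sum_pos [OF q, of 0] hw_sum_pos [OF q, of 1] by (intro tendsto_intros rr_denom_LIMSEQ q) auto
  then have "rr_fraction q = root 5 q / (hw_sum q 0 / hw_sum q 1)"
    unfolding rr_fraction_def by (rule limI)
  then show ?thesis by simp
qed

subsection \<open>Euler's integral for the hypergeometric function\<close>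

text \<open>Expand the last factor by the binomial series and integrate termwise by Beta integrals.
  The binomial series converges absolutely at \<open>\<bar>x\<bar> < 1\<close>, so a constant times
  the Beta weight dominates all partial sums.\<close>

lemma has_integral_hyp_2F1:
  fixes a b c x :: real
  assumes b: "0 < b" and d: "0 < d" and x: "\<bar>x\<bar> < 1"
  shows "((\<lambda>t. t powr (b - 1) * (1 - t) powr (d - 1) * (1 - x * t) powr (- a)) has_integral
     Gamma b * Gamma d / Gamma (b + d) * hyp_2F1 a b (b + d) x) {0..1}"
proof -
  define k where "k n = (- a gchoose n) * (- x) ^ n" for n
  define w where "w t = t powr (b - 1) * (1 - t) powr (d - 1)" for t :: real
  have w0: "0 \<le> w t" for t by (simp add: w_def)
  have kx: "summable (\<lambda>n. \<bar>k n\<bar>)"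
  proof -
    have "summable (\<lambda>n. norm ((- a gchoose n) * (- x) ^ n))"
    proof -
      obtain r where r: "\<bar>x\<bar> < r" "r < 1" using dense x by blast
      have "summable (\<lambda>n. (- a gchoose n) * r ^ n)"
        using gen_binomial_real [of r "- a"] r by (simp add: sums_iff)
      then show ?thesis by (rule powser_insidea) (use r in simp)
    qed
    then show ?thesis by (simp add: k_def)
  qed
  have ser: "(\<lambda>n. k n * t ^ n) sums (1 - x * t) powr (- a)" if "t \<in> {0..1}" for t
  proof -
    have "\<bar>- (x * t)\<bar> \<le> \<bar>x\<bar> * 1" using that unfolding abs_minus_cancel abs_mult by (intro mult_left_mono) auto
    then have "\<bar>- (x * t)\<bar> < 1" using x by linarith
    then have "(\<lambda>n. (- a gchoose n) * (- (x * t)) ^ n) sums (1 + - (x * t)) powr (- a)"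
      by (rule gen_binomial_real)
    moreover have "(- a gchoose n) * (- (x * t)) ^ n = k n * t ^ n" for n
    proof -
      have "- (x * t) = (- x) * t" by simp
      then show ?thesis by (simp only: k_def power_mult_distrib mult.assoc)
    qed
    ultimately show ?thesis by simp
  qed
  have trm: "((\<lambda>t. w t * t ^ n) has_integral Beta (b + n) d) {0..1}" for n
  proof -
    have "((\<lambda>t. t powr (b + n - 1) * (1 - t) powr (d - 1)) has_integral Beta (b + n) d) {0..1}"
      by (rule has_integral_Beta_real) (use b d in auto)
    then show ?thesis
    proof (rule has_integral_spike [of "{0}", rotated 2])
      fix t :: real assume "t \<in> {0..1} - {0}"
      then have "t powr real n = t ^ n" by (intro powr_realpow) auto
      moreover have "b + n - 1 = b - 1 + n" by simp
      ultimately have "t powr (b + n - 1) = t powr (b - 1) * t ^ n" by (simp only: powr_add)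
      then show "w t * t ^ n = t powr (b + n - 1) * (1 - t) powr (d - 1)"
        by (simp add: w_def)
    qed auto
  qed
  define f where "f N t = w t * (\<Sum>n<N. k n * t ^ n)" for N t
  have f: "(f N has_integral (\<Sum>n<N. k n * Beta (b + n) d)) {0..1}" for N
  proof -
    have "((\<lambda>t. \<Sum>n<N. k n * (w t * t ^ n)) has_integral (\<Sum>n<N. k n * Beta (b + n) d)) {0..1}"
      by (intro has_integral_sum has_integral_mult_right trm) auto
    then show ?thesis by (simp add: f_def [abs_def] sum_distrib_left mult_ac)
  qed
  define K where "K = (\<Sum>n. \<bar>k n\<bar>)"
  have bound: "norm (f N t) \<le> K * w t" if "t \<in> {0..1}" for N t
  proof -
    have "\<bar>\<Sum>n<N. k n * t ^ n\<bar> \<le> (\<Sum>n<N. \<bar>k n\<bar>)"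
    proof (rule order_trans [OF sum_abs sum_mono])
      fix n
      have "t ^ n \<le> 1" using that by (simp add: power_le_one)
      then show "\<bar>k n * t ^ n\<bar> \<le> \<bar>k n\<bar>" using that by (simp add: abs_mult mult_left_le)
    qed
    also have "\<dots> \<le> K" unfolding K_def using kx by (intro sum_le_suminf) auto
    finally have "w t * \<bar>\<Sum>n<N. k n * t ^ n\<bar> \<le> w t * K" using w0 by (intro mult_left_mono)
    then show ?thesis using w0 [of t] by (simp add: f_def abs_mult mult.commute)
  qed
  have wi: "(\<lambda>t. K * w t) integrable_on {0..1}"
    using trm [of 0] by (intro integrable_on_mult_right) (auto simp: has_integral_iff)
  have lim: "(\<lambda>N. f N t) \<longlonglongrightarrow> w t * (1 - x * t) powr (- a)" if "t \<in> {0..1}" for t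
    unfolding f_def using ser [OF that] by (intro tendsto_intros) (simp add: sums_def)
  have int: "(\<lambda>t. w t * (1 - x * t) powr (- a)) integrable_on {0..1}"
    and conv: "(\<lambda>N. integral {0..1} (f N)) \<longlonglongrightarrow> integral {0..1} (\<lambda>t. w t * (1 - x * t) powr (- a))"
    using dominated_convergence [OF has_integral_integrable [OF f] wi bound lim] by blast+
  have "integral {0..1} (f N) = (\<Sum>n<N. k n * Beta (b + n) d)" for N
    using f by (rule integral_unique)
  with conv have sums: "(\<lambda>n. k n * Beta (b + n) d) sums integral {0..1} (\<lambda>t. w t * (1 - x * t) powr (- a))"
    by (simp add: sums_def)
  define B where "B = Gamma b * Gamma d / Gamma (b + d)"
  have B: "0 < B" using b d by (simp add: B_def Gamma_real_pos)
  \<comment> \<open>\<open>Beta (b + n) d\<close> supplies the quotient of the Pochhammer symbols of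
    \<open>b\<close> and \<open>b + d\<close>; the signs of \<open>- a gchoose n\<close> and
    \<open>(- x) ^ n\<close> cancel.\<close>
  have tm: "k n * Beta (b + n) d = B * (pochhammer a n * pochhammer b n / pochhammer (b + d) n * (x ^ n / fact n))" for n
  proof -
    have nn: "b \<notin> \<int>\<^sub>\<le>\<^sub>0" "b + d \<notin> \<int>\<^sub>\<le>\<^sub>0" using b d by (auto dest: nonpos_Ints_nonpos)
    have p: "pochhammer b n = Gamma (b + n) / Gamma b" "pochhammer (b + d) n = Gamma (b + d + n) / Gamma (b + d)"
      by (rule pochhammer_Gamma [OF nn(1)], rule pochhammer_Gamma [OF nn(2)])
    have g: "Gamma b > 0" "Gamma (b + d) > 0" "Gamma (b + d + n) > 0" "Gamma (b + n) > 0"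
      using b d by (simp_all add: Gamma_real_pos)
    have "k n = ((- 1) ^ n * (- 1) ^ n) * (pochhammer a n / fact n * x ^ n)"
      unfolding k_def gbinomial_pochhammer power_minus [of x n] by simp
    also have "(- 1 :: real) ^ n * (- 1) ^ n = 1" by (simp flip: power_mult_distrib)
    finally have "k n = pochhammer a n / fact n * x ^ n" by simp
    then show ?thesis unfolding p Beta_def B_def using g by (simp add: field_simps add_ac)
  qed
  have "integral {0..1} (\<lambda>t. w t * (1 - x * t) powr (- a)) = B * hyp_2F1 a b (b + d) x"
  proof -
    have "(\<lambda>n. pochhammer a n * pochhammer b n / pochhammer (b + d) n * (x ^ n / fact n)) sums
       (integral {0..1} (\<lambda>t. w t * (1 - x * t) powr (- a)) / B)"
      using sums_divide [OF sums [unfolded tm], of B] B by simp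
    then show ?thesis using B by (simp add: hyp_2F1_def sums_iff)
  qed
  with int show ?thesis by (simp add: has_integral_iff w_def B_def)
qed

subsection \<open>The function \<open>R(q) ^ 5\<close> on the unit interval\<close>

text \<open>The logarithm of the real product (q^i; q^5), see \<open>exp_qln\<close>. Its termwise
  derivative is a Lambert type series.\<close>

definition qln :: "nat \<Rightarrow> real \<Rightarrow> real" where
  "qln i q = (\<Sum>n. ln (1 - q ^ (n * 5 + i)))"

lemma DERIV_qln:
  fixes q :: real
  assumes q: "0 < q" "q < 1" and i: "0 < i"
  shows "summable (\<lambda>n. ln (1 - q ^ (n * 5 + i)))"
    and "\<exists>D. (qln i has_field_derivative D) (at q) \<and>
      (\<lambda>n. real (n * 5 + i) * (q ^ (n * 5 + i) / (1 - q ^ (n * 5 + i)))) sums (- (q * D))"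
proof -
  \<comment> \<open>A point between \<open>q\<close> and 1: on \<open>{0..r}\<close> every power
    that occurs is at most \<open>r\<close>, so all denominators stay away from 0.\<close>
  define r where "r = (q + 1) / 2"
  have r: "q < r" "r < 1" "0 < r" using q by (simp_all add: r_def)
  define f' where "f' n x = - (real (n * 5 + i) * x ^ (n * 5 + i - 1)) / (1 - x ^ (n * 5 + i))" for n and x :: real
  have lt: "x ^ (n * 5 + i) \<le> r" if "x \<in> {0..r}" for n x
  proof -
    have "x ^ (n * 5 + i) \<le> r ^ (n * 5 + i)" using that by (intro power_mono) auto
    also have "\<dots> \<le> r ^ 1" using r i by (intro power_decreasing) auto
    finally show ?thesis by simp
  qed
  have der: "((\<lambda>x. ln (1 - x ^ (n * 5 + i))) has_field_derivative f' n x) (at x within {0..r})" if "x \<in> {0..r}" for n x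
  proof -
    have "0 < 1 - x ^ (n * 5 + i)" using lt [OF that, of n] r by linarith
    then show ?thesis unfolding f'_def by (auto intro!: derivative_eq_intros simp: field_simps)
  qed
  have unif: "uniformly_convergent_on {0..r} (\<lambda>N x. \<Sum>n<N. f' n x)"
  proof (rule Weierstrass_m_test')
    fix n x assume x: "x \<in> {0..r}"
    have "x ^ (n * 5 + i - 1) \<le> r ^ (n * 5 + i - 1)" using x by (intro power_mono) auto
    also have "\<dots> \<le> r ^ n" using r i by (intro power_decreasing) auto
    finally have "real (n * 5 + i) * x ^ (n * 5 + i - 1) / (1 - x ^ (n * 5 + i)) \<le> real (Suc n * (5 + i)) * r ^ n / (1 - r)"
      using lt [OF x, of n] r x by (intro frac_le mult_mono) (auto simp: algebra_simps)
    moreover have nn: "0 \<le> real (n * 5 + i) * x ^ (n * 5 + i - 1) / (1 - x ^ (n * 5 + i))"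
      using lt [OF x, of n] r x by (intro divide_nonneg_nonneg mult_nonneg_nonneg) auto
    ultimately show "norm (f' n x) \<le> real (Suc n * (5 + i)) * r ^ n / (1 - r)"
      by (simp only: f'_def minus_divide_left [symmetric] norm_minus_cancel real_norm_def abs_of_nonneg [OF nn])
  next
    have "summable (\<lambda>n. (real (5 + i) / (1 - r)) * (of_nat (Suc n) * r ^ n))"
      using geometric_deriv_sums [of r] r by (intro summable_mult) (simp add: sums_iff)
    then show "summable (\<lambda>n. real (Suc n * (5 + i)) * r ^ n / (1 - r))"
      by (simp only: of_nat_mult mult_ac times_divide_eq_left times_divide_eq_right)
  qed
  \<comment> \<open>Every logarithm vanishes at 0; this is the point of convergence from which the
    termwise derivative theorem starts.\<close>
  have z: "(0 :: real) \<in> {0..r}" "summable (\<lambda>n. ln (1 - (0 :: real) ^ (n * 5 + i)))" "q \<in> interior {0..r}"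
    using r q i by (simp_all add: interior_atLeastAtMost_real power_0_left)
  note S = has_field_derivative_series' [OF convex_real_interval(5) der unif z]
  show "summable (\<lambda>n. ln (1 - q ^ (n * 5 + i)))" by (rule S(1))
  have D: "(qln i has_field_derivative (\<Sum>n. f' n q)) (at q)"
    using S(2) unfolding qln_def [abs_def] .
  have qr: "q \<in> {0..r}" using q r by simp
  have "(\<lambda>n. f' n q) sums (\<Sum>n. f' n q)"
    using tendsto_uniform_limitI [OF uniform_limit_suminf [OF unif] qr] by (simp add: sums_def)
  from sums_mult [OF this, of "- q"]
  have "(\<lambda>n. - q * f' n q) sums (- (q * (\<Sum>n. f' n q)))" by simp
  moreover have "- q * f' n q = real (n * 5 + i) * (q ^ (n * 5 + i) / (1 - q ^ (n * 5 + i)))" for n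
  proof -
    have "q * q ^ (n * 5 + i - 1) = q ^ (n * 5 + i)" using i by (simp flip: power_Suc)
    then show ?thesis by (simp add: f'_def mult.left_commute [of q])
  qed
  ultimately show "\<exists>D. (qln i has_field_derivative D) (at q) \<and>
      (\<lambda>n. real (n * 5 + i) * (q ^ (n * 5 + i) / (1 - q ^ (n * 5 + i)))) sums (- (q * D))"
    using D by auto
qed

lemma exp_qln:
  fixes q :: real
  assumes q: "0 < q" "q < 1" and i: "0 < i"
  shows "complex_of_real (exp (qln i q)) = qpoch (of_real q ^ i) (of_real q ^ 5)"
proof (rule LIMSEQ_unique)
  have lt: "q ^ (n * 5 + i) < 1" for n using q i by (simp add: power_less_one_iff)
  have "(\<lambda>N. \<Sum>n<N. ln (1 - q ^ (n * 5 + i))) \<longlonglongrightarrow> qln i q"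
    using summable_LIMSEQ [OF DERIV_qln(1) [OF assms]] by (simp add: qln_def)
  then have "(\<lambda>N. complex_of_real (exp (\<Sum>n<N. ln (1 - q ^ (n * 5 + i))))) \<longlonglongrightarrow> complex_of_real (exp (qln i q))"
    by (intro tendsto_intros)
  moreover have "complex_of_real (exp (\<Sum>n<N. ln (1 - q ^ (n * 5 + i)))) = (\<Prod>n<N. 1 - of_real q ^ i * (of_real q ^ 5) ^ n)" for N
    using lt by (simp add: exp_sum power_add power_mult mult_ac flip: power_mult)
  ultimately show "(\<lambda>N. \<Prod>n<N. 1 - of_real q ^ i * (of_real q ^ 5) ^ n) \<longlonglongrightarrow> complex_of_real (exp (qln i q))" by simp
  show "(\<lambda>N. \<Prod>n<N. 1 - of_real q ^ i * (of_real q ^ 5) ^ n) \<longlonglongrightarrow> qpoch (of_real q ^ i) (of_real q ^ 5)"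
    using q by (intro qpoch_LIMSEQ) (simp add: norm_power power_less_one_iff)
qed

lemma of_real_ramanujan_f:
  fixes q :: real
  assumes q: "0 \<le> q" "q < 1"
  shows "complex_of_real (ramanujan_f (- q)) = qpoch (of_real q) (of_real q)" and "0 < ramanujan_f (- q)"
proof -
  have lt: "q * q ^ n < 1" for n using power_Suc_less_one [of q n] q by (cases "q = 0") auto
  have c: "convergent_prod (\<lambda>n. 1 - q * q ^ n)" using q by (intro convergent_prod_qpoch) simp
  have e: "ramanujan_f (- q) = (\<Prod>n. 1 - q * q ^ n)" by (simp add: ramanujan_f_def)
  have h: "(\<lambda>n. 1 - q * q ^ n) has_prod ramanujan_f (- q)" unfolding e by (rule convergent_prod_has_prod [OF c])
  then show "0 < ramanujan_f (- q)" by (rule has_prod_pos) (use lt in simp)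
  have "(\<lambda>n. complex_of_real (1 - q * q ^ n)) has_prod of_real (ramanujan_f (- q))"
    using h by (simp only: has_prod_of_real_iff)
  then have "(\<lambda>n. 1 - complex_of_real q * of_real q ^ n) has_prod of_real (ramanujan_f (- q))" by simp
  then show "complex_of_real (ramanujan_f (- q)) = qpoch (of_real q) (of_real q)"
    unfolding qpoch_def by (rule has_prod_unique)
qed

text \<open>R(q)^5 as \<open>q\<close> times the fifth power of a theta quotient, in logarithms so
  that it can be differentiated through \<open>DERIV_qln\<close>. \<open>rr_R_eq\<close> confirms
  the identification.\<close>

definition rr_u :: "real \<Rightarrow> real" where
  "rr_u q = q * exp (5 * (qln 1 q + qln 4 q - qln 2 q - qln 3 q))"

context
  fixes q :: real
  assumes q: "0 < q" "q < 1"
begin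

abbreviation (input) "cq \<equiv> complex_of_real q"

lemma norm_cq: "norm cq < 1" "cq \<noteq> 0"
  using q by simp_all

lemma of_real_jtheta:
  "jtheta cq (cq ^ 5) = of_real (exp (qln 1 q + qln 4 q))"
  "jtheta (cq ^ 2) (cq ^ 5) = of_real (exp (qln 2 q + qln 3 q))"
  using exp_qln [OF q, of 1] exp_qln [OF q, of 2] exp_qln [OF q, of 3] exp_qln [OF q, of 4]
  by (simp_all add: jtheta_level_five [OF norm_cq(2)] exp_add)

lemma hw_quotient: "hw_sum q 1 / hw_sum q 0 = exp (qln 1 q + qln 4 q - qln 2 q - qln 3 q)"
proof -
  have "complex_of_real (hw_sum q 1 / hw_sum q 0) = jtheta cq (cq ^ 5) / jtheta (cq ^ 2) (cq ^ 5)"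
    unfolding of_real_divide hw_sum_jtheta [OF q] using qpoch_power_nonzero [OF norm_cq(1), of 5 5] by simp
  also have "\<dots> = complex_of_real (exp (qln 1 q + qln 4 q) / exp (qln 2 q + qln 3 q))"
    unfolding of_real_jtheta of_real_divide ..
  finally have "hw_sum q 1 / hw_sum q 0 = exp (qln 1 q + qln 4 q) / exp (qln 2 q + qln 3 q)"
    by (simp only: of_real_eq_iff)
  then show ?thesis by (simp add: exp_diff exp_add)
qed

lemma rr_R_eq: "rr_R q = root 5 (rr_u q)" and rr_u_pos: "0 < rr_u q" and rr_u_le: "rr_u q \<le> q"
proof -
  define x where "x = qln 1 q + qln 4 q - qln 2 q - qln 3 q"
  have u: "rr_u q = q * exp x ^ 5" by (simp add: rr_u_def x_def exp_of_nat_mult [symmetric])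
  have "rr_R q = root 5 q * exp x"
    unfolding x_def hw_quotient [symmetric] rr_fraction_eq [OF q, symmetric] using q by (simp add: rr_R_def)
  also have "\<dots> = root 5 (rr_u q)" unfolding u real_root_mult by (simp add: real_root_power_cancel)
  finally show "rr_R q = root 5 (rr_u q)" .
  show "0 < rr_u q" using q by (simp add: u)
  \<comment> \<open>The finite fractions are at least 1, hence so is their limit; this bounds the
    theta quotient by 1.\<close>
  have "1 \<le> hw_sum q 0 / hw_sum q 1"
    by (rule LIMSEQ_le_const [OF rr_denom_LIMSEQ [OF q]]) (use rr_denom_ge_1 [OF q] in auto)
  then have "hw_sum q 1 / hw_sum q 0 \<le> 1"
    using hw_sum_pos [OF q, of 0] hw_sum_pos [OF q, of 1] by (simp add: field_simps)
  then have "exp x \<le> 1" by (simp only: hw_quotient x_def)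
  then have "exp x ^ 5 \<le> 1" by (intro power_le_one) auto
  then show "rr_u q \<le> q" using q by (simp add: u)
qed

lemma of_real_rr_u: "complex_of_real (rr_u q) = cq * jtheta cq (cq ^ 5) ^ 5 / jtheta (cq ^ 2) (cq ^ 5) ^ 5"
proof -
  have "5 * (qln 1 q + qln 4 q - qln 2 q - qln 3 q) = of_nat 5 * (qln 1 q + qln 4 q) - of_nat 5 * (qln 2 q + qln 3 q)" by simp
  then have "rr_u q = q * exp (qln 1 q + qln 4 q) ^ 5 / exp (qln 2 q + qln 3 q) ^ 5"
    by (simp only: rr_u_def exp_diff exp_of_nat_mult times_divide_eq_right)
  then show ?thesis unfolding of_real_jtheta by simp
qed

lemma of_real_f: "complex_of_real (ramanujan_f (- q)) = qpoch cq cq" "complex_of_real (ramanujan_f (- (q ^ 5))) = qpoch (cq ^ 5) (cq ^ 5)"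
  and f_pos: "0 < ramanujan_f (- q)" "0 < ramanujan_f (- (q ^ 5))"
  using of_real_ramanujan_f [of q] of_real_ramanujan_f [of "q ^ 5"] q by (simp_all add: power_less_one_iff)

lemma rr_u_relation: "(1 - 11 * rr_u q - rr_u q ^ 2) * (q * ramanujan_f (- (q ^ 5)) ^ 6) = rr_u q * ramanujan_f (- q) ^ 6"
proof -
  have "complex_of_real ((1 - 11 * rr_u q - rr_u q ^ 2) * (q * ramanujan_f (- (q ^ 5)) ^ 6)) = of_real (rr_u q * ramanujan_f (- q) ^ 6)"
    using theta_quotient_relation [OF norm_cq] unfolding of_real_rr_u [symmetric] of_real_f [symmetric] by simp
  then show ?thesis by (simp only: of_real_eq_iff)
qed

text \<open>The quotient is the product of \<open>1 - q ^ m\<close> over all \<open>m\<close> not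
  divisible by 5. Each factor is at most 1, and only the one for \<open>m = 1\<close> is
  kept.\<close>

lemma f_quotient_le: "ramanujan_f (- q) / ramanujan_f (- (q ^ 5)) \<le> 1 - q"
proof -
  have "complex_of_real (ramanujan_f (- q)) = of_real (exp (qln 1 q + qln 4 q) * exp (qln 2 q + qln 3 q) * ramanujan_f (- (q ^ 5)))"
    using qpoch_level_five [OF norm_cq] unfolding of_real_f [symmetric] of_real_jtheta by simp
  then have e: "ramanujan_f (- q) / ramanujan_f (- (q ^ 5)) = exp (qln 1 q + (qln 2 q + qln 3 q + qln 4 q))"
    using f_pos unfolding of_real_eq_iff by (simp add: exp_add)
  have lt: "0 < 1 - q ^ (n * 5 + i)" "1 - q ^ (n * 5 + i) \<le> 1" if "0 < i" for n i
    using q that by (simp_all add: power_less_one_iff)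
  have neg: "qln i q \<le> (\<Sum>n<N. ln (1 - q ^ (n * 5 + i)))" if "0 < i" for i N
  proof -
    have "(\<Sum>n<N. - ln (1 - q ^ (n * 5 + i))) \<le> (\<Sum>n. - ln (1 - q ^ (n * 5 + i)))"
      using DERIV_qln(1) [OF q that] lt [OF that] by (intro sum_le_suminf summable_minus) auto
    then show ?thesis using suminf_minus [OF DERIV_qln(1) [OF q that]] by (simp add: qln_def sum_negf)
  qed
  have "qln 1 q \<le> ln (1 - q)" using neg [of 1 1] by simp
  moreover have "qln 2 q \<le> 0" "qln 3 q \<le> 0" "qln 4 q \<le> 0" using neg [of _ 0] by simp_all
  ultimately have "exp (qln 1 q + (qln 2 q + qln 3 q + qln 4 q)) \<le> exp (ln (1 - q))" by simp
  then show ?thesis using e q by simp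
qed

text \<open>The four derivatives of \<open>qln\<close> carry the signs of \<open>chi5\<close>, so
  the logarithmic derivative of \<open>rr_u\<close> is the series of
  \<open>eta_quotient_sums\<close> grouped into blocks of five.\<close>

lemma DERIV_rr_u: "(rr_u has_field_derivative rr_u q / q * (ramanujan_f (- q) ^ 5 / ramanujan_f (- (q ^ 5)))) (at q)"
proof -
  define A where "A = ramanujan_f (- q) ^ 5 / ramanujan_f (- (q ^ 5))"
  obtain D1 where D1: "(qln 1 has_field_derivative D1) (at q)"
    "(\<lambda>n. real (n * 5 + 1) * (q ^ (n * 5 + 1) / (1 - q ^ (n * 5 + 1)))) sums (- (q * D1))"
    using DERIV_qln(2) [OF q, of 1] by auto
  obtain D2 where D2: "(qln 2 has_field_derivative D2) (at q)"
    "(\<lambda>n. real (n * 5 + 2) * (q ^ (n * 5 + 2) / (1 - q ^ (n * 5 + 2)))) sums (- (q * D2))"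
    using DERIV_qln(2) [OF q, of 2] by auto
  obtain D3 where D3: "(qln 3 has_field_derivative D3) (at q)"
    "(\<lambda>n. real (n * 5 + 3) * (q ^ (n * 5 + 3) / (1 - q ^ (n * 5 + 3)))) sums (- (q * D3))"
    using DERIV_qln(2) [OF q, of 3] by auto
  obtain D4 where D4: "(qln 4 has_field_derivative D4) (at q)"
    "(\<lambda>n. real (n * 5 + 4) * (q ^ (n * 5 + 4) / (1 - q ^ (n * 5 + 4)))) sums (- (q * D4))"
    using DERIV_qln(2) [OF q, of 4] by auto
  define g where "g m = real m * (q ^ m / (1 - q ^ m))" for m
  have "(\<lambda>m. complex_of_real (chi5 m * g m)) sums complex_of_real ((1 - A) / 5)"
    using eta_quotient_sums [OF norm_cq] unfolding of_real_f [symmetric] by (simp add: A_def g_def)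
  then have "(\<lambda>m. chi5 m * g m) sums ((1 - A) / 5)" by (simp only: sums_of_real_iff)
  then have "(\<lambda>n. \<Sum>m = n * 5..<n * 5 + 5. chi5 m * g m) sums ((1 - A) / 5)"
    by (rule sums_group) simp
  moreover have "(\<Sum>m = n * 5..<n * 5 + 5. chi5 m * g m) = g (n * 5 + 1) - g (n * 5 + 2) - g (n * 5 + 3) + g (n * 5 + 4)" for n
  proof -
    have "(\<Sum>m = n * 5..<n * 5 + 5. chi5 m * g m) = (\<Sum>j = 0..<5. chi5 (n * 5 + j) * g (n * 5 + j))"
      using sum.shift_bounds_nat_ivl [of "\<lambda>m. chi5 m * g m" 0 "n * 5" 5] by (simp add: add.commute)
    also have "\<dots> = (\<Sum>j \<in> {0, 1, 2, 3, 4}. chi5 j * g (n * 5 + j))"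
      by (rule sum.cong) (auto simp: chi5_def)
    finally show ?thesis by (simp add: chi5_def)
  qed
  moreover have "(\<lambda>n. g (n * 5 + 1) - g (n * 5 + 2) - g (n * 5 + 3) + g (n * 5 + 4)) sums
     (- (q * D1) - - (q * D2) - - (q * D3) + - (q * D4))"
    unfolding g_def by (intro sums_add sums_diff D1 D2 D3 D4)
  ultimately have s: "(1 - A) / 5 = - (q * D1) - - (q * D2) - - (q * D3) + - (q * D4)"
    by (simp only: sums_unique2)
  have "1 + 5 * q * (D1 + D4 - D2 - D3) = 1 - 5 * (- (q * D1) - - (q * D2) - - (q * D3) + - (q * D4))"
    by (simp add: algebra_simps)
  also have "\<dots> = A" unfolding s [symmetric] by (simp add: diff_divide_distrib)
  finally have A: "1 + 5 * q * (D1 + D4 - D2 - D3) = A" .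
  have "((\<lambda>q. q * exp (5 * (qln 1 q + qln 4 q - qln 2 q - qln 3 q))) has_field_derivative
     exp (5 * (qln 1 q + qln 4 q - qln 2 q - qln 3 q)) * (1 + 5 * q * (D1 + D4 - D2 - D3))) (at q)"
    by (rule derivative_eq_intros D1 D2 D3 D4 refl)+ (simp add: algebra_simps)
  then show ?thesis unfolding A using q by (simp add: rr_u_def [abs_def] A_def)
qed

end

subsection \<open>Evaluation of the integral\<close>

text \<open>The positive zero of \<open>1 - 11 * u - u ^ 2\<close>; the other zero is its negative
  reciprocal.\<close>

definition rr_u1 :: real where
  "rr_u1 = (- 11 + 5 * sqrt 5) / 2"

lemma rr_u1_bounds: "0 < rr_u1" "rr_u1 < 1"
  and rr_u1_mult: "rr_u1 * ((11 + 5 * sqrt 5) / 2) = 1"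
proof -
  have "11 / 5 < sqrt 5" by (rule real_less_rsqrt) (simp add: power2_eq_square)
  moreover have "sqrt 5 < 13 / 5" by (rule real_less_lsqrt) (simp_all add: power2_eq_square)
  ultimately show "0 < rr_u1" "rr_u1 < 1" by (simp_all add: rr_u1_def)
  show "rr_u1 * ((11 + 5 * sqrt 5) / 2) = 1" by (simp add: rr_u1_def field_simps)
qed

lemma rr_u1_factor: "(rr_u1 - u) * ((11 + 5 * sqrt 5) / 2 + u) = 1 - 11 * u - u ^ 2"
proof -
  have "(11 + 5 * sqrt 5) / 2 - rr_u1 = 11" by (simp add: rr_u1_def field_simps)
  moreover have "(a - u) * (b + u) = a * b - (b - a) * u - u ^ 2" for a b :: real
    by (simp add: algebra_simps power2_eq_square)
  ultimately show ?thesis using rr_u1_mult by simp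
qed

text \<open>Factored, \<open>rr_u_relation\<close> equates the distance to \<open>rr_u1\<close>,
  times a factor \<open>v\<close> of at least 1, with \<open>(rr_u q / q) * (E / F) ^ 6\<close>.
  That product is positive, and at most \<open>1 - q\<close> by \<open>rr_u_le\<close> and
  \<open>f_quotient_le\<close>.\<close>

lemma rr_u_bounds:
  assumes q: "0 < q" "q < 1"
  shows "rr_u q < rr_u1" "rr_u1 - (1 - q) \<le> rr_u q"
proof -
  define E F v where "E = ramanujan_f (- q)" and "F = ramanujan_f (- (q ^ 5))" and "v = (11 + 5 * sqrt 5) / 2 + rr_u q"
  have pos: "0 < E" "0 < F" "0 < rr_u q" using f_pos [OF q] rr_u_pos [OF q] by (simp_all add: E_def F_def)
  have "0 \<le> 5 * sqrt 5 / 2" by simp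
  moreover have "v = 11 / 2 + 5 * sqrt 5 / 2 + rr_u q" by (simp add: v_def add_divide_distrib)
  ultimately have v: "1 \<le> v" using pos by linarith
  have "1 - 11 * rr_u q - rr_u q ^ 2 = rr_u q * E ^ 6 / (q * F ^ 6)"
    using rr_u_relation [OF q] q pos by (simp add: eq_divide_eq E_def F_def)
  then have eq: "(rr_u1 - rr_u q) * v = (rr_u q / q) * (E / F) ^ 6"
    unfolding v_def rr_u1_factor by (simp add: power_divide)
  have "0 < (rr_u q / q) * (E / F) ^ 6" using q pos by simp
  then have "0 < (rr_u1 - rr_u q) * v" using eq by simp
  then show lt: "rr_u q < rr_u1" using v by (simp add: zero_less_mult_iff)
  have "(E / F) ^ 6 \<le> (1 - q) ^ 6"
    using f_quotient_le [OF q] pos by (intro power_mono) (simp_all add: E_def F_def)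
  also have "\<dots> \<le> (1 - q) ^ 1" using q by (intro power_decreasing) auto
  finally have "(rr_u q / q) * (E / F) ^ 6 \<le> 1 * (1 - q)"
    using rr_u_le [OF q] pos q by (intro mult_mono) auto
  moreover have "(rr_u1 - rr_u q) * 1 \<le> (rr_u1 - rr_u q) * v" using v lt by (intro mult_left_mono) auto
  ultimately show "rr_u1 - (1 - q) \<le> rr_u q" using eq by simp
qed

lemma rr_u_strict_mono:
  assumes "0 < a" "a < b" "b < 1"
  shows "rr_u a < rr_u b"
proof (rule DERIV_pos_imp_increasing [OF assms(2)])
  fix x assume "a \<le> x" "x \<le> b"
  then have x: "0 < x" "x < 1" using assms by auto
  then have "0 < rr_u x / x * (ramanujan_f (- x) ^ 5 / ramanujan_f (- (x ^ 5)))"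
    using f_pos [OF x] rr_u_pos [OF x] by simp
  with DERIV_rr_u [OF x] show "\<exists>y. (rr_u has_real_derivative y) (at x) \<and> 0 < y" by blast
qed

lemma rr_u_image: "(\<lambda>q. rr_u q / rr_u1) ` {0<..<1} = {0<..<1}"
proof (intro equalityI subsetI)
  fix t assume "t \<in> (\<lambda>q. rr_u q / rr_u1) ` {0<..<1}"
  then show "t \<in> {0<..<1}" using rr_u_bounds(1) rr_u_pos rr_u1_bounds by auto
next
  fix t :: real assume t: "t \<in> {0<..<1}"
  define y where "y = t * rr_u1"
  have y: "0 < y" "y < rr_u1" using t rr_u1_bounds by (auto simp: y_def)
  \<comment> \<open>Witnesses for the intermediate value theorem: \<open>rr_u_le\<close> puts
    \<open>rr_u a\<close> below \<open>y\<close>, and the lower bound in \<open>rr_u_bounds\<close>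
    puts \<open>rr_u b\<close> above it.\<close>
  define a b where "a = y / 2" and "b = 1 - (rr_u1 - y) / 2"
  have ab: "0 < a" "a < b" "b < 1" using y rr_u1_bounds by (simp_all add: a_def b_def field_simps)
  have "rr_u a \<le> y" using rr_u_le [of a] ab y by (simp add: a_def)
  moreover have "y \<le> rr_u b"
  proof -
    have "y \<le> rr_u1 - (1 - b)" using y by (simp add: b_def field_simps)
    also have "\<dots> \<le> rr_u b" using ab by (intro rr_u_bounds(2)) auto
    finally show ?thesis .
  qed
  moreover have "isCont rr_u x" if "a \<le> x" "x \<le> b" for x
    using DERIV_isCont [OF DERIV_rr_u [of x]] that ab by simp
  ultimately obtain x where x: "a \<le> x" "x \<le> b" "rr_u x = y"
    using IVT [of rr_u a y b] ab by auto
  then show "t \<in> (\<lambda>q. rr_u q / rr_u1) ` {0<..<1}"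
    using ab rr_u1_bounds by (intro image_eqI [of _ _ x]) (auto simp: y_def)
qed

section \<open>The value at 1 and the upper limit of integration\<close>

lemma rr_R_1: "rr_R 1 = root 5 rr_u1"
proof -
  have "((\<lambda>q. rr_u1 - (1 - q)) \<longlongrightarrow> rr_u1 - (1 - 1)) (at_left 1)" by (intro tendsto_intros)
  then have "((\<lambda>q. rr_u1 - (1 - q)) \<longlongrightarrow> rr_u1) (at_left 1)" by simp
  moreover have ev: "eventually (\<lambda>q::real. 0 < q \<and> q < 1) (at_left 1)"
    using eventually_at_left_real [of 0 1] by simp
  moreover have "eventually (\<lambda>q. rr_u1 - (1 - q) \<le> rr_u q) (at_left 1)"
    using ev by eventually_elim (simp add: rr_u_bounds)
  moreover have "eventually (\<lambda>q. rr_u q \<le> rr_u1) (at_left 1)"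
    using ev by eventually_elim (simp add: rr_u_bounds less_imp_le)
  ultimately have "(rr_u \<longlongrightarrow> rr_u1) (at_left 1)"
    by (intro tendsto_sandwich [of "\<lambda>q. rr_u1 - (1 - q)" rr_u "at_left 1" "\<lambda>_. rr_u1"]) auto
  then have "((\<lambda>q. root 5 (rr_u q)) \<longlongrightarrow> root 5 rr_u1) (at_left 1)" by (intro tendsto_intros)
  moreover have "eventually (\<lambda>q. root 5 (rr_u q) = rr_fraction q) (at_left 1)"
    using ev
  proof eventually_elim
    case (elim q)
    then show ?case using rr_R_eq [of q] by (simp add: rr_R_def)
  qed
  ultimately have "(rr_fraction \<longlongrightarrow> root 5 rr_u1) (at_left 1)"
    by (rule Lim_transform_eventually)
  then show ?thesis by (simp add: rr_R_def tendsto_Lim)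
qed

text \<open>\<open>inv_into\<close> picks some preimage, so 1 has to be the only one in
  \<open>{0..1}\<close>: at \<open>q = 0\<close> the value is 0, and for \<open>0 < q < 1\<close> it
  lies strictly below.\<close>

lemma rr_R_inv_1: "rr_R_inv (root 5 rr_u1) = 1"
proof -
  have "q = 1" if "q \<in> {0..1}" "rr_R q = root 5 rr_u1" for q
  proof (rule ccontr)
    assume "q \<noteq> 1"
    with that have q: "0 \<le> q" "q < 1" by auto
    have "rr_R q < root 5 rr_u1"
    proof (cases "q = 0")
      case True
      have "rr_fraction 0 = 0" unfolding rr_fraction_def by simp
      then show ?thesis using True rr_u1_bounds by (simp add: rr_R_def)
    next
      case False
      then show ?thesis using q rr_u_bounds(1) [of q] by (simp add: rr_R_eq)
    qed
    with that show False by simp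
  qed
  then show ?thesis unfolding rr_R_inv_def inv_into_def
    by (intro some_equality) (auto simp: rr_R_1)
qed

theorem theorem1:
  fixes \<nu> :: real
  assumes "\<nu> > 0"
  shows "((\<lambda>q. ramanujan_f (- q) ^ 4 * q powr (- 5 / 6) * rr_R q powr (5 * \<nu>)) has_integral
      Gamma (5 / 6) * ((11 + 5 * sqrt 5) / 2) powr (- 1 / 6 - \<nu>)
        * (Gamma (1 / 6 + \<nu>) / Gamma (1 + \<nu>))
        * hyp_2F1 (1 / 6) (1 / 6 + \<nu>) (1 + \<nu>) ((11 - 5 * sqrt 5) / (11 + 5 * sqrt 5)))
    {0..rr_R_inv (root 5 ((- 11 + 5 * sqrt 5) / 2))}"
proof -
  define u2 x where "u2 = (11 + 5 * sqrt 5) / 2" and "x = (11 - 5 * sqrt 5) / (11 + 5 * sqrt 5)"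
  have u12: "rr_u1 * u2 = 1" unfolding u2_def by (rule rr_u1_mult)
  have u2: "0 < u2" by (simp add: u2_def add_pos_nonneg)
  have "(a / 2) / (b / 2) = a / b" for a b :: real by simp
  then have "rr_u1 / u2 = (- 11 + 5 * sqrt 5) / (11 + 5 * sqrt 5)" by (simp only: rr_u1_def u2_def)
  then have x: "x = - (rr_u1 / u2)" by (simp add: x_def minus_divide_left)
  \<comment> \<open>\<open>u12\<close> makes the argument of the hypergeometric function equal to
    \<open>- rr_u1 ^ 2\<close>, inside the disc of convergence.\<close>
  have "rr_u1 / u2 = rr_u1 * rr_u1" using u12 u2 by (simp add: field_simps)
  also have "\<dots> < 1 * 1" using rr_u1_bounds by (intro mult_strict_mono) auto
  finally have ax: "\<bar>x\<bar> < 1" using rr_u1_bounds u2 by (simp add: x)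
  \<comment> \<open>Euler's integrand with \<open>a = 1 / 6\<close>,
    \<open>b = 1 / 6 + \<nu>\<close>, \<open>d = 5 / 6\<close>; the constant compensates for the
    scaling \<open>t = u / rr_u1\<close>.\<close>
  define \<phi> where "\<phi> t = rr_u1 powr (\<nu> + 1 / 6) * (t powr (1 / 6 + \<nu> - 1) * (1 - t) powr (5 / 6 - 1) * (1 - x * t) powr (- (1 / 6)))" for t
  define I where "I = rr_u1 powr (\<nu> + 1 / 6) * (Gamma (1 / 6 + \<nu>) * Gamma (5 / 6) / Gamma (1 / 6 + \<nu> + 5 / 6) * hyp_2F1 (1 / 6) (1 / 6 + \<nu>) (1 / 6 + \<nu> + 5 / 6) x)"
  have "(\<phi> has_integral I) {0..1}"
    unfolding \<phi>_def [abs_def] I_def using assms ax by (intro has_integral_mult_right has_integral_hyp_2F1) auto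
  \<comment> \<open>The substitution is differentiable and onto only between open intervals; the
    endpoints do not affect the integral.\<close>
  then have "(\<phi> has_integral I) {0<..<1}" by (simp add: has_integral_Icc_iff_Ioo)
  \<comment> \<open>Nonnegativity upgrades integrability to absolute integrability, which the change
    of variables works with.\<close>
  moreover have "0 \<le> \<phi> t" for t by (simp add: \<phi>_def)
  ultimately have \<phi>: "\<phi> absolutely_integrable_on {0<..<1} \<and> integral {0<..<1} \<phi> = I"
    by (auto simp: has_integral_iff intro: nonnegative_absolutely_integrable_1)
  define g g' where "g q = rr_u q / rr_u1" and "g' q = rr_u q / q * (ramanujan_f (- q) ^ 5 / ramanujan_f (- (q ^ 5))) / rr_u1" for q
  have img: "g ` {0<..<1} = {0<..<1}" unfolding g_def by (rule rr_u_image)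
  have "inj_on g {0<..<1}"
  proof (rule linorder_inj_onI')
    fix a b :: real assume "a \<in> {0<..<1}" "b \<in> {0<..<1}" "a < b"
    then show "g a \<noteq> g b" using rr_u_strict_mono [of a b] rr_u1_bounds by (simp add: g_def)
  qed
  moreover have "(g has_field_derivative g' q) (at q within {0<..<1})" if "q \<in> {0<..<1}" for q
    unfolding g_def g'_def using that by (intro DERIV_cdivide has_field_derivative_at_within [OF DERIV_rr_u]) auto
  ultimately have "(\<lambda>q. \<bar>g' q\<bar> * \<phi> (g q)) absolutely_integrable_on {0<..<1} \<and>
      integral {0<..<1} (\<lambda>q. \<bar>g' q\<bar> * \<phi> (g q)) = I"
    using has_absolute_integral_change_of_variables_1' [of "{0<..<1}" g g' \<phi> I] \<phi> unfolding img by auto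
  then have "((\<lambda>q. \<bar>g' q\<bar> * \<phi> (g q)) has_integral I) {0<..<1}"
    by (auto simp: has_integral_iff absolutely_integrable_on_def)
  moreover have "\<bar>g' q\<bar> * \<phi> (g q) = ramanujan_f (- q) ^ 4 * q powr (- 5 / 6) * rr_R q powr (5 * \<nu>)" if "q \<in> {0<..<1}" for q
  proof -
    have q: "0 < q" "q < 1" using that by auto
    define u E F where "u = rr_u q" and "E = ramanujan_f (- q)" and "F = ramanujan_f (- (q ^ 5))"
    have pos: "0 < u" "0 < E" "0 < F" using rr_u_pos [OF q] f_pos [OF q] by (simp_all add: u_def E_def F_def)
    \<comment> \<open>With all quantities positive, the identity of the integrands becomes linear in
      these logarithms; \<open>f\<close> cancels.\<close>
    define m e f s where "m = ln u" and "e = ln E" and "f = ln F" and "s = ln q"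
    have ex: "u = exp m" "E = exp e" "F = exp f" "q = exp s"
      using pos q by (simp_all add: m_def e_def f_def s_def)
    have pw: "exp y ^ n = exp (of_nat n * y)" for y :: real and n by (rule exp_of_nat_mult [symmetric])
    define w where "w = 1 - 11 * u - u ^ 2"
    have "w * (q * F ^ 6) = u * E ^ 6"
      unfolding w_def u_def E_def F_def by (rule rr_u_relation [OF q])
    then have "w = u * E ^ 6 / (q * F ^ 6)" using pos q by (simp add: eq_divide_eq)
    also have "\<dots> = exp (m + 6 * e - s - 6 * f)"
      unfolding ex pw by (simp add: exp_add exp_diff)
    finally have w: "w = exp (m + 6 * e - s - 6 * f)" .
    have t: "0 < g q" "g q < 1" using rr_u_bounds(1) [OF q] pos rr_u1_bounds by (simp_all add: g_def u_def)
    \<comment> \<open>The exponents \<open>5 / 6 - 1\<close> and \<open>- (1 / 6)\<close> agree, so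
      the two factors merge into a power of \<open>w\<close>.\<close>
    have "(1 - g q) * (1 - x * g q) = (rr_u1 - u) * (u2 + u) / (rr_u1 * u2)"
      using rr_u1_bounds u2 by (simp add: g_def x u_def field_simps)
    also have "\<dots> = w" by (simp only: u12 div_by_1 w_def rr_u1_factor [folded u2_def])
    finally have "(1 - g q) powr (5 / 6 - 1) * (1 - x * g q) powr (- (1 / 6)) = w powr (- (1 / 6))"
      using powr_mult [of "1 - g q" "1 - x * g q" "- (1 / 6)"] by simp
    moreover have "rr_u1 powr (\<nu> + 1 / 6) * g q powr (1 / 6 + \<nu> - 1) = rr_u1 * u powr (1 / 6 + \<nu> - 1)"
    proof -
      have "rr_u1 powr (\<nu> + 1 / 6) = rr_u1 powr (1 / 6 + \<nu> - 1) * rr_u1"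
        using rr_u1_bounds powr_add [of rr_u1 "1 / 6 + \<nu> - 1" 1] by (simp add: add.commute)
      moreover have "g q powr (1 / 6 + \<nu> - 1) = u powr (1 / 6 + \<nu> - 1) / rr_u1 powr (1 / 6 + \<nu> - 1)"
        using pos rr_u1_bounds by (simp add: g_def u_def powr_divide)
      ultimately show ?thesis using rr_u1_bounds by simp
    qed
    ultimately have "\<phi> (g q) = rr_u1 * u powr (1 / 6 + \<nu> - 1) * w powr (- (1 / 6))"
      unfolding \<phi>_def by (simp add: mult.assoc [symmetric])
    moreover have "\<bar>g' q\<bar> = u / q * (E ^ 5 / F) / rr_u1"
      using pos q rr_u1_bounds by (simp add: g'_def u_def E_def F_def)
    ultimately have "\<bar>g' q\<bar> * \<phi> (g q) = u / q * (E ^ 5 / F) * (u powr (1 / 6 + \<nu> - 1) * w powr (- (1 / 6)))"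
      using rr_u1_bounds by simp
    also have "\<dots> = exp (m - s + (5 * e - f) + (m * (1 / 6 + \<nu> - 1) + (m + 6 * e - s - 6 * f) * (- (1 / 6))))"
      unfolding w ex exp_powr_real pw of_nat_numeral by (simp only: exp_add exp_diff)
    also have "m - s + (5 * e - f) + (m * (1 / 6 + \<nu> - 1) + (m + 6 * e - s - 6 * f) * (- (1 / 6))) = 4 * e + s * (- 5 / 6) + m * \<nu>"
      by (simp add: field_simps)
    also have "exp (4 * e + s * (- 5 / 6) + m * \<nu>) = E ^ 4 * q powr (- 5 / 6) * u powr \<nu>"
      unfolding ex exp_powr_real pw of_nat_numeral by (simp only: exp_add)
    also have "u powr \<nu> = rr_R q powr (5 * \<nu>)"
      using pos by (simp add: rr_R_eq [OF q] root_powr_inverse powr_powr u_def)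
    finally show ?thesis unfolding E_def .
  qed
  ultimately have "((\<lambda>q. ramanujan_f (- q) ^ 4 * q powr (- 5 / 6) * rr_R q powr (5 * \<nu>)) has_integral I) {0<..<1}"
    by (rule has_integral_eq [rotated])
  then have *: "((\<lambda>q. ramanujan_f (- q) ^ 4 * q powr (- 5 / 6) * rr_R q powr (5 * \<nu>)) has_integral I) {0..1}"
    by (simp add: has_integral_Icc_iff_Ioo)
  have "rr_u1 powr (\<nu> + 1 / 6) = u2 powr (- 1 / 6 - \<nu>)"
  proof -
    have "rr_u1 = inverse u2" using u12 u2 by (simp add: inverse_eq_divide eq_divide_eq)
    moreover have "inverse u2 powr (\<nu> + 1 / 6) = inverse (u2 powr (\<nu> + 1 / 6))"
      using u2 by (intro inverse_powr)
    ultimately have "rr_u1 powr (\<nu> + 1 / 6) = u2 powr (- (\<nu> + 1 / 6))"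
      by (simp only: powr_minus)
    also have "- (\<nu> + 1 / 6) = - 1 / 6 - \<nu>" by simp
    finally show ?thesis .
  qed
  moreover have "1 / 6 + \<nu> + 5 / 6 = 1 + \<nu>" by simp
  ultimately have "I = Gamma (5 / 6) * u2 powr (- 1 / 6 - \<nu>) * (Gamma (1 / 6 + \<nu>) / Gamma (1 + \<nu>)) * hyp_2F1 (1 / 6) (1 / 6 + \<nu>) (1 + \<nu>) x"
    unfolding I_def by simp
  then show ?thesis
    using * rr_R_inv_1 unfolding rr_u1_def u2_def x_def by simp
qed

end
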